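(* Let $(\Sigma,\mu)$ be a non-atomic $\sigma$-finite measure space with $\mu(\Sigma)>0$. Let $\mathcal{B}$ be a Muckenhoupt basis such that $A_{\infty,\mathcal{B}}\subset\bigcup_{s>1}RH_{s,\mathcal{B}}$, let $\mathcal{F}$ be a family of extrapolation pairs, and let $1\le\mathfrak{p}_-<\mathfrak{p}_+\le\infty$. Assume that for some $\mathfrak{p}_0\in[\mathfrak{p}_-,\mathfrak{p}_+]$, $\mathfrak{p}_0<\infty$, and for every $w_0\in A_{\mathfrak{p}_0/\mathfrak{p}_-,\mathcal{B}}\cap RH_{(\mathfrak{p}_+/\mathfrak{p}_0)',\mathcal{B}}$ there holds $$\|f\|_{L^{\mathfrak{p}_0}(\Sigma,w_0)}\le C\|g\|_{L^{\mathfrak{p}_0}(\Sigma,w_0)},\qquad(f,g)\in\mathcal{F},$$ where $C$ does not depend on $(f,g)$ and depends on $w_0$ only through its $A_{\mathfrak{p}_0/\mathfrak{p}_-,\mathcal{B}}$ and $RH_{(\mathfrak{p}_+/\mathfrak{p}_0)',\mathcal{B}}$ constants (non-decreasingly). Let $\mathbb{X}$ be a rearrangement invariant Banach function space over $(\Sigma,\mu)$ such that $\mathbb{X}^{\frac1r}$ is a Banach function space for some $r>\mathfrak{p}_-$ and $\mathfrak{p}_-<p_{\mathbb{X}}\le q_{\mathbb{X}}<\mathfrak{p}_+$, where $p_{\mathbb{X}},q_{\mathbb{X}}$ are the Boyd indices of $\mathbb{X}$. Then for every $\mathcal{B}$-weight $u$ with $$u^{p_{\mathbb{X}}}\in A_{p_{\mathbb{X}}/\mathfrak{p}_-,\mathcal{B}}\cap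 RH_{(\mathfrak{p}_+/p_{\mathbb{X}})',\mathcal{B}}\quad\text{and}\quad u^{q_{\mathbb{X}}}\in A_{q_{\mathbb{X}}/\mathfrak{p}_-,\mathcal{B}}\cap RH_{(\mathfrak{p}_+/q_{\mathbb{X}})',\mathcal{B}}$$ there is a constant $C<\infty$ such that $$\|fu\|_{\mathbb{X}}\le C\|gu\|_{\mathbb{X}},\qquad(f,g)\in\mathcal{F}.$$
   Context: Non-atomic: every measurable $F$ with $\mu(F)>0$ contains a measurable $F'$ with $0<\mu(F')<\mu(F)$. A basis $\mathcal{B}$ is a collection of $\mu$-measurable sets with $0<\mu(B)<\infty$; standing assumption: $\mu(\Sigma\setminus\bigcup_{B\in\mathcal{B}}B)=0$. $M_{\mathcal{B}}f(x)=\sup_{x\in B\in\mathcal{B}}\frac1{\mu(B)}\int_B|f|\,d\mu$. A $\mathcal{B}$-weight is a $\mu$-measurable $w$ with $0<w<\infty$ $\mu$-a.e.; $L^p(\Sigma,w)=L^p(\Sigma,w\,d\mu)$. For $1<p<\infty$, $w\in A_{p,\mathcal{B}}$ iff $[w]_{A_{p,\mathcal{B}}}=\sup_{B}\big(\frac1{\mu(B)}\int_Bw\,d\mu\big)\big(\frac1{\mu(B)}\int_Bw^{1-p'}d\mu\big)^{p-1}<\infty$; $w\in A_{1,\mathcal{B}}$ iff $[w]_{A_{1,\mathcal{B}}}=\|(M_{\mathcal{B}}w)w^{-1}\|_{L^\infty(\Sigma,\mu)}<\infty$; $A_{\infty,\mathcal{B}}=\bigcup_{p\ge1}A_{p,\mathcal{B}}$.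 For $1<s<\infty$, $w\in RH_{s,\mathcal{B}}$ iff $[w]_{RH_{s,\mathcal{B}}}=\sup_B\big(\frac1{\mu(B)}\int_Bw^sd\mu\big)^{1/s}\big(\frac1{\mu(B)}\int_Bw\,d\mu\big)^{-1}<\infty$; $w\in RH_{\infty,\mathcal{B}}$ iff $\sup_B\|w\mathbf{1}_B\|_{L^\infty(\Sigma,\mu)}\big(\frac1{\mu(B)}\int_Bw\,d\mu\big)^{-1}<\infty$; $RH_{1,\mathcal{B}}$ imposes no condition. Primes denote Hölder conjugates, with $1'=\infty$, $\infty'=1$ and $\infty/p=\infty$ for $p<\infty$. $\mathcal{B}$ is a Muckenhoupt basis if for all $p\in(1,\infty)$ and $w\in A_{p,\mathcal{B}}$, $\|M_{\mathcal{B}}f\|_{L^p(\Sigma,w)}\le C\|f\|_{L^p(\Sigma,w)}$. Function norm over $(\Sigma,\mu)$: a map $\|\cdot\|$ from $\mu$-measurable functions to $[0,\infty]$ with: (i) $\|f\|=\||f|\|$, and $\|f\|=0$ iff $f=0$ a.e.; (ii) $\|f+g\|\le\|f\|+\|g\|$; (iii) $\|\lambda f\|=|\lambda|\|f\|$; (iv) $|f|\le|g|$ a.e. implies $\|f\|\le\|g\|$; (v) $|f_j|\uparrow|f|$ a.e. implies $\|f_j\|\uparrow\|f\|$; (vi) if $\mu(E)<\infty$ then $\|\mathbf{1}_E\|<\infty$ and $\int_E|f|d\mu\le C_E\|f\|$. $\mathbb{X}=\{f:\|f\|<\infty\}$ is a Banach function space. For $r>0$, $\mathbb{X}^r=\{f:|f|^r\in\mathbb{X}\}$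 with $\|f\|_{\mathbb{X}^r}=\||f|^r\|_{\mathbb{X}}^{1/r}$. $\mathbb{X}$ is rearrangement invariant if $\|f\|_{\mathbb{X}}=\|g\|_{\mathbb{X}}$ whenever $f,g$ have the same distribution function. Then (Luxemburg) there is a rearrangement invariant Banach function space $\overline{\mathbb{X}}$ over $[0,\mu(\Sigma))$ with $\|f\|_{\mathbb{X}}=\|f^*_\mu\|_{\overline{\mathbb{X}}}$, $f^*_\mu$ being the decreasing rearrangement. With the dilation $D_tf(s)=f(s/t)$ for $0\le s\le\mu(\Sigma)\min\{1,t\}$ and $0$ for larger $s\le \mu(\Sigma)$, the Boyd indices are $p_{\mathbb{X}}=\lim_{t\to\infty}\frac{\log t}{\log\|D_t\|_{\overline{\mathbb{X}}\to\overline{\mathbb{X}}}}$ and $q_{\mathbb{X}}=\lim_{t\to0^+}\frac{\log t}{\log\|D_t\|_{\overline{\mathbb{X}}\to\overline{\mathbb{X}}}}$, so $1\le p_{\mathbb{X}}\le q_{\mathbb{X}}\le\infty$. A family of extrapolation pairs $\mathcal{F}$ is a collection of pairs $(f,g)$ of nonnegative measurable functions. *)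

theory Defs
  imports "HOL-Analysis.Analysis"
begin

text \<open>
  Every norm below depends on a measurable function f only through its absolute value. Measurable
  functions are therefore represented by their absolute values, of type \<^typ>\<open>'a \<Rightarrow> ennreal\<close>; this
  also makes the rearrangement and the maximal function, which may take the value infinity,
  functions of the same kind. Weights are real valued: they are finite almost everywhere, and
  nothing below depends on their values on a null set.
\<close>

text \<open>Powers on the extended half line, meant only for exponents a > 0.\<close>

definition ennpowr :: "ennreal \<Rightarrow> real \<Rightarrow> ennreal" where
  "ennpowr x a = (if x = \<infinity> then \<infinity> else ennreal (enn2real x powr a))"

definition holder_conj :: "ereal \<Rightarrow> ereal" where
  "holder_conj p = (if p = 1 then \<infinity> else if p = \<infinity> then 1 else p / (p - 1))"

definition nonatomic :: "'a measure \<Rightarrow> bool" where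
  "nonatomic M \<longleftrightarrow> (\<forall>F\<in>sets M. 0 < emeasure M F \<longrightarrow>
     (\<exists>F'\<in>sets M. F' \<subseteq> F \<and> 0 < emeasure M F' \<and> emeasure M F' < emeasure M F))"

definition Lp_norm :: "'a measure \<Rightarrow> real \<Rightarrow> ('a \<Rightarrow> ennreal) \<Rightarrow> ennreal" where
  "Lp_norm M p f = ennpowr (\<integral>\<^sup>+x. ennpowr (f x) p \<partial>M) (1 / p)"

text \<open>For measurable f this is the essential supremum; unlike \<open>esssup\<close>, it also makes sense for
  functions that are measurable only with respect to the completion of M.\<close>

definition Linf_norm :: "'a measure \<Rightarrow> ('a \<Rightarrow> ennreal) \<Rightarrow> ennreal" where
  "Linf_norm M f = Inf {C. AE x in M. f x \<le> C}"


section \<open>Bases, maximal operators and weights\<close>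

text \<open>The condition that the complement of the union of the basis is null is expressed with
  \<open>AE\<close>, since \<open>emeasure\<close> is 0 on non-measurable sets.\<close>

definition is_basis :: "'a measure \<Rightarrow> 'a set set \<Rightarrow> bool" where
  "is_basis M \<B> \<longleftrightarrow>
     (\<forall>B\<in>\<B>. B \<in> sets M \<and> 0 < emeasure M B \<and> emeasure M B < \<infinity>) \<and>
     (AE x in M. x \<in> \<Union>\<B>)"

definition average :: "'a measure \<Rightarrow> 'a set \<Rightarrow> ('a \<Rightarrow> ennreal) \<Rightarrow> ennreal" where
  "average M B f = (\<integral>\<^sup>+x\<in>B. f x \<partial>M) / emeasure M B"

definition maximal :: "'a measure \<Rightarrow> 'a set set \<Rightarrow> ('a \<Rightarrow> ennreal) \<Rightarrow> 'a \<Rightarrow> ennreal" where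
  "maximal M \<B> f x = (SUP B\<in>{B\<in>\<B>. x \<in> B}. average M B f)"

definition weight :: "'a measure \<Rightarrow> ('a \<Rightarrow> real) \<Rightarrow> bool" where
  "weight M w \<longleftrightarrow> w \<in> borel_measurable M \<and> (AE x in M. 0 < w x)"

text \<open>For p > 1, the exponent 1 - p' is 1 - p / (p - 1).\<close>

definition A_const :: "'a measure \<Rightarrow> 'a set set \<Rightarrow> real \<Rightarrow> ('a \<Rightarrow> real) \<Rightarrow> ennreal" where
  "A_const M \<B> p w =
     (if p = 1 then Linf_norm M (\<lambda>x. maximal M \<B> (\<lambda>y. ennreal (w y)) x * inverse (ennreal (w x)))
      else (SUP B\<in>\<B>. average M B (\<lambda>x. ennreal (w x)) *
              ennpowr (average M B (\<lambda>x. ennreal (w x powr (1 - p / (p - 1))))) (p - 1)))"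

definition A_class :: "'a measure \<Rightarrow> 'a set set \<Rightarrow> real \<Rightarrow> ('a \<Rightarrow> real) set" where
  "A_class M \<B> p = {w. weight M w \<and> A_const M \<B> p w < \<infinity>}"

definition A_infty :: "'a measure \<Rightarrow> 'a set set \<Rightarrow> ('a \<Rightarrow> real) set" where
  "A_infty M \<B> = (\<Union>p\<in>{1..}. A_class M \<B> p)"

text \<open>The case s = 1 imposes no condition; its constant is set to 1. If the average of w over some
  B is infinite, the quotients below are not meaningful, but such a w lies in none of the classes
  \<open>A_class M \<B> p\<close>, with which the reverse Hoelder classes are always combined.\<close>

definition RH_const :: "'a measure \<Rightarrow> 'a set set \<Rightarrow> ereal \<Rightarrow> ('a \<Rightarrow> real) \<Rightarrow> ennreal" where
  "RH_const M \<B> s w =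
     (if s = 1 then 1
      else if s = \<infinity> then
        (SUP B\<in>\<B>. Linf_norm M (\<lambda>x. ennreal (w x) * indicator B x) / average M B (\<lambda>x. ennreal (w x)))
      else
        (SUP B\<in>\<B>. ennpowr (average M B (\<lambda>x. ennreal (w x powr real_of_ereal s))) (1 / real_of_ereal s)
                     / average M B (\<lambda>x. ennreal (w x))))"

definition RH_class :: "'a measure \<Rightarrow> 'a set set \<Rightarrow> ereal \<Rightarrow> ('a \<Rightarrow> real) set" where
  "RH_class M \<B> s = {w. weight M w \<and> RH_const M \<B> s w < \<infinity>}"

text \<open>The norm of the maximal function presupposes that this function, a possibly uncountable
  supremum, is measurable up to null sets; \<open>nn_integral\<close> would otherwise silently be a lower
  integral. On functions measurable with respect to the completion, \<open>nn_integral M\<close> agrees with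
  the integral over the completion.\<close>

definition muckenhoupt_basis :: "'a measure \<Rightarrow> 'a set set \<Rightarrow> bool" where
  "muckenhoupt_basis M \<B> \<longleftrightarrow> is_basis M \<B> \<and>
     (\<forall>f\<in>borel_measurable M. maximal M \<B> f \<in> borel_measurable (completion M)) \<and>
     (\<forall>p>1. \<forall>w\<in>A_class M \<B> p. \<exists>C<\<infinity>. \<forall>f\<in>borel_measurable M.
        Lp_norm (density M w) p (maximal M \<B> f) \<le> C * Lp_norm (density M w) p f)"


section \<open>Banach function spaces\<close>

text \<open>A Banach function space is given by its function norm N. As functions are represented by
  their absolute values, the requirement that f and its absolute value have the same norm is built
  in, and scalars are nonnegative.\<close>

definition function_norm :: "'a measure \<Rightarrow> (('a \<Rightarrow> ennreal) \<Rightarrow> ennreal) \<Rightarrow> bool" where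
  "function_norm M N \<longleftrightarrow>
     (\<forall>f\<in>borel_measurable M. N f = 0 \<longleftrightarrow> (AE x in M. f x = 0)) \<and>
     (\<forall>f\<in>borel_measurable M. \<forall>g\<in>borel_measurable M. N (\<lambda>x. f x + g x) \<le> N f + N g) \<and>
     (\<forall>f\<in>borel_measurable M. \<forall>c\<ge>0. N (\<lambda>x. ennreal c * f x) = ennreal c * N f) \<and>
     (\<forall>f\<in>borel_measurable M. \<forall>g\<in>borel_measurable M.
        (AE x in M. f x \<le> g x) \<longrightarrow> N f \<le> N g) \<and>
     (\<forall>f\<in>borel_measurable M. \<forall>F. (\<forall>j::nat. F j \<in> borel_measurable M) \<longrightarrow>
        (AE x in M. incseq (\<lambda>j. F j x) \<and> (SUP j. F j x) = f x) \<longrightarrow>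
        incseq (\<lambda>j. N (F j)) \<and> (SUP j. N (F j)) = N f) \<and>
     (\<forall>E\<in>sets M. emeasure M E < \<infinity> \<longrightarrow> N (indicator E) < \<infinity> \<and>
        (\<exists>C<\<infinity>. \<forall>f\<in>borel_measurable M. (\<integral>\<^sup>+x\<in>E. f x \<partial>M) \<le> C * N f))"

text \<open>The norm of the s-th power of the space with norm N, for s > 0.\<close>

definition power_norm :: "real \<Rightarrow> (('a \<Rightarrow> ennreal) \<Rightarrow> ennreal) \<Rightarrow> ('a \<Rightarrow> ennreal) \<Rightarrow> ennreal" where
  "power_norm s N f = ennpowr (N (\<lambda>x. ennpowr (f x) s)) (1 / s)"

definition distribution_function :: "'a measure \<Rightarrow> ('a \<Rightarrow> ennreal) \<Rightarrow> ennreal \<Rightarrow> ennreal" where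
  "distribution_function M f s = emeasure M {x\<in>space M. s < f x}"

definition decreasing_rearrangement :: "'a measure \<Rightarrow> ('a \<Rightarrow> ennreal) \<Rightarrow> real \<Rightarrow> ennreal" where
  "decreasing_rearrangement M f t = Inf {s. distribution_function M f s \<le> ennreal t}"

definition rearrangement_invariant :: "'a measure \<Rightarrow> (('a \<Rightarrow> ennreal) \<Rightarrow> ennreal) \<Rightarrow> bool" where
  "rearrangement_invariant M N \<longleftrightarrow>
     (\<forall>f\<in>borel_measurable M. \<forall>g\<in>borel_measurable M.
        distribution_function M f = distribution_function M g \<longrightarrow> N f = N g)"

text \<open>The interval [0, m) with Lebesgue measure, where m may be infinite.\<close>

definition halfline :: "ennreal \<Rightarrow> real measure" where
  "halfline m = lebesgue_on {t. 0 \<le> t \<and> ennreal t < m}"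

definition luxemburg_representation ::
  "'a measure \<Rightarrow> (('a \<Rightarrow> ennreal) \<Rightarrow> ennreal) \<Rightarrow> ((real \<Rightarrow> ennreal) \<Rightarrow> ennreal) \<Rightarrow> bool" where
  "luxemburg_representation M N N' \<longleftrightarrow>
     function_norm (halfline (emeasure M (space M))) N' \<and>
     rearrangement_invariant (halfline (emeasure M (space M))) N' \<and>
     (\<forall>f\<in>borel_measurable M. N f = N' (decreasing_rearrangement M f))"


section \<open>Boyd indices\<close>

text \<open>The strict inequality keeps s / t inside [0, m); at the endpoint f is not defined.\<close>

definition dilation :: "ennreal \<Rightarrow> real \<Rightarrow> (real \<Rightarrow> ennreal) \<Rightarrow> real \<Rightarrow> ennreal" where
  "dilation m t f s = (if ennreal s < m * min 1 (ennreal t) then f (s / t) else 0)"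

definition dilation_norm :: "ennreal \<Rightarrow> ((real \<Rightarrow> ennreal) \<Rightarrow> ennreal) \<Rightarrow> real \<Rightarrow> ennreal" where
  "dilation_norm m N t = (SUP f\<in>{f\<in>borel_measurable (halfline m). N f \<le> 1}. N (dilation m t f))"

text \<open>For a rearrangement invariant N the dilation norm is finite and lies on the same side of 1
  as t, so the two logarithms have the same sign. The absolute values make the quotient infinite,
  as opposed to minus infinity for t < 1, when the dilation norm is 1.\<close>

definition boyd_quotient :: "ennreal \<Rightarrow> ((real \<Rightarrow> ennreal) \<Rightarrow> ennreal) \<Rightarrow> real \<Rightarrow> ereal" where
  "boyd_quotient m N t = ereal \<bar>ln t\<bar> / ereal \<bar>ln (enn2real (dilation_norm m N t))\<bar>"

definition lower_boyd_index :: "ennreal \<Rightarrow> ((real \<Rightarrow> ennreal) \<Rightarrow> ennreal) \<Rightarrow> ereal" where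
  "lower_boyd_index m N = Lim at_top (boyd_quotient m N)"

definition upper_boyd_index :: "ennreal \<Rightarrow> ((real \<Rightarrow> ennreal) \<Rightarrow> ennreal) \<Rightarrow> ereal" where
  "upper_boyd_index m N = Lim (at_right 0) (boyd_quotient m N)"


section \<open>Extrapolation pairs\<close>

definition extrapolation_family :: "'a measure \<Rightarrow> (('a \<Rightarrow> ennreal) \<times> ('a \<Rightarrow> ennreal)) set \<Rightarrow> bool" where
  "extrapolation_family M \<F> \<longleftrightarrow>
     (\<forall>(f, g)\<in>\<F>. f \<in> borel_measurable M \<and> g \<in> borel_measurable M)"

end

theory Submission
  imports Defs
begin

text \<open>
  Fix exponents p1 < p_X \<le> q_X < p2 close to the Boyd indices and put \<Phi>(y) = min (y^p1) (y^p2). The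
  theorem splits at the family of inequalities

    \<mu> {f u > l} \<le> C \<integral> \<Phi>(g u / l) d\<mu>   for all l > 0,

  called \<open>modular_dominated\<close> below: it mentions the weight u only through the functions f u and g u, and
  it mentions the space X not at all.

  From this family to X. Cutting g u into dyadic layers turns the right-hand side into a series in the
  distribution function of g u, and solving for the rearrangement of f u bounds it at t by a sum of the
  rearrangement of g u at the points 2^n t and t / 2^n, with coefficients 2^(n/r2) and 2^(-n/r1) for any
  exponents with p1 < r1 < r2 < p2 (\<open>rearrangement_dominated\<close>). These are dilations. If r1 < p_X and
  q_X < r2, the definition of the Boyd indices makes the series of their norms converge
  (\<open>boyd_interpolation\<close>). Before that, the limits that define the indices have to be shown to exist,
  which is Fekete's lemma applied to the submultiplicative dilation norm.

  From the hypothesis to this family. Let y = f u and \<gamma> = g u, both divided by l. The hypothesis may be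
  used with any weight u^p0 m in the class for p0, where m may depend on f and g as long as the
  constants of the weight do not. It is enough to find m such that, up to functions with controlled
  integral,

    \<Phi>(y) \<le> y^p0 m   and   \<gamma>^p0 m \<le> C \<Phi>(\<gamma>) + \<epsilon> \<Phi>(y),

  for then integration gives \<integral> \<Phi>(y) \<le> C \<integral> \<Phi>(\<gamma>) + 1/2 \<integral> \<Phi>(y), and the last term can be
  absorbed once f has been truncated so that it is finite (\<open>modular_estimate\<close>, \<open>weak_modular_estimate\<close>).
  Chebyshev's inequality then yields the family. The power p2 governs small values and the power p1 large
  ones, and m is the minimum of one multiplier for each of the two powers (\<open>one_sided_multiplier\<close>).

  Each multiplier is a power of a Rubio de Francia majorant (\<open>rubio_de_francia\<close>, \<open>weighted_majorant\<close>). The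
  definition of a Muckenhoupt basis bounds the maximal operator on each weighted space separately; it does
  not say that the bound depends only on the constant of the weight. All majorants are therefore
  constructed in spaces whose weight is a power of u, fixed once and for all. A step that changed the
  weight together with f and g would have no uniform constant.

  The membership of u^p in the class for p is rephrased as a two-sided bound for the averages of u and
  1 / u (\<open>bump\<close>). In this form the duality u \<mapsto> 1 / u, geometric means and minima of weights are visible,
  and so is the role of the inclusion of A_\<infinity> in the reverse Hoelder classes: the exponents of such a bound
  can be improved slightly, which moves it from p_X and q_X to the exponents p1 and p2 beyond them
  (\<open>nearby_exponents\<close>).
\<close>

section \<open>Averages and two-sided weight conditions\<close>

lemma average_mono_AE:
  assumes "AE x in M. x \<in> B \<longrightarrow> f x \<le> g x"
  shows "average M B f \<le> average M B g"
  unfolding average_def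
  by (intro divide_right_mono_ennreal nn_integral_mono_AE) (use assms in \<open>auto split: split_indicator\<close>)

lemma average_cong_AE:
  assumes "AE x in M. x \<in> B \<longrightarrow> f x = g x"
  shows "average M B f = average M B g"
  by (intro antisym average_mono_AE) (use assms in auto)

lemma average_const:
  assumes "B \<in> sets M" "0 < emeasure M B" "emeasure M B < \<infinity>"
  shows "average M B (\<lambda>_. c) = c"
  unfolding average_def using assms
  by (simp add: nn_integral_cmult_indicator ennreal_mult_divide_eq)

lemma average_add:
  assumes "B \<in> sets M" "f \<in> borel_measurable M" "g \<in> borel_measurable M"
  shows "average M B (\<lambda>x. f x + g x) = average M B f + average M B g"
  unfolding average_def using assms
  by (simp add: distrib_right nn_integral_add add_divide_distrib_ennreal)

lemma average_cmult:
  assumes "B \<in> sets M" "f \<in> borel_measurable M"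
  shows "average M B (\<lambda>x. c * f x) = c * average M B f"
  unfolding average_def using assms
  by (simp add: mult.assoc nn_integral_cmult ennreal_times_divide)

text \<open>
  Hoelder's inequality, proved by applying Young's inequality to f / F and g / G. Upper bounds F and
  G take the place of the averages, so that averages equal to zero or infinity need no separate
  treatment.
\<close>

lemma average_holder:
  fixes f g :: "'a \<Rightarrow> real"
  assumes B: "B \<in> sets M" "0 < emeasure M B" "emeasure M B < \<infinity>"
    and [measurable]: "f \<in> borel_measurable M" "g \<in> borel_measurable M"
    and pos: "\<And>x. 0 < f x" "\<And>x. 0 < g x" and FG: "0 < F" "0 < G" and \<theta>: "0 \<le> \<theta>" "\<theta> \<le> 1"
    and f: "average M B (\<lambda>x. ennreal (f x)) \<le> ennreal F"
    and g: "average M B (\<lambda>x. ennreal (g x)) \<le> ennreal G"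
  shows "average M B (\<lambda>x. ennreal (f x powr \<theta> * g x powr (1 - \<theta>))) \<le> ennreal (F powr \<theta> * G powr (1 - \<theta>))"
proof -
  define K where "K = F powr \<theta> * G powr (1 - \<theta>)"
  have K: "0 < K" using FG by (simp add: K_def)
  have pt: "f x powr \<theta> * g x powr (1 - \<theta>) \<le> K * \<theta> / F * f x + K * (1 - \<theta>) / G * g x" for x
  proof -
    have "(f x / F) powr \<theta> * (g x / G) powr (1 - \<theta>) \<le> \<theta> * (f x / F) + (1 - \<theta>) * (g x / G)"
      by (rule Youngs_inequality_0) (use \<theta> FG pos[of x] in auto)
    then have "K * ((f x / F) powr \<theta> * (g x / G) powr (1 - \<theta>)) \<le> K * (\<theta> * (f x / F) + (1 - \<theta>) * (g x / G))"
      using K by simp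
    moreover have "K * ((f x / F) powr \<theta> * (g x / G) powr (1 - \<theta>)) = f x powr \<theta> * g x powr (1 - \<theta>)"
      using FG pos[of x] by (simp add: K_def powr_divide)
    ultimately show ?thesis by (simp add: algebra_simps)
  qed
  have "average M B (\<lambda>x. ennreal (f x powr \<theta> * g x powr (1 - \<theta>)))
      \<le> average M B (\<lambda>x. ennreal (K * \<theta> / F) * ennreal (f x) + ennreal (K * (1 - \<theta>) / G) * ennreal (g x))"
  proof (intro average_mono_AE AE_I2 impI)
    fix x
    have "0 \<le> f x" "0 \<le> g x" using pos[of x] by auto
    then have "ennreal (K * \<theta> / F) * ennreal (f x) + ennreal (K * (1 - \<theta>) / G) * ennreal (g x)
        = ennreal (K * \<theta> / F * f x + K * (1 - \<theta>) / G * g x)"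
      using K \<theta> FG
      by (subst (1 2) ennreal_mult[symmetric]; simp?; subst ennreal_plus[symmetric]; simp?)
    then show "ennreal (f x powr \<theta> * g x powr (1 - \<theta>))
        \<le> ennreal (K * \<theta> / F) * ennreal (f x) + ennreal (K * (1 - \<theta>) / G) * ennreal (g x)"
      using ennreal_leI[OF pt[of x]] by simp
  qed
  also have "\<dots> = ennreal (K * \<theta> / F) * average M B f + ennreal (K * (1 - \<theta>) / G) * average M B g"
    using B by (simp add: average_add average_cmult)
  also have "\<dots> \<le> ennreal (K * \<theta> / F) * ennreal F + ennreal (K * (1 - \<theta>) / G) * ennreal G"
    by (intro add_mono mult_left_mono f g) auto
  also have "\<dots> = ennreal (K * \<theta> / F * F + K * (1 - \<theta>) / G * G)"
    using K \<theta> FG by (simp add: ennreal_mult[symmetric] ennreal_plus[symmetric] del: ennreal_plus)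
  also have "K * \<theta> / F * F + K * (1 - \<theta>) / G * G = K" using FG by (simp add: field_simps)
  finally show ?thesis by (simp add: K_def)
qed

text \<open>
  The norm of W in L^(1/\<beta>) with respect to normalised measure on B is at most k. Indexing by
  the reciprocal of the exponent makes the essential supremum the case \<beta> = 0 and makes
  Hoelder's inequality linear in \<beta>. A predicate is used instead of the norm itself so that k
  is real.
\<close>

definition mean_le :: "'a measure \<Rightarrow> 'a set \<Rightarrow> real \<Rightarrow> ('a \<Rightarrow> real) \<Rightarrow> real \<Rightarrow> bool" where
  "mean_le M B \<beta> W k \<longleftrightarrow>
     (if \<beta> = 0 then AE x in M. x \<in> B \<longrightarrow> W x \<le> k
      else average M B (\<lambda>x. ennreal (W x powr (1 / \<beta>))) \<le> ennreal (k powr (1 / \<beta>)))"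

text \<open>
  With \<alpha> = 1/a - 1/p and \<beta> = 1/p - 1/b this says that W^p lies in the intersection of
  A_(p/a) and RH_((b/p)'), at least when \<alpha> and \<beta> are positive: the product of the norm
  of W in L^(1/\<beta>) and the norm of 1 / W in L^(1/\<alpha>), both averaged over B, is bounded by
  D. The number k splits the bound between the two factors, so that no product of 0 and \<infinity>
  arises. Note that \<alpha> + \<beta> does not depend on p.
\<close>

definition bump :: "'a measure \<Rightarrow> 'a set set \<Rightarrow> real \<Rightarrow> real \<Rightarrow> ('a \<Rightarrow> real) \<Rightarrow> real \<Rightarrow> bool" where
  "bump M \<B> \<alpha> \<beta> W D \<longleftrightarrow>
     (\<forall>B\<in>\<B>. \<exists>k>0. mean_le M B \<beta> W k \<and> mean_le M B \<alpha> (\<lambda>x. 1 / W x) (D / k))"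

lemma bump_inverse:
  assumes "bump M \<B> \<alpha> \<beta> W D" "0 < D"
  shows "bump M \<B> \<beta> \<alpha> (\<lambda>x. 1 / W x) D"
  unfolding bump_def
proof
  fix B assume "B \<in> \<B>"
  then obtain k where "k > 0" "mean_le M B \<beta> W k" "mean_le M B \<alpha> (\<lambda>x. 1 / W x) (D / k)"
    using assms by (auto simp: bump_def)
  then show "\<exists>k>0. mean_le M B \<alpha> (\<lambda>x. 1 / W x) k \<and> mean_le M B \<beta> (\<lambda>x. 1 / (1 / W x)) (D / k)"
    using \<open>0 < D\<close> by (intro exI[of _ "D / k"]) auto
qed

text \<open>
  Log-convexity of the norms jointly in the function and in the reciprocal exponent. When both
  exponents are finite it is Hoelder's inequality with weight s * \<beta> / \<delta>, where \<delta>
  is the resulting reciprocal exponent; when one of them is infinite that function is simply bounded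
  pointwise.
\<close>

lemma mean_le_geometric:
  fixes V W :: "'a \<Rightarrow> real"
  assumes B: "B \<in> sets M" "0 < emeasure M B" "emeasure M B < \<infinity>"
    and [measurable]: "V \<in> borel_measurable M" "W \<in> borel_measurable M"
    and pos: "\<And>x. 0 < V x" "\<And>x. 0 < W x" and k: "0 < k" "0 < l" and s: "0 < s" "s < 1"
    and \<beta>: "0 \<le> \<beta>" "0 \<le> \<gamma>"
    and V: "mean_le M B \<beta> V k" and W: "mean_le M B \<gamma> W l"
  shows "mean_le M B (s * \<beta> + (1 - s) * \<gamma>) (\<lambda>x. V x powr s * W x powr (1 - s)) (k powr s * l powr (1 - s))"
proof -
  have zero: "mean_le M B (s * \<beta> + (1 - s) * 0) (\<lambda>x. V x powr s * W x powr (1 - s)) (k powr s * l powr (1 - s))"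
    if V: "mean_le M B \<beta> V k" and W: "mean_le M B 0 W l" and \<beta>: "\<beta> > 0"
      and pos: "\<And>x. 0 < V x" "\<And>x. 0 < W x" and k: "0 < k" "0 < l" and s: "0 < s" "s < 1"
      and [measurable]: "V \<in> borel_measurable M" "W \<in> borel_measurable M"
    for V W :: "'a \<Rightarrow> real" and k l \<beta> s
  proof -
    have Wl: "AE x in M. x \<in> B \<longrightarrow> W x \<le> l" using W by (simp add: mean_le_def)
    have "average M B (\<lambda>x. ennreal ((V x powr s * W x powr (1 - s)) powr (1 / (s * \<beta>))))
       \<le> average M B (\<lambda>x. ennreal (l powr ((1 - s) / (s * \<beta>))) * ennreal (V x powr (1 / \<beta>)))"
      apply (rule average_mono_AE)
      using Wl
    proof (eventually_elim, intro impI)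
      fix x assume *: "x \<in> B \<longrightarrow> W x \<le> l" "x \<in> B"
      have "(V x powr s * W x powr (1 - s)) powr (1 / (s * \<beta>)) = V x powr (1 / \<beta>) * W x powr ((1 - s) / (s * \<beta>))"
        using pos[of x] s \<beta> by (simp add: powr_mult powr_powr)
      also have "\<dots> \<le> V x powr (1 / \<beta>) * l powr ((1 - s) / (s * \<beta>))"
        using * pos[of x] s \<beta> by (intro mult_left_mono powr_mono2) auto
      finally show "ennreal ((V x powr s * W x powr (1 - s)) powr (1 / (s * \<beta>)))
        \<le> ennreal (l powr ((1 - s) / (s * \<beta>))) * ennreal (V x powr (1 / \<beta>))"
        by (subst ennreal_mult[symmetric]) (auto simp: mult.commute intro!: ennreal_leI)
    qed
    also have "\<dots> = ennreal (l powr ((1 - s) / (s * \<beta>))) * average M B (\<lambda>x. ennreal (V x powr (1 / \<beta>)))"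
      using B by (simp add: average_cmult)
    also have "\<dots> \<le> ennreal (l powr ((1 - s) / (s * \<beta>))) * ennreal (k powr (1 / \<beta>))"
      using V \<beta> by (intro mult_left_mono) (auto simp: mean_le_def)
    also have "\<dots> = ennreal ((k powr s * l powr (1 - s)) powr (1 / (s * \<beta>)))"
      using k s \<beta> by (simp add: ennreal_mult[symmetric] powr_mult powr_powr mult.commute)
    finally show ?thesis using s \<beta> by (simp add: mean_le_def)
  qed
  consider "\<beta> > 0" "\<gamma> > 0" | "\<beta> > 0" "\<gamma> = 0" | "\<beta> = 0" "\<gamma> > 0" | "\<beta> = 0" "\<gamma> = 0" using \<beta> by linarith
  then show ?thesis
  proof cases
    case 1
    define \<delta> where "\<delta> = s * \<beta> + (1 - s) * \<gamma>"
    have \<delta>: "\<delta> > 0" using 1 s by (simp add: \<delta>_def add_pos_pos)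
    define \<theta> where "\<theta> = s * \<beta> / \<delta>"
    have \<theta>': "1 - \<theta> = (1 - s) * \<gamma> / \<delta>" using \<delta> by (simp add: \<theta>_def field_simps) (simp add: \<delta>_def algebra_simps)
    have \<theta>: "0 \<le> \<theta>" "\<theta> \<le> 1" using \<delta> 1 s \<theta>' apply (simp add: \<theta>_def)
      using \<theta>' 1 s \<delta> by (smt (verit) divide_nonneg_pos mult_nonneg_nonneg)
    have *: "(v powr (1 / \<beta>)) powr \<theta> * (w powr (1 / \<gamma>)) powr (1 - \<theta>) = (v powr s * w powr (1 - s)) powr (1 / \<delta>)"
      if "v > 0" "w > 0" for v w :: real
      using that 1 \<delta> unfolding \<theta>' by (simp add: \<theta>_def powr_powr powr_mult)
    have "average M B (\<lambda>x. ennreal ((V x powr (1 / \<beta>)) powr \<theta> * (W x powr (1 / \<gamma>)) powr (1 - \<theta>)))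
        \<le> ennreal ((k powr (1 / \<beta>)) powr \<theta> * (l powr (1 / \<gamma>)) powr (1 - \<theta>))"
      by (rule average_holder) (use B V W 1 pos less_imp_neq[OF pos(1)] less_imp_neq[OF pos(2)] k \<theta> in \<open>auto simp: mean_le_def\<close>)
    then have "average M B (\<lambda>x. ennreal ((V x powr s * W x powr (1 - s)) powr (1 / \<delta>)))
        \<le> ennreal ((k powr s * l powr (1 - s)) powr (1 / \<delta>))"
      using * pos k by simp
    then show ?thesis unfolding mean_le_def \<delta>_def[symmetric] using \<delta> by simp
  next
    case 2
    then show ?thesis using zero[of \<beta> V k W l s] V W pos k s by simp
  next
    case 3
    have "mean_le M B ((1 - s) * \<gamma> + (1 - (1 - s)) * 0) (\<lambda>x. W x powr (1 - s) * V x powr (1 - (1 - s))) (l powr (1 - s) * k powr (1 - (1 - s)))"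
      by (rule zero) (use 3 V W pos k s in auto)
    then show ?thesis using 3 by (simp add: mult.commute)
  next
    case 4
    have "AE x in M. x \<in> B \<longrightarrow> V x \<le> k" "AE x in M. x \<in> B \<longrightarrow> W x \<le> l"
      using V W 4 by (auto simp: mean_le_def)
    then have "AE x in M. x \<in> B \<longrightarrow> V x powr s * W x powr (1 - s) \<le> k powr s * l powr (1 - s)"
    proof eventually_elim
      case (elim x)
      then show ?case using pos[of x] s by (auto intro!: mult_mono powr_mono2)
    qed
    then show ?thesis using 4 by (simp add: mean_le_def)
  qed
qed

text \<open>
  Jensen's inequality on the probability space B: the norms increase with the exponent, hence
  decrease with its reciprocal.
\<close>

lemma mean_le_mono_exponent:
  fixes V :: "'a \<Rightarrow> real"
  assumes B: "B \<in> sets M" "0 < emeasure M B" "emeasure M B < \<infinity>"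
    and [measurable]: "V \<in> borel_measurable M"
    and pos: "\<And>x. 0 < V x" and k: "0 < k" and \<beta>: "0 \<le> \<beta>" "\<beta> \<le> \<gamma>"
    and V: "mean_le M B \<beta> V k"
  shows "mean_le M B \<gamma> V k"
proof -
  consider "\<beta> = \<gamma>" | "\<beta> = 0" "\<gamma> > 0" | "0 < \<beta>" "\<beta> < \<gamma>" using \<beta> by linarith
  then show ?thesis
  proof cases
    case 1 then show ?thesis using V by simp
  next
    case 2
    have "AE x in M. x \<in> B \<longrightarrow> V x \<le> k" using V 2 by (auto simp: mean_le_def)
    then have "AE x in M. x \<in> B \<longrightarrow> ennreal (V x powr (1 / \<gamma>)) \<le> ennreal (k powr (1 / \<gamma>))"
    proof eventually_elim
      case (elim x)
      then show ?case using pos[of x] 2 by (auto intro!: ennreal_leI powr_mono2)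
    qed
    from average_mono_AE[OF this] show ?thesis using 2 average_const[OF B] by (simp add: mean_le_def)
  next
    case 3
    have "average M B (\<lambda>x. ennreal ((V x powr (1 / \<beta>)) powr (\<beta> / \<gamma>) * 1 powr (1 - \<beta> / \<gamma>)))
        \<le> ennreal ((k powr (1 / \<beta>)) powr (\<beta> / \<gamma>) * 1 powr (1 - \<beta> / \<gamma>))"
      by (rule average_holder) (use B V 3 pos less_imp_neq[OF pos] k average_const[OF B, of 1] in \<open>auto simp: mean_le_def\<close>)
    then show ?thesis using 3 pos k by (simp add: mean_le_def powr_powr)
  qed
qed

lemma bump_geometric:
  fixes V W :: "'a \<Rightarrow> real"
  assumes B: "is_basis M \<B>"
    and [measurable]: "V \<in> borel_measurable M" "W \<in> borel_measurable M"
    and pos: "\<And>x. 0 < V x" "\<And>x. 0 < W x" and D: "0 < D" "0 < E" and s: "0 < s" "s < 1"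
    and nn: "0 \<le> \<alpha>" "0 \<le> \<beta>" "0 \<le> \<alpha>'" "0 \<le> \<beta>'"
    and V: "bump M \<B> \<alpha> \<beta> V D" and W: "bump M \<B> \<alpha>' \<beta>' W E"
  shows "bump M \<B> (s * \<alpha> + (1 - s) * \<alpha>') (s * \<beta> + (1 - s) * \<beta>') (\<lambda>x. V x powr s * W x powr (1 - s))
           (D powr s * E powr (1 - s))"
  unfolding bump_def
proof
  fix B assume "B \<in> \<B>"
  then have B': "B \<in> sets M" "0 < emeasure M B" "emeasure M B < \<infinity>" using B by (auto simp: is_basis_def)
  obtain k where k: "k > 0" "mean_le M B \<beta> V k" "mean_le M B \<alpha> (\<lambda>x. 1 / V x) (D / k)"
    using V \<open>B \<in> \<B>\<close> by (auto simp: bump_def)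
  obtain l where l: "l > 0" "mean_le M B \<beta>' W l" "mean_le M B \<alpha>' (\<lambda>x. 1 / W x) (E / l)"
    using W \<open>B \<in> \<B>\<close> by (auto simp: bump_def)
  have "mean_le M B (s * \<beta> + (1 - s) * \<beta>') (\<lambda>x. V x powr s * W x powr (1 - s)) (k powr s * l powr (1 - s))"
    by (rule mean_le_geometric) (use B' k l pos s nn in auto)
  moreover have "mean_le M B (s * \<alpha> + (1 - s) * \<alpha>') (\<lambda>x. (1 / V x) powr s * (1 / W x) powr (1 - s))
      ((D / k) powr s * (E / l) powr (1 - s))"
    by (rule mean_le_geometric) (use B' k l pos s nn D in auto)
  moreover have "(1 / v) powr s * (1 / w) powr (1 - s) = 1 / (v powr s * w powr (1 - s))"
    if "v > 0" "w > 0" for v w :: real using that by (simp add: powr_divide)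
  moreover have "(D / k) powr s * (E / l) powr (1 - s) = (D powr s * E powr (1 - s)) / (k powr s * l powr (1 - s))"
    using D k l by (simp add: powr_divide)
  ultimately show "\<exists>r>0. mean_le M B (s * \<beta> + (1 - s) * \<beta>') (\<lambda>x. V x powr s * W x powr (1 - s)) r \<and>
    mean_le M B (s * \<alpha> + (1 - s) * \<alpha>') (\<lambda>x. 1 / (V x powr s * W x powr (1 - s))) (D powr s * E powr (1 - s) / r)"
    using k l pos by (intro exI[of _ "k powr s * l powr (1 - s)"]) auto
qed

lemma mean_le_min:
  fixes V W :: "'a \<Rightarrow> real"
  assumes pos: "\<And>x. 0 < V x" "\<And>x. 0 < W x" and k: "0 < k" "0 < l" and \<beta>: "0 \<le> \<beta>"
    and V: "mean_le M B \<beta> V k" and W: "mean_le M B \<beta> W l"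
  shows "mean_le M B \<beta> (\<lambda>x. min (V x) (W x)) (min k l)"
proof (cases "\<beta> = 0")
  case True
  have "AE x in M. x \<in> B \<longrightarrow> V x \<le> k" "AE x in M. x \<in> B \<longrightarrow> W x \<le> l"
    using V W True by (auto simp: mean_le_def)
  then have "AE x in M. x \<in> B \<longrightarrow> min (V x) (W x) \<le> min k l" by eventually_elim auto
  then show ?thesis using True by (simp add: mean_le_def)
next
  case False
  have "average M B (\<lambda>x. ennreal (min (V x) (W x) powr (1 / \<beta>))) \<le> average M B (\<lambda>x. ennreal (V x powr (1 / \<beta>)))"
    "average M B (\<lambda>x. ennreal (min (V x) (W x) powr (1 / \<beta>))) \<le> average M B (\<lambda>x. ennreal (W x powr (1 / \<beta>)))"
    using less_imp_le[OF pos(1)] less_imp_le[OF pos(2)] \<beta>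
    by (intro average_mono_AE AE_I2 impI ennreal_leI powr_mono2; simp)+
  then show ?thesis using V W False unfolding mean_le_def min_def by (auto intro: order_trans)
qed

lemma mean_le_max:
  fixes V W :: "'a \<Rightarrow> real"
  assumes B: "B \<in> sets M"
    and [measurable]: "V \<in> borel_measurable M" "W \<in> borel_measurable M"
    and pos: "\<And>x. 0 < V x" "\<And>x. 0 < W x" and k: "0 < k" "0 < l" and \<beta>: "0 \<le> \<beta>"
    and V: "mean_le M B \<beta> V k" and W: "mean_le M B \<beta> W l"
  shows "mean_le M B \<beta> (\<lambda>x. max (V x) (W x)) (2 powr \<beta> * max k l)"
proof (cases "\<beta> = 0")
  case True
  have "AE x in M. x \<in> B \<longrightarrow> V x \<le> k" "AE x in M. x \<in> B \<longrightarrow> W x \<le> l"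
    using V W True by (auto simp: mean_le_def)
  then have "AE x in M. x \<in> B \<longrightarrow> max (V x) (W x) \<le> max k l" by eventually_elim auto
  then show ?thesis using True by (simp add: mean_le_def)
next
  case False
  have "average M B (\<lambda>x. ennreal (max (V x) (W x) powr (1 / \<beta>)))
      \<le> average M B (\<lambda>x. ennreal (V x powr (1 / \<beta>)) + ennreal (W x powr (1 / \<beta>)))"
    by (intro average_mono_AE AE_I2) (auto simp: max_def)
  also have "\<dots> = average M B (\<lambda>x. ennreal (V x powr (1 / \<beta>))) + average M B (\<lambda>x. ennreal (W x powr (1 / \<beta>)))"
    using B by (simp add: average_add)
  also have "\<dots> \<le> ennreal (k powr (1 / \<beta>)) + ennreal (l powr (1 / \<beta>))"
    using V W False by (intro add_mono) (auto simp: mean_le_def)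
  also have "\<dots> \<le> ennreal (max k l powr (1 / \<beta>)) + ennreal (max k l powr (1 / \<beta>))"
    using k \<beta> by (intro add_mono ennreal_leI powr_mono2) auto
  also have "\<dots> = ennreal ((2 powr \<beta> * max k l) powr (1 / \<beta>))"
    using k False by (subst ennreal_plus[symmetric]) (auto simp: powr_mult powr_powr)
  finally show ?thesis using False by (simp add: mean_le_def)
qed

lemma mean_le_mono:
  assumes "mean_le M B \<beta> W k" "0 < k" "k \<le> l" "0 \<le> \<beta>"
  shows "mean_le M B \<beta> W l"
proof (cases "\<beta> = 0")
  case True then show ?thesis using assms by (auto simp: mean_le_def)
next
  case False
  then have "k powr (1 / \<beta>) \<le> l powr (1 / \<beta>)" using assms by (intro powr_mono2) auto
  then show ?thesis using assms False unfolding mean_le_def by (auto intro: order_trans ennreal_leI)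
qed

lemma bump_mono:
  assumes "bump M \<B> \<alpha> \<beta> W D" "0 < D" "D \<le> E" "0 \<le> \<alpha>"
  shows "bump M \<B> \<alpha> \<beta> W E"
  unfolding bump_def
proof
  fix B assume "B \<in> \<B>"
  then obtain k where k: "k > 0" "mean_le M B \<beta> W k" "mean_le M B \<alpha> (\<lambda>x. 1 / W x) (D / k)"
    using assms by (auto simp: bump_def)
  have "mean_le M B \<alpha> (\<lambda>x. 1 / W x) (E / k)"
    by (rule mean_le_mono[OF k(3)]) (use k assms in \<open>auto simp: divide_right_mono\<close>)
  then show "\<exists>k>0. mean_le M B \<beta> W k \<and> mean_le M B \<alpha> (\<lambda>x. 1 / W x) (E / k)"
    using k by blast
qed

text \<open>
  Taking the minimum can only lower the average of the weight. The reciprocal of the minimum is the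
  maximum of the reciprocals, and its powers are at most the sum of their powers, so the other
  average increases at most by a factor.
\<close>

lemma bump_min:
  fixes V W :: "'a \<Rightarrow> real"
  assumes B: "is_basis M \<B>"
    and [measurable]: "V \<in> borel_measurable M" "W \<in> borel_measurable M"
    and pos: "\<And>x. 0 < V x" "\<And>x. 0 < W x" and D: "0 < D" and nn: "0 \<le> \<alpha>" "0 \<le> \<beta>"
    and V: "bump M \<B> \<alpha> \<beta> V D" and W: "bump M \<B> \<alpha> \<beta> W D"
  shows "bump M \<B> \<alpha> \<beta> (\<lambda>x. min (V x) (W x)) (2 powr \<alpha> * D)"
  unfolding bump_def
proof
  fix B assume "B \<in> \<B>"
  then have B': "B \<in> sets M" using B by (auto simp: is_basis_def)
  obtain k where k: "k > 0" "mean_le M B \<beta> V k" "mean_le M B \<alpha> (\<lambda>x. 1 / V x) (D / k)"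
    using V \<open>B \<in> \<B>\<close> by (auto simp: bump_def)
  obtain l where l: "l > 0" "mean_le M B \<beta> W l" "mean_le M B \<alpha> (\<lambda>x. 1 / W x) (D / l)"
    using W \<open>B \<in> \<B>\<close> by (auto simp: bump_def)
  have "mean_le M B \<beta> (\<lambda>x. min (V x) (W x)) (min k l)"
    by (rule mean_le_min) (use k l pos nn in auto)
  moreover have "mean_le M B \<alpha> (\<lambda>x. max (1 / V x) (1 / W x)) (2 powr \<alpha> * max (D / k) (D / l))"
    by (rule mean_le_max) (use B' k l pos nn D in auto)
  moreover have "max (1 / v) (1 / w) = 1 / min v w" if "v > 0" "w > 0" for v w :: real
    using that by (auto simp: max_def min_def field_simps)
  moreover have "max (D / k) (D / l) = D / min k l"
    using D k l by (auto simp: max_def min_def field_simps)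
  ultimately show "\<exists>r>0. mean_le M B \<beta> (\<lambda>x. min (V x) (W x)) r \<and> mean_le M B \<alpha> (\<lambda>x. 1 / min (V x) (W x)) (2 powr \<alpha> * D / r)"
    using k l pos by (intro exI[of _ "min k l"]) auto
qed

section \<open>The maximal operator and the Rubio de Francia algorithm\<close>

lemma ennpowr_ennreal: "0 \<le> r \<Longrightarrow> ennpowr (ennreal r) a = ennreal (r powr a)"
  by (simp add: ennpowr_def)

lemma ennpowr_mono: assumes "x \<le> y" "0 \<le> a" shows "ennpowr x a \<le> ennpowr y a"
proof (cases "y = \<infinity>")
  case True then show ?thesis by (simp add: ennpowr_def)
next
  case False
  then obtain r where r: "y = ennreal r" "0 \<le> r" by (cases y) auto
  then obtain s where s: "x = ennreal s" "0 \<le> s" using assms by (cases x) (auto simp: top_unique)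
  then show ?thesis using r assms by (auto simp: ennpowr_ennreal intro!: ennreal_leI powr_mono2)
qed

lemma ennpowr_one [simp]: "ennpowr x 1 = x"
  by (cases x) (auto simp: ennpowr_def)

lemma ennpowr_ennpowr: "ennpowr (ennpowr x a) b = ennpowr x (a * b)"
  by (cases x) (auto simp: ennpowr_def powr_powr)

lemma ennpowr_mult: assumes "0 < c" shows "ennpowr (ennreal c * x) a = ennreal (c powr a) * ennpowr x a"
proof (cases x)
  case (real r)
  then show ?thesis using assms
    by (simp add: ennreal_mult[symmetric] ennpowr_ennreal powr_mult)
next
  case top
  then show ?thesis using assms by (simp add: ennpowr_def ennreal_mult_top)
qed

lemma measurable_ennpowr [measurable]:
  assumes [measurable]: "f \<in> borel_measurable M"
  shows "(\<lambda>x. ennpowr (f x) a) \<in> borel_measurable M"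
  unfolding ennpowr_def by measurable

lemma average_le_maximal: "B \<in> \<B> \<Longrightarrow> x \<in> B \<Longrightarrow> average M B f \<le> maximal M \<B> f x"
  unfolding maximal_def by (intro SUP_upper) auto

lemma maximal_le: "(\<And>B. B \<in> \<B> \<Longrightarrow> x \<in> B \<Longrightarrow> average M B f \<le> c) \<Longrightarrow> maximal M \<B> f x \<le> c"
  unfolding maximal_def by (intro SUP_least) auto

lemma maximal_cong_AE: "AE x in M. f x = g x \<Longrightarrow> maximal M \<B> f = maximal M \<B> g"
  unfolding maximal_def by (intro ext SUP_cong refl average_cong_AE) auto

text \<open>
  The A_1 condition. It is kept as a pointwise almost everywhere inequality for the maximal
  function, with an explicit constant, since the constants of the weights built from H must be
  controlled.
\<close>

definition A1_bound :: "'a measure \<Rightarrow> 'a set set \<Rightarrow> real \<Rightarrow> ('a \<Rightarrow> real) \<Rightarrow> bool" where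
  "A1_bound M \<B> c H \<longleftrightarrow> (AE x in M. maximal M \<B> (\<lambda>y. ennreal (H y)) x \<le> ennreal (c * H x))"

lemma average_suminf:
  assumes B: "B \<in> sets M" and [measurable]: "\<And>n. f n \<in> borel_measurable M"
  shows "average M B (\<lambda>x. \<Sum>n. f n x) = (\<Sum>n. average M B (f n))"
proof -
  have [measurable]: "B \<in> sets M" by (fact B)
  have "(\<integral>\<^sup>+x. (\<Sum>n. f n x) * indicator B x \<partial>M) = (\<integral>\<^sup>+x. (\<Sum>n. f n x * indicator B x) \<partial>M)"
    by (simp add: ennreal_suminf_multc)
  also have "\<dots> = (\<Sum>n. \<integral>\<^sup>+x. f n x * indicator B x \<partial>M)"
    by (rule nn_integral_suminf) measurable
  finally show ?thesis unfolding average_def divide_ennreal_def by (simp add: ennreal_suminf_multc)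
qed

lemma maximal_suminf_le:
  assumes B: "is_basis M \<B>" and [measurable]: "\<And>n. f n \<in> borel_measurable M"
  shows "maximal M \<B> (\<lambda>x. \<Sum>n. ennreal (c n) * f n x) x \<le> (\<Sum>n. ennreal (c n) * maximal M \<B> (f n) x)"
proof (rule maximal_le)
  fix B assume "B \<in> \<B>" "x \<in> B"
  then have "B \<in> sets M" using B by (auto simp: is_basis_def)
  then have "average M B (\<lambda>x. \<Sum>n. ennreal (c n) * f n x) = (\<Sum>n. ennreal (c n) * average M B (f n))"
    by (subst average_suminf) (simp_all add: average_cmult)
  also have "\<dots> \<le> (\<Sum>n. ennreal (c n) * maximal M \<B> (f n) x)"
    using \<open>B \<in> \<B>\<close> \<open>x \<in> B\<close> by (intro suminf_le mult_left_mono average_le_maximal) auto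
  finally show "average M B (\<lambda>x. \<Sum>n. ennreal (c n) * f n x) \<le> (\<Sum>n. ennreal (c n) * maximal M \<B> (f n) x)" .
qed

text \<open>
  A substitute for Minkowski's inequality: with geometric weights a series is at most twice the
  supremum of its terms, and the power of a supremum is at most the sum of the powers. The loss of a
  constant is harmless, and the sum can be exchanged with an integral.
\<close>

lemma weighted_geometric_sum_power_le:
  fixes b :: "nat \<Rightarrow> ennreal"
  assumes q: "0 < q"
  shows "ennpowr (\<Sum>n. ennreal ((1/2) ^ n) * b n) q \<le> ennreal (2 powr q) * (\<Sum>n. ennpowr (b n) q)"
proof -
  define R where "R = (\<Sum>n. ennpowr (b n) q)"
  have "b n \<le> ennpowr R (1 / q)" for n
  proof -
    have "ennpowr (b n) q \<le> R" unfolding R_def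
      using sum_le_suminf[of "\<lambda>n. ennpowr (b n) q" "{n}"] by simp
    then show ?thesis using ennpowr_mono[of "ennpowr (b n) q" R "1/q"] q by (simp add: ennpowr_ennpowr)
  qed
  then have "(\<Sum>n. ennreal ((1/2) ^ n) * b n) \<le> (\<Sum>n. ennreal ((1/2) ^ n) * ennpowr R (1 / q))"
    by (intro suminf_le mult_left_mono) auto
  also have "\<dots> = (\<Sum>n. ennreal ((1/2) ^ n)) * ennpowr R (1 / q)"
    by (simp add: ennreal_suminf_multc)
  also have "(\<Sum>n. ennreal ((1/2::real) ^ n)) = ennreal 2"
    by (subst suminf_ennreal2) (auto simp: suminf_geometric summable_geometric)
  finally have "ennpowr (\<Sum>n. ennreal ((1/2) ^ n) * b n) q \<le> ennpowr (ennreal 2 * ennpowr R (1 / q)) q"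
    using q by (intro ennpowr_mono) auto
  also have "\<dots> = ennreal (2 powr q) * R"
    using q by (subst ennpowr_mult) (simp_all add: ennpowr_ennpowr)
  finally show ?thesis by (simp add: R_def)
qed

text \<open>
  The maximal function of a measurable function is measurable only with respect to the completion,
  so it is replaced by a measurable function g that agrees with it almost everywhere. The norm
  inequality is raised to the power q.
\<close>

lemma maximal_weighted_bound:
  fixes M :: "'a measure"
  assumes mb: "muckenhoupt_basis M \<B>" and q: "1 < q" and v: "v \<in> A_class M \<B> q"
  obtains N :: real where "1 \<le> N"
    "\<And>f. f \<in> borel_measurable M \<Longrightarrow> \<exists>g\<in>borel_measurable M. (AE x in M. maximal M \<B> f x = g x) \<and>
       (\<integral>\<^sup>+x. ennpowr (g x) q * ennreal (v x) \<partial>M) \<le> ennreal (N powr q) * (\<integral>\<^sup>+x. ennpowr (f x) q * ennreal (v x) \<partial>M)"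
proof -
  have [measurable]: "v \<in> borel_measurable M" using v by (auto simp: A_class_def weight_def)
  obtain C where C: "C < \<infinity>" "\<And>f. f \<in> borel_measurable M \<Longrightarrow>
      Lp_norm (density M v) q (maximal M \<B> f) \<le> C * Lp_norm (density M v) q f"
    using mb q v unfolding muckenhoupt_basis_def by blast
  define N where "N = max 1 (enn2real C)"
  have N: "1 \<le> N" "C \<le> ennreal N"
  proof -
    obtain r where "C = ennreal r" "0 \<le> r" using C(1) by (cases C) auto
    then show "1 \<le> N" "C \<le> ennreal N" by (auto simp: N_def intro: ennreal_leI)
  qed
  show ?thesis
  proof (rule that[OF N(1)])
    fix f :: "'a \<Rightarrow> ennreal" assume [measurable]: "f \<in> borel_measurable M"
    have "maximal M \<B> f \<in> borel_measurable (completion M)"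
      using mb by (auto simp: muckenhoupt_basis_def)
    from completion_ex_borel_measurable[OF this] obtain g
      where [measurable]: "g \<in> borel_measurable M" and g: "AE x in M. maximal M \<B> f x = g x" by blast
    have L: "Lp_norm (density M v) q h = ennpowr (\<integral>\<^sup>+x. ennpowr (h x) q * ennreal (v x) \<partial>M) (1 / q)"
      if [measurable]: "h \<in> borel_measurable M" for h
      unfolding Lp_norm_def by (subst nn_integral_density) (auto simp: mult.commute)
    have "AE x in density M v. maximal M \<B> f x = g x"
      using g by (subst AE_density) auto
    then have "(\<integral>\<^sup>+x. ennpowr (maximal M \<B> f x) q \<partial>density M v) = (\<integral>\<^sup>+x. ennpowr (g x) q \<partial>density M v)"
      by (intro nn_integral_cong_AE) auto
    then have "Lp_norm (density M v) q g \<le> C * Lp_norm (density M v) q f"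
      using C(2)[of f] by (simp add: Lp_norm_def)
    also have "\<dots> \<le> ennreal N * Lp_norm (density M v) q f" by (intro mult_right_mono N) auto
    finally have "ennpowr (\<integral>\<^sup>+x. ennpowr (g x) q * ennreal (v x) \<partial>M) (1 / q)
        \<le> ennreal N * ennpowr (\<integral>\<^sup>+x. ennpowr (f x) q * ennreal (v x) \<partial>M) (1 / q)"
      by (simp add: L)
    from ennpowr_mono[OF this, of q]
    have "(\<integral>\<^sup>+x. ennpowr (g x) q * ennreal (v x) \<partial>M)
        \<le> ennreal (N powr q) * (\<integral>\<^sup>+x. ennpowr (f x) q * ennreal (v x) \<partial>M)"
      using q N by (simp add: ennpowr_ennpowr ennpowr_mult)
    then show "\<exists>g\<in>borel_measurable M. (AE x in M. maximal M \<B> f x = g x) \<and>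
       (\<integral>\<^sup>+x. ennpowr (g x) q * ennreal (v x) \<partial>M) \<le> ennreal (N powr q) * (\<integral>\<^sup>+x. ennpowr (f x) q * ennreal (v x) \<partial>M)"
      using g by (intro bexI[of _ g]) auto
  qed
qed

text \<open>
  This is where \<sigma>-finiteness enters. The function serves twice: as a perturbation that makes
  a majorant strictly positive, and as a truncation level.
\<close>

lemma positive_integrable_function:
  fixes M :: "'a measure"
  assumes "sigma_finite_measure M"
  obtains k :: "'a \<Rightarrow> real" where "k \<in> borel_measurable M" "\<And>x. 0 < k x" "(\<integral>\<^sup>+x. ennreal (k x) \<partial>M) \<le> 1"
proof -
  interpret sigma_finite_measure M by fact
  obtain h where h[measurable]: "h \<in> borel_measurable M" and hI: "integral\<^sup>N M h \<noteq> \<infinity>"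
    and hp: "\<And>x. x \<in> space M \<Longrightarrow> 0 < h x \<and> h x < \<infinity>"
    using Ex_finite_integrable_function by blast
  define J where "J = enn2real (integral\<^sup>N M h)"
  define k where "k x = (if 0 < enn2real (h x) then enn2real (h x) else 1) / (J + 1)" for x
  have J: "0 \<le> J" "integral\<^sup>N M h = ennreal J" using hI by (auto simp: J_def less_top)
  have "(\<integral>\<^sup>+x. ennreal (k x) \<partial>M) = (\<integral>\<^sup>+x. ennreal (1 / (J + 1)) * h x \<partial>M)"
  proof (rule nn_integral_cong)
    fix x assume "x \<in> space M"
    then obtain r where "h x = ennreal r" "0 < r" using hp[of x] by (cases "h x") auto
    then show "ennreal (k x) = ennreal (1 / (J + 1)) * h x"
      using J by (simp add: k_def ennreal_mult[symmetric])
  qed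
  also have "\<dots> = ennreal (1 / (J + 1)) * ennreal J" by (simp add: nn_integral_cmult J)
  also have "\<dots> = ennreal (J / (J + 1))" using J by (simp add: ennreal_mult[symmetric])
  also have "\<dots> \<le> 1" using J by (simp add: ennreal_le_1)
  finally have "(\<integral>\<^sup>+x. ennreal (k x) \<partial>M) \<le> 1" .
  moreover have "k \<in> borel_measurable M" unfolding k_def by measurable
  moreover have "0 < k x" for x using J by (simp add: k_def)
  ultimately show ?thesis using that by blast
qed

text \<open>
  The majorant is the series of (4 N)^(-n) times the n-th iterated maximal function of h + \<kappa>,
  where N is the norm of the maximal operator on L^q(v): applying the maximal operator shifts the
  series by one index and hence costs at most the factor 4 N. The positive function \<kappa> has a
  norm controlled by \<Gamma> and makes the majorant positive even where h and all its averages
  vanish. The constant c depends on v and q only and serves for all h and \<Gamma>.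
\<close>

lemma rubio_de_francia:
  fixes M :: "'a measure"
  assumes sf: "sigma_finite_measure M" and mb: "muckenhoupt_basis M \<B>" and q: "1 < q"
    and v: "v \<in> A_class M \<B> q" and vpos: "\<And>x. 0 < v x"
  obtains c :: real where "1 \<le> c"
    "\<And>h \<Gamma>. h \<in> borel_measurable M \<Longrightarrow> (\<And>x. 0 \<le> h x) \<Longrightarrow> 0 < \<Gamma> \<Longrightarrow>
       (\<integral>\<^sup>+x. ennreal (h x powr q * v x) \<partial>M) \<le> ennreal \<Gamma> \<Longrightarrow>
       \<exists>H\<in>borel_measurable M. (\<forall>x. 0 < H x) \<and> (\<forall>x. h x \<le> H x) \<and>
         A1_bound M \<B> c H \<and>
         (\<integral>\<^sup>+x. ennreal (H x powr q * v x) \<partial>M) \<le> ennreal (c * \<Gamma>)"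
proof -
  have [measurable]: "v \<in> borel_measurable M" using v by (auto simp: A_class_def weight_def)
  have basis: "is_basis M \<B>" using mb by (simp add: muckenhoupt_basis_def)
  define I where "I f = (\<integral>\<^sup>+x. ennpowr (f x) q * ennreal (v x) \<partial>M)" for f
  obtain N :: real where N: "1 \<le> N" and "\<And>f. f \<in> borel_measurable M \<Longrightarrow>
      \<exists>g\<in>borel_measurable M. (AE x in M. maximal M \<B> f x = g x) \<and> I g \<le> ennreal (N powr q) * I f"
    unfolding I_def using maximal_weighted_bound[OF mb q v] by blast
  then obtain T where T: "\<And>f. f \<in> borel_measurable M \<Longrightarrow> T f \<in> borel_measurable M"
    "\<And>f. f \<in> borel_measurable M \<Longrightarrow> AE x in M. maximal M \<B> f x = T f x"
    "\<And>f. f \<in> borel_measurable M \<Longrightarrow> I (T f) \<le> ennreal (N powr q) * I f"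
    by metis
  (* 4 N is the factor in the A_1 condition, 4 * 4^q the one in the norm estimate of the
    series. *)
  define c where "c = 4 * N + 4 * 4 powr q"
  have c1: "1 \<le> c" using N by (simp add: c_def add_increasing2)
  obtain k where k[measurable]: "k \<in> borel_measurable M" and kpos: "\<And>x. 0 < k x"
    and kI: "(\<integral>\<^sup>+x. ennreal (k x) \<partial>M) \<le> 1"
    using positive_integrable_function[OF sf] by blast
  show ?thesis
  proof (rule that[OF c1])
    fix h :: "'a \<Rightarrow> real" and \<Gamma> :: real
    assume h[measurable]: "h \<in> borel_measurable M" and hpos: "\<And>x. 0 \<le> h x" and \<Gamma>: "0 < \<Gamma>"
      and hI: "(\<integral>\<^sup>+x. ennreal (h x powr q * v x) \<partial>M) \<le> ennreal \<Gamma>"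
    (* Chosen such that \<kappa>^q v = \<Gamma> k has integral at most \<Gamma>. *)
    define \<kappa> where "\<kappa> x = (\<Gamma> * k x / v x) powr (1 / q)" for x
    have [measurable]: "\<kappa> \<in> borel_measurable M" unfolding \<kappa>_def by measurable
    have \<kappa>: "0 < \<kappa> x" "\<kappa> x powr q * v x = \<Gamma> * k x" for x
      using \<Gamma> kpos[of x] vpos[of x] q by (auto simp: \<kappa>_def powr_powr)
    define F where "F n = (T ^^ n) (\<lambda>x. ennreal (h x + \<kappa> x))" for n
    have F0: "F 0 = (\<lambda>x. ennreal (h x + \<kappa> x))" and FS: "F (Suc n) = T (F n)" for n
      by (auto simp: F_def)
    have Fm[measurable]: "F n \<in> borel_measurable M" for n
      by (induction n) (auto simp: F0 FS T)
    have I0: "I (F 0) \<le> ennreal (2 * 2 powr q * \<Gamma>)"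
    proof -
      have "I (F 0) \<le> (\<integral>\<^sup>+x. ennreal (2 powr q) * (ennreal (h x powr q * v x) + ennreal \<Gamma> * ennreal (k x)) \<partial>M)"
        unfolding I_def F0
      proof (rule nn_integral_mono)
        fix x assume "x \<in> space M"
        have "(h x + \<kappa> x) powr q \<le> (2 * max (h x) (\<kappa> x)) powr q"
          using hpos[of x] \<kappa>(1)[of x] q by (intro powr_mono2) auto
        also have "\<dots> = 2 powr q * max (h x) (\<kappa> x) powr q"
          using hpos[of x] \<kappa>(1)[of x] by (simp add: powr_mult)
        also have "max (h x) (\<kappa> x) powr q \<le> h x powr q + \<kappa> x powr q"
          by (auto simp: max_def)
        finally have "(h x + \<kappa> x) powr q * v x \<le> 2 powr q * (h x powr q + \<kappa> x powr q) * v x"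
          using vpos[of x] by (intro mult_right_mono) auto
        also have "\<dots> = 2 powr q * (h x powr q * v x + \<Gamma> * k x)"
          using \<kappa>(2)[of x] by (simp add: algebra_simps)
        finally have "ennreal ((h x + \<kappa> x) powr q * v x) \<le> ennreal (2 powr q * (h x powr q * v x + \<Gamma> * k x))"
          by (rule ennreal_leI)
        moreover have "0 \<le> h x + \<kappa> x" "0 < v x" "0 < k x" using hpos[of x] \<kappa>(1)[of x] vpos[of x] kpos[of x] by auto
        ultimately show "ennpowr (ennreal (h x + \<kappa> x)) q * ennreal (v x)
            \<le> ennreal (2 powr q) * (ennreal (h x powr q * v x) + ennreal \<Gamma> * ennreal (k x))"
          using \<Gamma> by (simp add: ennpowr_ennreal ennreal_mult[symmetric] ennreal_plus[symmetric] del: ennreal_plus)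
      qed
      also have "\<dots> = ennreal (2 powr q) * ((\<integral>\<^sup>+x. ennreal (h x powr q * v x) \<partial>M) + ennreal \<Gamma> * (\<integral>\<^sup>+x. ennreal (k x) \<partial>M))"
        by (simp add: nn_integral_cmult nn_integral_add)
      also have "\<dots> \<le> ennreal (2 powr q) * (ennreal \<Gamma> + ennreal \<Gamma> * 1)"
        by (intro mult_left_mono add_mono hI kI) auto
      also have "\<dots> = ennreal (2 * 2 powr q * \<Gamma>)"
        using \<Gamma> by (simp add: ennreal_mult[symmetric] ennreal_plus[symmetric] del: ennreal_plus)
      finally show ?thesis .
    qed
    have In: "I (F n) \<le> ennreal ((N powr q) ^ n * (2 * 2 powr q * \<Gamma>))" for n
    proof (induction n)
      case 0 then show ?case using I0 by simp
    next
      case (Suc n)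
      have "I (F (Suc n)) \<le> ennreal (N powr q) * I (F n)" unfolding FS by (intro T) simp
      also have "\<dots> \<le> ennreal (N powr q) * ennreal ((N powr q) ^ n * (2 * 2 powr q * \<Gamma>))"
        by (intro mult_left_mono Suc) auto
      also have "\<dots> = ennreal ((N powr q) ^ Suc n * (2 * 2 powr q * \<Gamma>))"
        using \<Gamma> by (subst ennreal_mult[symmetric]) (auto simp: mult.assoc)
      finally show ?case .
    qed
    define S where "S x = (\<Sum>n. ennreal ((1 / (4 * N)) ^ n) * F n x)" for x
    have Sm[measurable]: "S \<in> borel_measurable M" unfolding S_def by measurable
    (* The factor (1/2)^n is split off for weighted_geometric_sum_power_le; the other factor (2
      N)^(-n) compensates the growth N^n of the iterates. *)
    have S2: "S x = (\<Sum>n. ennreal ((1/2) ^ n) * (ennreal ((1 / (2 * N)) ^ n) * F n x))" for x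
    proof -
      have "ennreal ((1 / (4 * N)) ^ n) = ennreal ((1/2) ^ n) * ennreal ((1 / (2 * N)) ^ n)" for n
        using N by (simp add: ennreal_mult[symmetric] power_mult_distrib[symmetric])
      then show ?thesis unfolding S_def by (simp add: mult.assoc)
    qed
    have SI: "I S \<le> ennreal (c * \<Gamma>)"
    proof -
      have "I S \<le> (\<integral>\<^sup>+x. ennreal (2 powr q) * (\<Sum>n. ennpowr (ennreal ((1 / (2 * N)) ^ n) * F n x) q) * ennreal (v x) \<partial>M)"
        unfolding I_def S2 using q by (intro nn_integral_mono mult_right_mono weighted_geometric_sum_power_le) auto
      also have "\<dots> = (\<integral>\<^sup>+x. ennreal (2 powr q) * (\<Sum>n. ennreal (((1 / (2 * N)) ^ n) powr q) * (ennpowr (F n x) q * ennreal (v x))) \<partial>M)"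
        using N by (simp add: ennpowr_mult mult.assoc ennreal_suminf_multc[symmetric])
      also have "\<dots> = ennreal (2 powr q) * (\<Sum>n. ennreal (((1 / (2 * N)) ^ n) powr q) * I (F n))"
        unfolding I_def by (simp add: nn_integral_cmult nn_integral_suminf)
      also have "\<dots> \<le> ennreal (2 powr q) * (\<Sum>n. ennreal ((1/2) ^ n) * ennreal (2 * 2 powr q * \<Gamma>))"
      proof (intro mult_left_mono suminf_le)
        fix n
        have "ennreal (((1 / (2 * N)) ^ n) powr q) * I (F n) \<le> ennreal (((1 / (2 * N)) ^ n) powr q) * ennreal ((N powr q) ^ n * (2 * 2 powr q * \<Gamma>))"
          by (intro mult_left_mono In) auto
        also have "\<dots> = ennreal (((1 / (2 * N)) ^ n) powr q * (N powr q) ^ n * (2 * 2 powr q * \<Gamma>))"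
          using \<Gamma> N by (simp add: ennreal_mult[symmetric] mult.assoc)
        also have "((1 / (2 * N)) ^ n) powr q * (N powr q) ^ n = ((1/2) powr q) ^ n"
        proof -
          have "((1 / (2 * N)) ^ n) powr q = ((1 / (2 * N)) powr q) ^ n"
            using N by (simp add: powr_powr mult.commute flip: powr_realpow)
          moreover have "(1 / (2 * N)) powr q * N powr q = (1/2) powr q"
            using N by (subst powr_mult[symmetric]) auto
          ultimately show ?thesis by (simp add: power_mult_distrib[symmetric])
        qed
        also have "ennreal (((1/2) powr q) ^ n * (2 * 2 powr q * \<Gamma>)) \<le> ennreal ((1/2) ^ n * (2 * 2 powr q * \<Gamma>))"
        proof (intro ennreal_leI mult_right_mono power_mono)
          show "(1/2) powr q \<le> (1/2::real)" using q powr_mono'[of 1 q "1/2::real"] by simp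
        qed (use \<Gamma> in auto)
        also have "\<dots> = ennreal ((1/2) ^ n) * ennreal (2 * 2 powr q * \<Gamma>)"
          using \<Gamma> by (simp add: ennreal_mult)
        finally show "ennreal (((1 / (2 * N)) ^ n) powr q) * I (F n) \<le> ennreal ((1/2) ^ n) * ennreal (2 * 2 powr q * \<Gamma>)" .
      qed auto
      also have "\<dots> = ennreal (2 powr q) * ((\<Sum>n. ennreal ((1/2) ^ n)) * ennreal (2 * 2 powr q * \<Gamma>))"
        by (simp add: ennreal_suminf_multc)
      also have "(\<Sum>n. ennreal ((1/2::real) ^ n)) = ennreal 2"
        by (subst suminf_ennreal2) (auto simp: suminf_geometric summable_geometric)
      also have "ennreal (2 powr q) * (ennreal 2 * ennreal (2 * 2 powr q * \<Gamma>)) = ennreal (4 * (2 powr q * 2 powr q) * \<Gamma>)"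
      proof -
        have "ennreal a * (ennreal 2 * ennreal b) = ennreal (a * (2 * b))" if "0 \<le> a" "0 \<le> b" for a b
          using that by (simp add: ennreal_mult)
        from this[of "2 powr q" "2 * 2 powr q * \<Gamma>"]
        have "ennreal (2 powr q) * (ennreal 2 * ennreal (2 * 2 powr q * \<Gamma>)) = ennreal (2 powr q * (2 * (2 * 2 powr q * \<Gamma>)))"
          using \<Gamma> by simp
        also have "2 powr q * (2 * (2 * 2 powr q * \<Gamma>)) = 4 * (2 powr q * 2 powr q) * \<Gamma>" by simp
        finally show ?thesis .
      qed
      also have "2 powr q * 2 powr q = (4::real) powr q" by (simp flip: powr_mult)
      also have "ennreal (4 * 4 powr q * \<Gamma>) \<le> ennreal (c * \<Gamma>)"
        using \<Gamma> N by (intro ennreal_leI mult_right_mono) (auto simp: c_def)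
      finally show ?thesis .
    qed
    have SM: "AE x in M. maximal M \<B> S x \<le> ennreal c * S x"
    proof -
      have "AE x in M. \<forall>n. maximal M \<B> (F n) x = F (Suc n) x"
        unfolding FS AE_all_countable by (auto intro: T)
      then show ?thesis
      proof eventually_elim
        case (elim x)
        have "maximal M \<B> S x \<le> (\<Sum>n. ennreal ((1 / (4 * N)) ^ n) * maximal M \<B> (F n) x)"
          unfolding S_def by (rule maximal_suminf_le[OF basis]) simp
        also have "\<dots> = (\<Sum>n. ennreal (4 * N) * (ennreal ((1 / (4 * N)) ^ Suc n) * F (Suc n) x))"
        proof (rule suminf_cong)
          fix n
          have "(1 / (4 * N)) ^ n = 4 * N * (1 / (4 * N)) ^ Suc n" using N by simp
          then have "ennreal ((1 / (4 * N)) ^ n) = ennreal (4 * N) * ennreal ((1 / (4 * N)) ^ Suc n)"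
            using N by (simp only: ennreal_mult[symmetric]) (subst ennreal_mult[symmetric]; simp)
          then show "ennreal ((1 / (4 * N)) ^ n) * maximal M \<B> (F n) x = ennreal (4 * N) * (ennreal ((1 / (4 * N)) ^ Suc n) * F (Suc n) x)"
            using elim by (simp add: mult.assoc)
        qed
        also have "\<dots> = ennreal (4 * N) * (\<Sum>n. ennreal ((1 / (4 * N)) ^ Suc n) * F (Suc n) x)"
          by (rule ennreal_suminf_cmult)
        also have "(\<Sum>n. ennreal ((1 / (4 * N)) ^ Suc n) * F (Suc n) x) \<le> S x"
          unfolding S_def by (subst suminf_offset[of _ 1]) (auto)
        also have "ennreal (4 * N) \<le> ennreal c" by (intro ennreal_leI) (simp add: c_def)
        finally show ?case by (simp add: mult_left_mono mult_right_mono)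
      qed
    qed
    (* S is finite almost everywhere. The value h + 1 on the exceptional null set keeps H
      positive and above h at every point. *)
    define H where "H x = (if S x = \<infinity> then h x + 1 else enn2real (S x))" for x
    have Hm[measurable]: "H \<in> borel_measurable M" unfolding H_def by measurable
    have S0: "ennreal (h x + \<kappa> x) \<le> S x" for x
    proof -
      have "ennreal ((1 / (4 * N)) ^ 0) * F 0 x \<le> S x"
        unfolding S_def using sum_le_suminf[of "\<lambda>n. ennreal ((1 / (4 * N)) ^ n) * F n x" "{0}"] by simp
      then show ?thesis by (simp add: F0)
    qed
    have Hh: "h x \<le> H x \<and> 0 < H x" for x
    proof (cases "S x = \<infinity>")
      case True then show ?thesis using hpos[of x] by (simp add: H_def add_nonneg_pos)
    next
      case False
      then obtain s where s: "S x = ennreal s" "0 \<le> s" by (cases "S x") auto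
      then have "h x + \<kappa> x \<le> s" using S0[of x] by simp
      then show ?thesis using s hpos[of x] \<kappa>(1)[of x] by (simp add: H_def)
    qed
    have "AE x in M. ennpowr (S x) q * ennreal (v x) \<noteq> \<infinity>"
    proof (rule nn_integral_PInf_AE)
      show "(\<integral>\<^sup>+x. ennpowr (S x) q * ennreal (v x) \<partial>M) \<noteq> \<infinity>" using SI by (auto simp: I_def top_unique)
    qed measurable
    then have SH: "AE x in M. S x = ennreal (H x)"
    proof eventually_elim
      case (elim x)
      then have "S x \<noteq> \<infinity>" using vpos[of x] by (auto simp: ennpowr_def ennreal_top_mult)
      then show ?case by (cases "S x") (auto simp: H_def)
    qed
    show "\<exists>H\<in>borel_measurable M. (\<forall>x. 0 < H x) \<and> (\<forall>x. h x \<le> H x) \<and>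
         A1_bound M \<B> c H \<and>
         (\<integral>\<^sup>+x. ennreal (H x powr q * v x) \<partial>M) \<le> ennreal (c * \<Gamma>)"
    proof (intro bexI[of _ H] conjI allI)
      have "maximal M \<B> (\<lambda>y. ennreal (H y)) = maximal M \<B> S"
        by (rule maximal_cong_AE) (use SH in auto)
      then show "A1_bound M \<B> c H" unfolding A1_bound_def
        using SM SH c1 by (auto simp: ennreal_mult Hh less_imp_le)
      have "(\<integral>\<^sup>+x. ennreal (H x powr q * v x) \<partial>M) = I S" unfolding I_def
      proof (rule nn_integral_cong_AE)
        show "AE x in M. ennreal (H x powr q * v x) = ennpowr (S x) q * ennreal (v x)"
          using SH
        proof eventually_elim
          case (elim x)
          have "0 < H x" "0 < v x" using Hh vpos by auto
          then show ?case by (simp add: elim ennpowr_ennreal ennreal_mult)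
        qed
      qed
      then show "(\<integral>\<^sup>+x. ennreal (H x powr q * v x) \<partial>M) \<le> ennreal (c * \<Gamma>)" using SI by simp
    qed (use Hh in auto)
  qed
qed

section \<open>Muckenhoupt and reverse Hoelder classes as two-sided conditions\<close>

text \<open>
  The geometric mean of W and 1 / W is the constant 1, so by log-convexity the two norms cannot both
  be small.
\<close>

lemma mean_le_reciprocal_lower:
  fixes W :: "'a \<Rightarrow> real"
  assumes B: "B \<in> sets M" "0 < emeasure M B" "emeasure M B < \<infinity>"
    and [measurable]: "W \<in> borel_measurable M" and pos: "\<And>x. 0 < W x"
    and l: "0 < l" and \<alpha>: "0 \<le> \<alpha>" and p: "0 < p"
    and W: "mean_le M B \<alpha> (\<lambda>x. 1 / W x) l"
  shows "ennreal ((1 / l) powr p) \<le> average M B (\<lambda>x. ennreal (W x powr p))"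
proof (rule ccontr)
  assume "\<not> ?thesis"
  then have lt: "average M B (\<lambda>x. ennreal (W x powr p)) < ennreal ((1 / l) powr p)" by simp
  then obtain r where r: "average M B (\<lambda>x. ennreal (W x powr p)) \<le> ennreal r" "0 < r" "r < (1 / l) powr p"
  proof -
    obtain s where s: "average M B (\<lambda>x. ennreal (W x powr p)) = ennreal s" "0 \<le> s"
      using lt by (cases "average M B (\<lambda>x. ennreal (W x powr p))") auto
    then have "s < (1 / l) powr p" using lt by (simp add: ennreal_less_iff)
    then show ?thesis using s l by (intro that[of "(s + (1 / l) powr p) / 2"]) (auto intro!: ennreal_leI add_nonneg_pos)
  qed
  define k where "k = r powr (1 / p)"
  have k: "0 < k" "k powr p = r" using r p by (auto simp: k_def powr_powr)
  have "mean_le M B (1 / p) W k" using r p k by (simp add: mean_le_def)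
  from mean_le_geometric[OF B _ _ pos _ k(1) l _ _ _ \<alpha> this W, of "1/2"] pos p
  have "mean_le M B ((1 / p + \<alpha>) / 2) (\<lambda>x. W x powr (1/2) * (1 / W x) powr (1/2)) (k powr (1/2) * l powr (1/2))"
    by (simp add: field_simps)
  moreover have "W x powr (1/2) * (1 / W x) powr (1/2) = 1" for x
    using pos[of x] less_imp_neq[OF pos, of x] by (simp add: powr_mult[symmetric])
  moreover have "k powr (1/2) * l powr (1/2) = (k * l) powr (1/2)" using k l by (simp add: powr_mult)
  ultimately have "mean_le M B ((1 / p + \<alpha>) / 2) (\<lambda>x. 1) ((k * l) powr (1/2))" by simp
  moreover have "0 < (1 / p + \<alpha>) / 2" using p \<alpha> by (simp add: add_pos_nonneg)
  ultimately have "1 \<le> ((k * l) powr (1/2)) powr (1 / ((1 / p + \<alpha>) / 2))"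
    using average_const[OF B, of 1] by (simp add: mean_le_def)
  moreover have "((k * l) powr (1/2)) powr (1 / ((1 / p + \<alpha>) / 2)) < 1"
  proof -
    have "k powr p < (1 / l) powr p" using r k by simp
    then have "k < 1 / l" using powr_mono2[of p "1 / l" k] p l by (force simp: not_le[symmetric])
    then have "k * l < 1" using l by (simp add: field_simps)
    then show ?thesis
      using k l p \<alpha> powr_less_mono2[of "1 / (1 / p + \<alpha>)" "k * l" 1] by (simp add: powr_powr add_pos_nonneg)
  qed
  ultimately show False by simp
qed

lemma ennreal_divide_le:
  assumes "X \<le> ennreal x" "ennreal y \<le> Y" "0 < y" "0 \<le> x"
  shows "X / Y \<le> ennreal (x / y)"
proof -
  obtain r where r: "X = ennreal r" "0 \<le> r" "r \<le> x"
    using assms by (cases X) (auto simp: top_unique)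
  show ?thesis
  proof (cases Y)
    case (real t)
    then show ?thesis using r assms by (simp add: divide_ennreal frac_le)
  next
    case top
    then show ?thesis using r by simp
  qed
qed

text \<open>
  With q = (\<alpha> + \<beta>) / \<beta> and v = U^(1/\<beta>) one has v^(1-q') = U^(-1/\<alpha>),
  so the A_q condition for v is the two-sided condition for U raised to the power 1/\<beta>.
\<close>

lemma A_class_of_bump:
  fixes U :: "'a \<Rightarrow> real"
  assumes [measurable]: "U \<in> borel_measurable M" and pos: "\<And>x. 0 < U x"
    and \<alpha>: "0 < \<alpha>" "0 < \<beta>" and D: "0 < D" and U: "bump M \<B> \<alpha> \<beta> U D"
  shows "(\<lambda>x. U x powr (1 / \<beta>)) \<in> A_class M \<B> ((\<alpha> + \<beta>) / \<beta>)"
proof -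
  define q where "q = (\<alpha> + \<beta>) / \<beta>"
  have q: "q \<noteq> 1" "q - 1 = \<alpha> / \<beta>" using \<alpha> by (auto simp: q_def field_simps)
  have e: "1 - q / (q - 1) = - \<beta> / \<alpha>" using \<alpha> unfolding q(2) by (simp add: q_def field_simps)
  have "average M B (\<lambda>x. ennreal (U x powr (1 / \<beta>))) *
      ennpowr (average M B (\<lambda>x. ennreal ((U x powr (1 / \<beta>)) powr (1 - q / (q - 1))))) (q - 1) \<le> ennreal (D powr (1 / \<beta>))"
    if "B \<in> \<B>" for B
  proof -
    obtain k where k: "k > 0" "mean_le M B \<beta> U k" "mean_le M B \<alpha> (\<lambda>x. 1 / U x) (D / k)"
      using U \<open>B \<in> \<B>\<close> by (auto simp: bump_def)
    have *: "(U x powr (1 / \<beta>)) powr (1 - q / (q - 1)) = (1 / U x) powr (1 / \<alpha>)" for x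
      unfolding e using pos[of x] \<alpha> by (simp add: powr_powr powr_minus_divide powr_divide)
    have "average M B (\<lambda>x. ennreal (U x powr (1 / \<beta>))) *
        ennpowr (average M B (\<lambda>x. ennreal ((U x powr (1 / \<beta>)) powr (1 - q / (q - 1))))) (q - 1)
       \<le> ennreal (k powr (1 / \<beta>)) * ennpowr (ennreal ((D / k) powr (1 / \<alpha>))) (q - 1)"
      unfolding * using k \<alpha> by (intro mult_mono ennpowr_mono) (auto simp: mean_le_def q)
    also have "\<dots> = ennreal (k powr (1 / \<beta>) * (D / k) powr (1 / \<beta>))"
      using \<alpha> by (simp add: ennpowr_ennreal q powr_powr ennreal_mult)
    also have "k powr (1 / \<beta>) * (D / k) powr (1 / \<beta>) = D powr (1 / \<beta>)"
      using k D by (simp add: powr_divide)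
    finally show ?thesis .
  qed
  then have "A_const M \<B> q (\<lambda>x. U x powr (1 / \<beta>)) \<le> ennreal (D powr (1 / \<beta>))"
    using q by (auto simp: A_const_def intro!: SUP_least)
  then have "A_const M \<B> q (\<lambda>x. U x powr (1 / \<beta>)) < \<infinity>"
    by (rule order_le_less_trans) simp
  then show ?thesis using pos less_imp_neq[OF pos] unfolding q_def[symmetric] A_class_def weight_def
    by (auto simp: less_imp_neq[symmetric])
qed

lemma average_pos:
  fixes f :: "'a \<Rightarrow> ennreal"
  assumes B: "B \<in> sets M" "0 < emeasure M B" "emeasure M B < \<infinity>"
    and f[measurable]: "f \<in> borel_measurable M" and pos: "AE x in M. x \<in> B \<longrightarrow> 0 < f x"
  shows "0 < average M B f"
proof (rule ccontr)
  assume "\<not> ?thesis"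
  then have "(\<integral>\<^sup>+x. f x * indicator B x \<partial>M) / emeasure M B = 0" by (simp add: average_def)
  then have "(\<integral>\<^sup>+x. f x * indicator B x \<partial>M) = 0" using B by (auto simp: ennreal_divide_eq_0_iff)
  then have "AE x in M. f x * indicator B x = 0" using B by (subst (asm) nn_integral_0_iff_AE) auto
  with pos have "AE x in M. x \<notin> B" by eventually_elim (auto split: split_indicator_asm)
  then have "emeasure M B = 0" using B(1)
    by (subst (asm) AE_iff_measurable[OF B(1)]) (auto dest: sets.sets_into_space)
  then show False using B by simp
qed

text \<open>
  A reverse Hoelder inequality in a form that transports upper bounds for averages. For t =
  \<infinity> the exponent 2 is as good as any other.
\<close>

lemma RH_average:
  fixes \<sigma> :: "'a \<Rightarrow> real"
  assumes B: "is_basis M \<B>" and \<sigma>: "\<sigma> \<in> RH_class M \<B> t" "1 < t" and pos: "\<And>x. 0 < \<sigma> x"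
  obtains s C :: real where "1 < s" "1 \<le> C"
    "\<And>B y. B \<in> \<B> \<Longrightarrow> 0 < y \<Longrightarrow> average M B (\<lambda>x. ennreal (\<sigma> x)) \<le> ennreal y \<Longrightarrow>
       average M B (\<lambda>x. ennreal (\<sigma> x powr s)) \<le> ennreal ((C * y) powr s)"
proof -
  have [measurable]: "\<sigma> \<in> borel_measurable M" and fin: "RH_const M \<B> t \<sigma> < \<infinity>"
    using \<sigma> by (auto simp: RH_class_def weight_def)
  define C where "C = 1 + enn2real (RH_const M \<B> t \<sigma>)"
  have C: "1 \<le> C" "RH_const M \<B> t \<sigma> < ennreal C"
    using fin by (cases "RH_const M \<B> t \<sigma>"; auto simp: C_def ennreal_less_iff)+
  have le: "X \<le> ennreal (C * y)" "X < ennreal (C * y)"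
    if q: "X / average M B (\<lambda>x. ennreal (\<sigma> x)) \<le> RH_const M \<B> t \<sigma>" and "B \<in> \<B>" "0 < y"
      and y: "average M B (\<lambda>x. ennreal (\<sigma> x)) \<le> ennreal y" for X B y
  proof -
    have B': "B \<in> sets M" "0 < emeasure M B" "emeasure M B < \<infinity>" using B \<open>B \<in> \<B>\<close> by (auto simp: is_basis_def)
    define a where "a = average M B (\<lambda>x. ennreal (\<sigma> x))"
    have a: "0 < a" unfolding a_def by (rule average_pos) (use B' pos in auto)
    have "a \<noteq> \<infinity>" using y by (auto simp: a_def top_unique)
    have "X = X / a * a" using a \<open>a \<noteq> \<infinity>\<close> by (simp add: ennreal_divide_times ennreal_times_divide[symmetric] less_top)
    also have "\<dots> \<le> RH_const M \<B> t \<sigma> * a" using q by (intro mult_right_mono) (auto simp: a_def)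
    also have "\<dots> < ennreal C * a" using C a \<open>a \<noteq> \<infinity>\<close> by (intro ennreal_mult_strict_right_mono) (auto simp: less_top)
    also have "\<dots> \<le> ennreal C * ennreal y" using y by (intro mult_left_mono) (auto simp: a_def)
    also have "\<dots> = ennreal (C * y)" using C \<open>0 < y\<close> by (simp add: ennreal_mult)
    finally show "X < ennreal (C * y)" .
    then show "X \<le> ennreal (C * y)" by simp
  qed
  show ?thesis
  proof (cases "t = \<infinity>")
    case True
    show ?thesis
    proof (rule that[of 2 C])
      fix B y assume *: "B \<in> \<B>" "0 < y" "average M B (\<lambda>x. ennreal (\<sigma> x)) \<le> ennreal y"
      have B': "B \<in> sets M" "0 < emeasure M B" "emeasure M B < \<infinity>" using B \<open>B \<in> \<B>\<close> by (auto simp: is_basis_def)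
      have "Linf_norm M (\<lambda>x. ennreal (\<sigma> x) * indicator B x) / average M B (\<lambda>x. ennreal (\<sigma> x)) \<le> RH_const M \<B> t \<sigma>"
        using True * by (auto simp: RH_const_def intro!: SUP_upper)
      from le(2)[OF this *] obtain c where c: "c < ennreal (C * y)" "AE x in M. ennreal (\<sigma> x) * indicator B x \<le> c"
        unfolding Linf_norm_def Inf_less_iff by auto
      have "AE x in M. x \<in> B \<longrightarrow> ennreal (\<sigma> x powr 2) \<le> ennreal ((C * y) powr 2)"
        using c(2)
      proof eventually_elim
        case (elim x)
        show ?case
        proof
          assume "x \<in> B"
          then have "ennreal (\<sigma> x) \<le> ennreal (C * y)" using elim c(1) by auto
          then have "\<sigma> x \<le> C * y" using C * by simp
          then show "ennreal (\<sigma> x powr 2) \<le> ennreal ((C * y) powr 2)" 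
            using pos[of x] by (intro ennreal_leI powr_mono2) auto
        qed
      qed
      from average_mono_AE[OF this] average_const[OF B']
      show "average M B (\<lambda>x. ennreal (\<sigma> x powr 2)) \<le> ennreal ((C * y) powr 2)" by simp
    qed (use C in auto)
  next
    case False
    then obtain s where s: "t = ereal s" "1 < s" using \<sigma>(2) by (cases t) (auto simp: one_ereal_def)
    show ?thesis
    proof (rule that[of s C])
      fix B y assume *: "B \<in> \<B>" "0 < y" "average M B (\<lambda>x. ennreal (\<sigma> x)) \<le> ennreal y"
      have "ennpowr (average M B (\<lambda>x. ennreal (\<sigma> x powr s))) (1 / s) / average M B (\<lambda>x. ennreal (\<sigma> x)) \<le> RH_const M \<B> t \<sigma>"
        using s * by (auto simp: RH_const_def one_ereal_def intro!: SUP_upper2[OF *(1)])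
      from le(1)[OF this *] have "ennpowr (average M B (\<lambda>x. ennreal (\<sigma> x powr s))) (1 / s) \<le> ennreal (C * y)" .
      from ennpowr_mono[OF this, of s] s C *
      show "average M B (\<lambda>x. ennreal (\<sigma> x powr s)) \<le> ennreal ((C * y) powr s)"
        by (simp add: ennpowr_ennpowr ennpowr_ennreal)
    qed (use C s in auto)
  qed
qed

text \<open>
  The power \<sigma> = U^(-1/\<alpha>) is a Muckenhoupt weight by duality, so by the inclusion it
  satisfies a reverse Hoelder inequality with some exponent s > 1. That replaces the norm of 1 / U
  in L^(1/\<alpha>) by the norm in L^(s/\<alpha>).
\<close>

lemma bump_self_improvement:
  fixes U :: "'a \<Rightarrow> real"
  assumes B: "is_basis M \<B>" and incl: "A_infty M \<B> \<subseteq> (\<Union>s\<in>{1<..}. RH_class M \<B> s)"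
    and [measurable]: "U \<in> borel_measurable M" and pos: "\<And>x. 0 < U x"
    and \<alpha>: "0 < \<alpha>" "0 < \<beta>" and D: "0 < D" and U: "bump M \<B> \<alpha> \<beta> U D"
  obtains s E :: real where "1 < s" "0 < E" "bump M \<B> (\<alpha> / s) \<beta> U E"
proof -
  define \<sigma> where "\<sigma> x = (1 / U x) powr (1 / \<alpha>)" for x
  have "bump M \<B> \<beta> \<alpha> (\<lambda>x. 1 / U x) D" by (rule bump_inverse) fact+
  then have "\<sigma> \<in> A_class M \<B> ((\<beta> + \<alpha>) / \<alpha>)" unfolding \<sigma>_def
    by (intro A_class_of_bump) (use pos \<alpha> D in auto)
  then have "\<sigma> \<in> A_infty M \<B>" using \<alpha> by (auto simp: A_infty_def intro!: bexI[of _ "(\<beta> + \<alpha>) / \<alpha>"])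
  then obtain t where t: "\<sigma> \<in> RH_class M \<B> t" "1 < t" using incl by auto
  have \<sigma>pos: "0 < \<sigma> x" for x using pos[of x] by (simp add: \<sigma>_def)
  obtain s C where s: "1 < s" "1 \<le> C" and av: "\<And>B y. B \<in> \<B> \<Longrightarrow> 0 < y \<Longrightarrow> average M B (\<lambda>x. ennreal (\<sigma> x)) \<le> ennreal y \<Longrightarrow>
       average M B (\<lambda>x. ennreal (\<sigma> x powr s)) \<le> ennreal ((C * y) powr s)"
    using RH_average[OF B t \<sigma>pos] by metis
  show ?thesis
  proof (rule that[OF s(1)])
    show "0 < C powr \<alpha> * D" using s D by simp
    (* The witnesses k are kept; only the second average is improved. *)
    show "bump M \<B> (\<alpha> / s) \<beta> U (C powr \<alpha> * D)"
      unfolding bump_def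
    proof
      fix B assume "B \<in> \<B>"
      then obtain k where k: "k > 0" "mean_le M B \<beta> U k" "mean_le M B \<alpha> (\<lambda>x. 1 / U x) (D / k)"
        using U by (auto simp: bump_def)
      have "average M B (\<lambda>x. ennreal (\<sigma> x powr s)) \<le> ennreal ((C * (D / k) powr (1 / \<alpha>)) powr s)"
        using k \<alpha> D by (intro av \<open>B \<in> \<B>\<close>) (auto simp: mean_le_def \<sigma>_def)
      moreover have "\<sigma> x powr s = (1 / U x) powr (1 / (\<alpha> / s))" for x
        using pos[of x] by (simp add: \<sigma>_def powr_powr)
      moreover have "(C * (D / k) powr (1 / \<alpha>)) powr s = (C powr \<alpha> * D / k) powr (1 / (\<alpha> / s))"
      proof -
        have "C powr \<alpha> * D / k = C powr \<alpha> * (D / k)" by simp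
        moreover have "(C powr \<alpha> * (D / k)) powr (s / \<alpha>) = C powr s * (D / k) powr (s / \<alpha>)"
          using s k D \<alpha> by (subst powr_mult) (auto simp: powr_powr)
        moreover have "(C * (D / k) powr (1 / \<alpha>)) powr s = C powr s * (D / k) powr (s / \<alpha>)"
          using s k D \<alpha> by (subst powr_mult) (auto simp: powr_powr)
        ultimately show ?thesis by simp
      qed
      ultimately have "mean_le M B (\<alpha> / s) (\<lambda>x. 1 / U x) (C powr \<alpha> * D / k)"
        using \<alpha> s by (simp add: mean_le_def)
      then show "\<exists>k>0. mean_le M B \<beta> U k \<and> mean_le M B (\<alpha> / s) (\<lambda>x. 1 / U x) (C powr \<alpha> * D / k)"
        using k by blast
    qed
  qed
qed

lemma bump_mono_exponent:
  fixes U :: "'a \<Rightarrow> real"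
  assumes B: "is_basis M \<B>" and [measurable]: "U \<in> borel_measurable M" and pos: "\<And>x. 0 < U x"
    and D: "0 < D" and \<alpha>: "0 \<le> \<alpha>" "\<alpha> \<le> \<alpha>'" and \<beta>: "0 \<le> \<beta>" "\<beta> \<le> \<beta>'" and U: "bump M \<B> \<alpha> \<beta> U D"
  shows "bump M \<B> \<alpha>' \<beta>' U D"
  unfolding bump_def
proof
  fix B assume "B \<in> \<B>"
  then have B': "B \<in> sets M" "0 < emeasure M B" "emeasure M B < \<infinity>" using B by (auto simp: is_basis_def)
  obtain k where k: "k > 0" "mean_le M B \<beta> U k" "mean_le M B \<alpha> (\<lambda>x. 1 / U x) (D / k)"
    using U \<open>B \<in> \<B>\<close> by (auto simp: bump_def)
  have "mean_le M B \<beta>' U k" by (rule mean_le_mono_exponent[where \<beta>=\<beta>]) (use B' pos k \<beta> in auto)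
  moreover have "mean_le M B \<alpha>' (\<lambda>x. 1 / U x) (D / k)"
    by (rule mean_le_mono_exponent[where \<beta>=\<alpha>]) (use B' pos k \<alpha> D in auto)
  ultimately show "\<exists>k>0. mean_le M B \<beta>' U k \<and> mean_le M B \<alpha>' (\<lambda>x. 1 / U x) (D / k)" using k by blast
qed

text \<open>
  The convention 1 / \<infinity> = 0 is built in; the conversion of \<open>ereal\<close> to
  \<open>real\<close> alone would rely on its default value 0 at \<infinity>.
\<close>

definition inv_exponent :: "ereal \<Rightarrow> real" where
  "inv_exponent b = (if b = \<infinity> then 0 else 1 / real_of_ereal b)"

lemma inv_exponent_bounds:
  assumes "0 < p" "ereal p \<le> b"
  shows "0 \<le> inv_exponent b" "inv_exponent b \<le> 1 / p" "ereal p < b \<Longrightarrow> inv_exponent b < 1 / p"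
    "inv_exponent b = 1 / p \<Longrightarrow> b = ereal p"
  using assms by (cases b; auto simp: inv_exponent_def frac_le divide_strict_left_mono)+

lemma holder_conj_exponent:
  assumes "0 < p" "ereal p \<le> b"
  shows "holder_conj (b / ereal p) = (if inv_exponent b = 1 / p then \<infinity> else ereal (1 / (1 - p * inv_exponent b)))"
proof (cases b)
  case (real r)
  then have r: "p \<le> r" "0 < r" using assms by auto
  show ?thesis
  proof (cases "r = p")
    case True then show ?thesis using real r by (simp add: holder_conj_def inv_exponent_def one_ereal_def)
  next
    case False
    then have "r > p" using r by simp
    have e: "b / ereal p = ereal (r / p)" using real assms by simp
    have "r / p \<noteq> 1" using False assms by simp
    then have "holder_conj (b / ereal p) = ereal ((r / p) / (r / p - 1))"
      unfolding e holder_conj_def by (simp add: one_ereal_def)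
    also have "(r / p) / (r / p - 1) = 1 / (1 - p * inv_exponent b)"
      using \<open>r > p\<close> assms r real by (simp add: inv_exponent_def field_simps)
    finally show ?thesis using real r False assms by (simp add: inv_exponent_def)
  qed
next
  case PInf
  then show ?thesis using assms by (simp add: holder_conj_def inv_exponent_def one_ereal_def)
next
  case MInf
  then show ?thesis using assms by simp
qed

text \<open>
  The A condition bounds the product of the average of w = u^p and a power of the average of
  w^(-1/(p \<alpha>)); the reverse Hoelder condition replaces the first factor by the norm of w in
  L^\<sigma> with \<sigma> = 1 / (p \<beta>) = (b/p)'. The function u is only almost everywhere
  positive and U is a version of it that is positive everywhere.
\<close>

lemma bump_of_class:
  fixes u U :: "'a \<Rightarrow> real"
  assumes B: "is_basis M \<B>" and a: "0 < a" "a < p" and b: "ereal p < b"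
    and u: "(\<lambda>x. u x powr p) \<in> A_class M \<B> (p / a) \<inter> RH_class M \<B> (holder_conj (b / ereal p))"
    and [measurable]: "U \<in> borel_measurable M" and pos: "\<And>x. 0 < U x" and ae: "AE x in M. u x = U x"
  obtains D :: real where "0 < D" "bump M \<B> (1 / a - 1 / p) (1 / p - inv_exponent b) U D"
proof -
  define w where "w x = u x powr p" for x
  define \<alpha> where "\<alpha> = 1 / a - 1 / p"
  define \<beta> where "\<beta> = 1 / p - inv_exponent b"
  define \<sigma> where "\<sigma> = 1 / (1 - p * inv_exponent b)"
  have p: "0 < p" using a by simp
  have \<beta>: "0 < \<beta>" "inv_exponent b \<noteq> 1 / p" "0 \<le> inv_exponent b"
    using inv_exponent_bounds[of p b] less_imp_le[OF b] b p by (auto simp: \<beta>_def)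
  have \<alpha>: "0 < \<alpha>" using a by (simp add: \<alpha>_def divide_strict_left_mono)
  have \<sigma>: "\<sigma> = 1 / (p * \<beta>)" "0 < \<sigma>" using p \<beta> by (auto simp: \<sigma>_def \<beta>_def field_simps)
  have pa: "p / a \<noteq> 1" "p / a - 1 = p * \<alpha>" "1 - (p / a) / (p / a - 1) = - 1 / (p * \<alpha>)"
    using a p by (auto simp: \<alpha>_def field_simps)
  have wm[measurable]: "w \<in> borel_measurable M" and A: "A_const M \<B> (p / a) w < \<infinity>"
    and R: "RH_const M \<B> (ereal \<sigma>) w < \<infinity>"
    using u holder_conj_exponent[of p b] less_imp_le[OF b] p \<beta> unfolding w_def[abs_def, symmetric]
    by (auto simp: A_class_def RH_class_def weight_def \<sigma>_def)
  define c where "c = 1 + enn2real (A_const M \<B> (p / a) w)"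
  define d where "d = 1 + enn2real (RH_const M \<B> (ereal \<sigma>) w)"
  have c: "1 \<le> c" "A_const M \<B> (p / a) w \<le> ennreal c"
    using A by (cases "A_const M \<B> (p / a) w"; auto simp: c_def ennreal_leI)+
  have d: "1 \<le> d" "RH_const M \<B> (ereal \<sigma>) w \<le> ennreal d"
    using R by (cases "RH_const M \<B> (ereal \<sigma>) w"; auto simp: d_def ennreal_leI)+
  define D where "D = (c * d) powr (1 / p)"
  have D: "0 < D" using c d by (simp add: D_def)
  have "bump M \<B> \<alpha> \<beta> U D" unfolding bump_def
  proof
    fix B assume "B \<in> \<B>"
    then have B': "B \<in> sets M" "0 < emeasure M B" "emeasure M B < \<infinity>" using B by (auto simp: is_basis_def)
    define X where "X = average M B (\<lambda>x. ennreal (w x))"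
    define Y where "Y = average M B (\<lambda>x. ennreal (w x powr (- 1 / (p * \<alpha>))))"
    define V where "V = average M B (\<lambda>x. ennreal (w x powr \<sigma>))"
    have eqs: "AE x in M. w x = U x powr p \<and> w x powr (- 1 / (p * \<alpha>)) = (1 / U x) powr (1 / \<alpha>) \<and> w x powr \<sigma> = U x powr (1 / \<beta>)"
      using ae
    proof eventually_elim
      case (elim x)
      then show ?case using pos[of x] p \<alpha> \<beta>
        by (simp add: w_def powr_powr \<sigma>(1) powr_minus_divide powr_divide)
    qed
    have X': "X = average M B (\<lambda>x. ennreal (U x powr p))" unfolding X_def
      by (rule average_cong_AE) (use eqs in auto)
    have Y': "Y = average M B (\<lambda>x. ennreal ((1 / U x) powr (1 / \<alpha>)))" unfolding Y_def
      by (rule average_cong_AE) (use eqs in auto)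
    have V': "V = average M B (\<lambda>x. ennreal (U x powr (1 / \<beta>)))" unfolding V_def
      by (rule average_cong_AE) (use eqs in auto)
    have X0: "0 < X" unfolding X' by (rule average_pos) (use B' pos less_imp_neq[OF pos] in auto)
    have Y0: "0 < Y" unfolding Y' by (rule average_pos) (use B' pos less_imp_neq[OF pos] in auto)
    have XY: "X * ennpowr Y (p * \<alpha>) \<le> ennreal c"
    proof -
      have "X * ennpowr Y (p * \<alpha>) \<le> A_const M \<B> (p / a) w"
        unfolding A_const_def X_def Y_def pa(3) unfolding pa(2) using pa(1)
        by (auto intro!: SUP_upper2[OF \<open>B \<in> \<B>\<close>])
      then show ?thesis using c(2) by (rule order_trans)
    qed
    have pal: "0 < p * \<alpha>" using p \<alpha> by simp
    have Yp: "0 < ennpowr Y (p * \<alpha>)" using Y0 by (cases Y) (auto simp: ennpowr_def)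
    (* All points of B carry positive weight, so neither factor vanishes, and a finite product
      forces both factors to be finite. *)
    have "X \<noteq> \<infinity>" using XY Yp less_imp_neq[OF Yp] by (auto simp: ennreal_top_mult top_unique)
    then obtain x where x: "X = ennreal x" "0 < x" using X0 by (cases X) auto
    have "Y \<noteq> \<infinity>" using XY x by (auto simp: ennpowr_def ennreal_mult_top top_unique)
    then obtain y where y: "Y = ennreal y" "0 < y" using Y0 by (cases Y) auto
    have "x * y powr (p * \<alpha>) \<le> c" using XY x y c by (simp add: ennpowr_ennreal ennreal_mult[symmetric])
    then have "y powr (p * \<alpha>) \<le> c / x" using x by (simp add: field_simps)
    then have "(y powr (p * \<alpha>)) powr (1 / (p * \<alpha>)) \<le> (c / x) powr (1 / (p * \<alpha>))"
      using pal by (intro powr_mono2) auto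
    then have yle: "y \<le> (c / x) powr (1 / (p * \<alpha>))" using p \<alpha> y by (simp add: powr_powr)
    have Vle: "V \<le> ennreal ((d * x) powr \<sigma>)"
    proof (cases "\<sigma> = 1")
      case True
      have "V = X" unfolding V_def X_def by (rule average_cong_AE) (use eqs True pos in \<open>auto\<close>)
      then show ?thesis using x d True by (auto intro!: ennreal_leI)
    next
      case False
      have "ennpowr V (1 / \<sigma>) / X \<le> RH_const M \<B> (ereal \<sigma>) w"
        unfolding V_def X_def RH_const_def using False
        by (auto simp: one_ereal_def intro!: SUP_upper2[OF \<open>B \<in> \<B>\<close>])
      also note d(2)
      finally have "ennpowr V (1 / \<sigma>) / X * X \<le> ennreal d * X" by (rule mult_right_mono) simp
      moreover have "ennpowr V (1 / \<sigma>) / X * X = ennpowr V (1 / \<sigma>)"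
        using x by (simp add: ennreal_divide_times ennreal_times_divide[symmetric])
      ultimately have "ennpowr V (1 / \<sigma>) \<le> ennreal (d * x)" using x d by (simp add: ennreal_mult)
      from ennpowr_mono[OF this, of \<sigma>] \<sigma>(2) x d show ?thesis by (simp add: ennpowr_ennpowr ennpowr_ennreal)
    qed
    define k where "k = (d * x) powr (1 / p)"
    have k: "0 < k" using x d by (simp add: k_def)
    have "mean_le M B \<beta> U k" using Vle \<beta> p by (simp add: mean_le_def V' k_def powr_powr \<sigma>(1))
    moreover have "mean_le M B \<alpha> (\<lambda>x. 1 / U x) (D / k)"
    proof -
      have "D / k = (c / x) powr (1 / p)" using x c d by (simp add: D_def k_def powr_divide[symmetric])
      then have "(D / k) powr (1 / \<alpha>) = (c / x) powr (1 / (p * \<alpha>))" by (simp add: powr_powr)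
      then show ?thesis using yle y Y' \<alpha> by (simp add: mean_le_def ennreal_leI)
    qed
    ultimately show "\<exists>k>0. mean_le M B \<beta> U k \<and> mean_le M B \<alpha> (\<lambda>x. 1 / U x) (D / k)" using k by blast
  qed
  with D show ?thesis using that by (simp add: \<alpha>_def \<beta>_def)
qed

text \<open>
  The converse, with constants. Here the endpoints p = a and p = b are included, because the
  exponent of the hypothesis may be one of them. For p = a the target is A_1, where the supremum
  over the basis stands inside the almost everywhere quantifier. The two-sided condition controls
  each set of the basis up to its own null set, and these cannot be united when the basis is
  uncountable; hence the additional pointwise assumption. For p = b it is the essential supremum
  that has to be bounded, with \<beta> = 0.
\<close>

lemma class_of_bump:
  fixes W :: "'a \<Rightarrow> real"
  assumes B: "is_basis M \<B>" and a: "0 < a" "a \<le> p" and b: "ereal p \<le> b" and ab: "ereal a < b"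
    and [measurable]: "W \<in> borel_measurable M" and pos: "\<And>x. 0 < W x" and D: "0 < D" and c: "0 \<le> c"
    and W: "bump M \<B> (1 / a - 1 / p) (1 / p - inv_exponent b) W D"
    and max: "p = a \<Longrightarrow> A1_bound M \<B> c (\<lambda>x. W x powr (1 / (1 / p - inv_exponent b)))"
  defines "K \<equiv> 1 + D powr p + c powr (p * (1 / p - inv_exponent b))"
  shows "(\<lambda>x. W x powr p) \<in> A_class M \<B> (p / a) \<inter> RH_class M \<B> (holder_conj (b / ereal p))"
    and "A_const M \<B> (p / a) (\<lambda>x. W x powr p) \<le> ennreal K"
    and "RH_const M \<B> (holder_conj (b / ereal p)) (\<lambda>x. W x powr p) \<le> ennreal K"
proof -
  define \<alpha> where "\<alpha> = 1 / a - 1 / p"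
  define \<beta> where "\<beta> = 1 / p - inv_exponent b"
  define w where "w x = W x powr p" for x
  have wm[measurable]: "w \<in> borel_measurable M" unfolding w_def by measurable
  have p: "0 < p" using a by simp
  have \<beta>: "0 \<le> \<beta>" "0 \<le> inv_exponent b" using inv_exponent_bounds[of p b] b p by (auto simp: \<beta>_def)
  have \<beta>p: "\<beta> \<le> 1 / p" using \<beta> by (simp add: \<beta>_def)
  have \<alpha>: "0 \<le> \<alpha>" "\<alpha> = 0 \<longleftrightarrow> p = a" using a p by (auto simp: \<alpha>_def frac_le)
  have up: "average M B (\<lambda>x. ennreal (w x)) \<le> ennreal (k powr p)"
    if "B \<in> \<B>" "0 < k" "mean_le M B \<beta> W k" for B k
  proof -
    have B': "B \<in> sets M" "0 < emeasure M B" "emeasure M B < \<infinity>" using B \<open>B \<in> \<B>\<close> by (auto simp: is_basis_def)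
    have "mean_le M B (1 / p) W k" by (rule mean_le_mono_exponent[where \<beta>=\<beta>]) (use B' pos that \<beta> \<beta>p in auto)
    then show ?thesis using p by (simp add: mean_le_def w_def)
  qed
  have A: "A_const M \<B> (p / a) w \<le> ennreal K"
  proof (cases "p = a")
    case True
    then have \<beta>0: "\<beta> > 0" using inv_exponent_bounds(3)[of p b] ab p by (auto simp: \<beta>_def less_imp_le)
    have "AE x in M. maximal M \<B> (\<lambda>y. ennreal (w y)) x \<le> ennreal (c powr (p * \<beta>)) * ennreal (w x)"
      using max[OF True] unfolding A1_bound_def
    proof eventually_elim
      case (elim x)
      have elim': "maximal M \<B> (\<lambda>y. ennreal (W y powr (1 / \<beta>))) x \<le> ennreal (c * W x powr (1 / \<beta>))"
        using elim by (simp add: \<beta>_def)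
      show ?case
      proof (rule maximal_le)
        fix B assume B1: "B \<in> \<B>" "x \<in> B"
        have B': "B \<in> sets M" "0 < emeasure M B" "emeasure M B < \<infinity>" using B \<open>B \<in> \<B>\<close> by (auto simp: is_basis_def)
        have le: "average M B (\<lambda>y. ennreal (W y powr (1 / \<beta>))) \<le> ennreal (c * W x powr (1 / \<beta>))"
          using average_le_maximal[OF B1] elim' by (rule order_trans)
        have "0 < average M B (\<lambda>y. ennreal (W y powr (1 / \<beta>)))"
          by (rule average_pos) (use B' pos less_imp_neq[OF pos] in auto)
        then have "c \<noteq> 0" using le by auto
        then have c0: "0 < c" using c by simp
        (* The bound for W^(1/\<beta>) is converted to one for W^p by Jensen's inequality on B; the
          null set does not depend on B. *)
        define k where "k = c powr \<beta> * W x"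
        have "k powr (1 / \<beta>) = c * W x powr (1 / \<beta>)" using c0 pos[of x] \<beta>0 by (simp add: k_def powr_mult powr_powr)
        then have "mean_le M B \<beta> W k" using le \<beta>0 by (simp add: mean_le_def)
        from up[OF B1(1) _ this] have "average M B (\<lambda>x. ennreal (w x)) \<le> ennreal (k powr p)"
          using c0 pos[of x] by (simp add: k_def)
        also have "k powr p = c powr (p * \<beta>) * w x"
          using c0 pos[of x] by (simp add: k_def w_def powr_mult powr_powr mult.commute)
        finally show "average M B (\<lambda>x. ennreal (w x)) \<le> ennreal (c powr (p * \<beta>)) * ennreal (w x)"
          using pos[of x] by (simp add: ennreal_mult w_def)
      qed
    qed
    then have "AE x in M. maximal M \<B> (\<lambda>y. ennreal (w y)) x * inverse (ennreal (w x)) \<le> ennreal (c powr (p * \<beta>))"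
    proof eventually_elim
      case (elim x)
      have "w x > 0" using pos[of x] by (simp add: w_def)
      have "maximal M \<B> (\<lambda>y. ennreal (w y)) x * inverse (ennreal (w x))
          \<le> ennreal (c powr (p * \<beta>)) * ennreal (w x) * inverse (ennreal (w x))"
        using elim by (rule mult_right_mono) simp
      also have "\<dots> = ennreal (c powr (p * \<beta>))"
        using \<open>w x > 0\<close> by (simp add: inverse_ennreal ennreal_mult[symmetric] mult.assoc)
      finally show ?case .
    qed
    then have "A_const M \<B> (p / a) w \<le> ennreal (c powr (p * \<beta>))"
      using True p unfolding A_const_def Linf_norm_def by (auto intro: Inf_lower)
    also have "\<dots> \<le> ennreal K" by (intro ennreal_leI) (simp add: K_def \<beta>_def)
    finally show ?thesis .
  next
    case False
    then have \<alpha>0: "0 < \<alpha>" and pa: "p / a \<noteq> 1" "p / a - 1 = p * \<alpha>" "1 - (p / a) / (p / a - 1) = - 1 / (p * \<alpha>)"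
      using a p \<alpha> by (auto simp: \<alpha>_def field_simps)
    have "average M B (\<lambda>x. ennreal (w x)) *
        ennpowr (average M B (\<lambda>x. ennreal (w x powr (1 - (p / a) / (p / a - 1))))) (p / a - 1) \<le> ennreal (D powr p)"
      if "B \<in> \<B>" for B
    proof -
      obtain k where k: "k > 0" "mean_le M B \<beta> W k" "mean_le M B \<alpha> (\<lambda>x. 1 / W x) (D / k)"
        using W \<open>B \<in> \<B>\<close> by (auto simp: bump_def \<alpha>_def \<beta>_def)
      have *: "w x powr (1 - (p / a) / (p / a - 1)) = (1 / W x) powr (1 / \<alpha>)" for x
        unfolding pa(3) using pos[of x] \<alpha>0 p by (simp add: w_def powr_powr powr_minus_divide powr_divide)
      have "average M B (\<lambda>x. ennreal (w x)) *
          ennpowr (average M B (\<lambda>x. ennreal (w x powr (1 - (p / a) / (p / a - 1))))) (p / a - 1)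
         \<le> ennreal (k powr p) * ennpowr (ennreal ((D / k) powr (1 / \<alpha>))) (p * \<alpha>)"
        unfolding * unfolding pa(2) using k \<alpha>0 p \<open>B \<in> \<B>\<close>
        by (intro mult_mono ennpowr_mono up) (auto simp: mean_le_def)
      also have "\<dots> = ennreal (k powr p * (D / k) powr p)"
        using \<alpha>0 by (simp add: ennpowr_ennreal powr_powr ennreal_mult)
      also have "k powr p * (D / k) powr p = D powr p"
        using k D by (simp add: powr_divide)
      finally show ?thesis .
    qed
    then have "A_const M \<B> (p / a) w \<le> ennreal (D powr p)"
      using pa(1) by (auto simp: A_const_def intro!: SUP_least)
    also have "\<dots> \<le> ennreal K" by (intro ennreal_leI) (simp add: K_def)
    finally show ?thesis .
  qed
  have R: "RH_const M \<B> (holder_conj (b / ereal p)) w \<le> ennreal K"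
  proof -
    (* In the reverse Hoelder quotient the denominator is an average of W^p, bounded below
      through the average of the powers of 1 / W. *)
    have quot: "X / average M B (\<lambda>x. ennreal (w x)) \<le> ennreal (D powr p)"
      if "X \<le> ennreal (k powr p)" "B \<in> \<B>" "0 < k" "mean_le M B \<alpha> (\<lambda>x. 1 / W x) (D / k)" for X B k
    proof -
      have B': "B \<in> sets M" "0 < emeasure M B" "emeasure M B < \<infinity>" using B \<open>B \<in> \<B>\<close> by (auto simp: is_basis_def)
      have "ennreal ((1 / (D / k)) powr p) \<le> average M B (\<lambda>x. ennreal (w x))"
        unfolding w_def by (rule mean_le_reciprocal_lower[where \<alpha>=\<alpha>]) (use B' pos that D \<alpha> p in auto)
      from ennreal_divide_le[OF that(1) this] that D
      show ?thesis by (simp add: powr_divide)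
    qed
    have DK: "ennreal (D powr p) \<le> ennreal K" "1 \<le> ennreal K" by (auto simp: K_def intro!: ennreal_leI)
    show ?thesis
    proof (cases "\<beta> = 0")
      case True
      then have s: "holder_conj (b / ereal p) = \<infinity>" using holder_conj_exponent[of p b] p b by (simp add: \<beta>_def)
      have "Linf_norm M (\<lambda>x. ennreal (w x) * indicator B x) / average M B (\<lambda>x. ennreal (w x)) \<le> ennreal (D powr p)"
        if "B \<in> \<B>" for B
      proof -
        obtain k where k: "k > 0" "mean_le M B \<beta> W k" "mean_le M B \<alpha> (\<lambda>x. 1 / W x) (D / k)"
          using W \<open>B \<in> \<B>\<close> by (auto simp: bump_def \<alpha>_def \<beta>_def)
        have "AE x in M. x \<in> B \<longrightarrow> W x \<le> k" using k True by (simp add: mean_le_def)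
        then have "AE x in M. ennreal (w x) * indicator B x \<le> ennreal (k powr p)"
        proof eventually_elim
          case (elim x)
          then show ?case using pos[of x] p by (auto simp: w_def split: split_indicator intro!: ennreal_leI powr_mono2)
        qed
        then have "Linf_norm M (\<lambda>x. ennreal (w x) * indicator B x) \<le> ennreal (k powr p)"
          unfolding Linf_norm_def by (intro Inf_lower) auto
        from quot[OF this \<open>B \<in> \<B>\<close> k(1,3)] show ?thesis .
      qed
      then have "RH_const M \<B> (holder_conj (b / ereal p)) w \<le> ennreal (D powr p)"
        unfolding s RH_const_def by (auto simp: one_ereal_def intro!: SUP_least)
      then show ?thesis using DK by (auto intro: order_trans)
    next
      case False
      then have \<beta>0: "0 < \<beta>" using \<beta> by simp
      define \<sigma> where "\<sigma> = 1 / (p * \<beta>)"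
      have \<sigma>: "0 < \<sigma>" "1 / (1 - p * inv_exponent b) = \<sigma>" using p \<beta>0 by (auto simp: \<sigma>_def \<beta>_def field_simps)
      have s: "holder_conj (b / ereal p) = ereal \<sigma>" using holder_conj_exponent[of p b] p b False
        by (simp add: \<beta>_def \<sigma>(2))
      have "ennpowr (average M B (\<lambda>x. ennreal (w x powr \<sigma>))) (1 / \<sigma>) / average M B (\<lambda>x. ennreal (w x)) \<le> ennreal (D powr p)"
        if "B \<in> \<B>" for B
      proof -
        obtain k where k: "k > 0" "mean_le M B \<beta> W k" "mean_le M B \<alpha> (\<lambda>x. 1 / W x) (D / k)"
          using W \<open>B \<in> \<B>\<close> by (auto simp: bump_def \<alpha>_def \<beta>_def)
        have *: "w x powr \<sigma> = W x powr (1 / \<beta>)" for x using p \<beta>0 by (simp add: w_def \<sigma>_def powr_powr)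
        have "ennpowr (average M B (\<lambda>x. ennreal (w x powr \<sigma>))) (1 / \<sigma>) \<le> ennpowr (ennreal (k powr (1 / \<beta>))) (1 / \<sigma>)"
          unfolding * using k \<beta>0 \<sigma> by (intro ennpowr_mono) (auto simp: mean_le_def)
        also have "\<dots> = ennreal (k powr p)" using \<beta>0 by (simp add: ennpowr_ennreal \<sigma>_def powr_powr)
        finally show ?thesis by (rule quot[OF _ \<open>B \<in> \<B>\<close> k(1,3)])
      qed
      then have "RH_const M \<B> (holder_conj (b / ereal p)) w \<le> max 1 (ennreal (D powr p))"
        unfolding s RH_const_def by (auto intro!: SUP_least simp: max.coboundedI2)
      then show ?thesis using DK by (auto intro: order_trans)
    qed
  qed
  have "weight M w" using pos less_imp_neq[OF pos] by (auto simp: weight_def w_def less_imp_neq[symmetric])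
  then show "(\<lambda>x. W x powr p) \<in> A_class M \<B> (p / a) \<inter> RH_class M \<B> (holder_conj (b / ereal p))"
    using A R unfolding w_def[abs_def] A_class_def RH_class_def by (auto intro: order_le_less_trans)
  show "A_const M \<B> (p / a) (\<lambda>x. W x powr p) \<le> ennreal K" using A unfolding w_def[abs_def] .
  show "RH_const M \<B> (holder_conj (b / ereal p)) (\<lambda>x. W x powr p) \<le> ennreal K" using R unfolding w_def[abs_def] .
qed

section \<open>Multipliers built from a fixed weight\<close>

text \<open>
  The A_1 condition bounds H from below on B by a multiple of its average r, so H^(-\<delta>) is
  bounded above there by a multiple of r^(-\<delta>), while the norm of H^\<delta> in L^(1/\<delta>)
  is r^\<delta>.
\<close>

lemma bump_of_A1:
  fixes H :: "'a \<Rightarrow> real"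
  assumes B: "is_basis M \<B>" and [measurable]: "H \<in> borel_measurable M" and pos: "\<And>x. 0 < H x"
    and c: "0 < c" and \<delta>: "0 < \<delta>"
    and A1: "A1_bound M \<B> c H"
  shows "bump M \<B> \<delta> 0 (\<lambda>x. H x powr (- \<delta>)) (c powr \<delta>)"
  unfolding bump_def
proof
  fix B assume "B \<in> \<B>"
  then have B': "B \<in> sets M" "0 < emeasure M B" "emeasure M B < \<infinity>" using B by (auto simp: is_basis_def)
  have le: "AE x in M. x \<in> B \<longrightarrow> average M B (\<lambda>y. ennreal (H y)) \<le> ennreal (c * H x)"
    using A1 unfolding A1_bound_def by eventually_elim (use average_le_maximal[OF \<open>B \<in> \<B>\<close>] in \<open>blast intro: order_trans\<close>)
  obtain r where r: "average M B (\<lambda>y. ennreal (H y)) = ennreal r" "0 < r"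
  proof -
    have "0 < average M B (\<lambda>y. ennreal (H y))" by (rule average_pos) (use B' pos in auto)
    moreover have "average M B (\<lambda>y. ennreal (H y)) \<noteq> \<infinity>"
    proof
      assume "average M B (\<lambda>y. ennreal (H y)) = \<infinity>"
      with le have "AE x in M. x \<notin> B" by (auto simp: top_unique)
      then have "emeasure M B = 0"
        by (subst (asm) AE_iff_measurable[OF B'(1)]) (use B' in \<open>auto dest: sets.sets_into_space\<close>)
      then show False using B' by simp
    qed
    ultimately show ?thesis using that by (cases "average M B (\<lambda>y. ennreal (H y))") auto
  qed
  define k where "k = (r / c) powr (- \<delta>)"
  have k: "0 < k" using r c by (simp add: k_def)
  have "AE x in M. x \<in> B \<longrightarrow> H x powr (- \<delta>) \<le> k"
    using le
  proof eventually_elim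
    case (elim x)
    show ?case
    proof
      assume "x \<in> B"
      then have "r \<le> c * H x" using elim r pos[of x] c by simp
      then have "r / c \<le> H x" using c by (simp add: field_simps)
      then show "H x powr (- \<delta>) \<le> k" unfolding k_def using r c \<delta> by (intro powr_mono2') auto
    qed
  qed
  then have "mean_le M B 0 (\<lambda>x. H x powr (- \<delta>)) k" by (simp add: mean_le_def)
  moreover have "mean_le M B \<delta> (\<lambda>x. 1 / H x powr (- \<delta>)) (c powr \<delta> / k)"
  proof -
    have "(1 / H x powr (- \<delta>)) powr (1 / \<delta>) = H x" for x
      using pos[of x] \<delta> by (simp add: powr_minus_divide powr_powr)
    moreover have "(c powr \<delta> / k) powr (1 / \<delta>) = r"
      using r c \<delta> by (simp add: k_def powr_minus_divide powr_powr powr_mult[symmetric])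
    ultimately show ?thesis using \<delta> r by (simp add: mean_le_def)
  qed
  ultimately show "\<exists>k>0. mean_le M B 0 (\<lambda>x. H x powr (- \<delta>)) k \<and> mean_le M B \<delta> (\<lambda>x. 1 / H x powr (- \<delta>)) (c powr \<delta> / k)"
    using k by blast
qed

text \<open>
  The geometric mean of the conditions (\<alpha>, \<beta>) for U and (\<alpha> + \<beta>, 0) for
  H^(-(\<alpha>+\<beta>)). Every pair of exponents with sum \<alpha> + \<beta> and second component
  smaller than \<beta> arises in this way; this is how the condition is moved from p to p0.
\<close>

lemma bump_times_A1:
  fixes U H :: "'a \<Rightarrow> real"
  assumes B: "is_basis M \<B>" and [measurable]: "U \<in> borel_measurable M" "H \<in> borel_measurable M"
    and pos: "\<And>x. 0 < U x" "\<And>x. 0 < H x" and c: "0 < c" "0 < D" and \<alpha>: "0 < \<alpha>" "0 < \<beta>" and s: "0 \<le> s" "s < 1"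
    and U: "bump M \<B> \<alpha> \<beta> U D"
    and A1: "A1_bound M \<B> c H"
  shows "bump M \<B> (\<alpha> + \<beta> - s * \<beta>) (s * \<beta>) (\<lambda>x. U x powr s * H x powr (- (\<alpha> + \<beta>) * (1 - s)))
    (D powr s * (c powr (\<alpha> + \<beta>)) powr (1 - s))"
proof -
  have H: "bump M \<B> (\<alpha> + \<beta>) 0 (\<lambda>x. H x powr (- (\<alpha> + \<beta>))) (c powr (\<alpha> + \<beta>))"
    by (rule bump_of_A1) (use B pos c \<alpha> A1 in auto)
  show ?thesis
  proof (cases "s = 0")
    case True
    then show ?thesis using H c less_imp_neq[OF pos(1)] less_imp_neq[OF c(2)] by (simp add: less_imp_neq[symmetric])
  next
    case False
    have "bump M \<B> (s * \<alpha> + (1 - s) * (\<alpha> + \<beta>)) (s * \<beta> + (1 - s) * 0)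
       (\<lambda>x. U x powr s * (H x powr (- (\<alpha> + \<beta>))) powr (1 - s)) (D powr s * (c powr (\<alpha> + \<beta>)) powr (1 - s))"
      by (rule bump_geometric[OF B]) (use pos less_imp_neq[OF pos(2)] c \<alpha> s False U H in \<open>auto simp: less_imp_neq[symmetric]\<close>)
    moreover have "s * \<alpha> + (1 - s) * (\<alpha> + \<beta>) = \<alpha> + \<beta> - s * \<beta>" by (simp add: algebra_simps)
    ultimately show ?thesis by (simp add: powr_powr)
  qed
qed

text \<open>
  The Rubio de Francia majorant H of \<gamma>^(r \<beta> / (\<alpha>+\<beta>))
  U^(-1/(\<alpha>+\<beta>)) is taken in L^q(v) with v = U^(1/\<beta>) and q = (\<alpha> + \<beta>) /
  \<beta>. The powers are chosen such that H = G^(r \<beta> / (\<alpha>+\<beta>))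
  U^(-1/(\<alpha>+\<beta>)) defines a function G with H^q v = G^r, and such that the weight in
  \<open>bump_times_A1\<close> is U times a power of G. Thus the function G majorises \<gamma> and
  stays in unweighted L^r, and multiplying U by a power of it moves the exponents.
\<close>

lemma weighted_majorant:
  fixes U :: "'a \<Rightarrow> real"
  assumes sf: "sigma_finite_measure M" and mb: "muckenhoupt_basis M \<B>"
    and [measurable]: "U \<in> borel_measurable M" and pos: "\<And>x. 0 < U x"
    and \<alpha>: "0 < \<alpha>" "0 < \<beta>" and D: "0 < D" and U: "bump M \<B> \<alpha> \<beta> U D" and r: "0 < r" and s: "0 \<le> s" "s < 1"
  obtains c E :: real where "1 \<le> c" "0 < E"
    "\<And>\<gamma> \<Gamma>. \<gamma> \<in> borel_measurable M \<Longrightarrow> (\<And>x. 0 \<le> \<gamma> x) \<Longrightarrow> 0 < \<Gamma> \<Longrightarrow>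
       (\<integral>\<^sup>+x. ennreal (\<gamma> x powr r) \<partial>M) \<le> ennreal \<Gamma> \<Longrightarrow>
       \<exists>G\<in>borel_measurable M. (\<forall>x. 0 < G x) \<and> (\<forall>x. \<gamma> x \<le> G x) \<and>
         (\<integral>\<^sup>+x. ennreal (G x powr r) \<partial>M) \<le> ennreal (c * \<Gamma>) \<and>
         bump M \<B> (\<alpha> + \<beta> - s * \<beta>) (s * \<beta>) (\<lambda>x. U x * G x powr (- (r * \<beta> * (1 - s)))) E \<and>
         A1_bound M \<B> c (\<lambda>x. G x powr (r * \<beta> / (\<alpha> + \<beta>)) * U x powr (- 1 / (\<alpha> + \<beta>)))"
proof -
  have B: "is_basis M \<B>" using mb by (simp add: muckenhoupt_basis_def)
  define \<delta> where "\<delta> = \<alpha> + \<beta>"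
  define q where "q = \<delta> / \<beta>"
  define v where "v x = U x powr (1 / \<beta>)" for x
  have \<delta>: "0 < \<delta>" "\<beta> < \<delta>" using \<alpha> by (auto simp: \<delta>_def)
  have q: "1 < q" using \<alpha> by (simp add: q_def \<delta>_def)
  have v: "v \<in> A_class M \<B> q" unfolding v_def q_def \<delta>_def by (rule A_class_of_bump) (use pos \<alpha> D U in auto)
  have vpos: "0 < v x" for x using pos[of x] by (simp add: v_def)
  obtain c where c: "1 \<le> c" and rdf: "\<And>h \<Gamma>. h \<in> borel_measurable M \<Longrightarrow> (\<And>x. 0 \<le> h x) \<Longrightarrow> 0 < \<Gamma> \<Longrightarrow>
       (\<integral>\<^sup>+x. ennreal (h x powr q * v x) \<partial>M) \<le> ennreal \<Gamma> \<Longrightarrow>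
       \<exists>H\<in>borel_measurable M. (\<forall>x. 0 < H x) \<and> (\<forall>x. h x \<le> H x) \<and>
         A1_bound M \<B> c H \<and>
         (\<integral>\<^sup>+x. ennreal (H x powr q * v x) \<partial>M) \<le> ennreal (c * \<Gamma>)"
    using rubio_de_francia[OF sf mb q v vpos] by blast
  define E where "E = D powr s * (c powr \<delta>) powr (1 - s)"
  have E: "0 < E" using D c by (simp add: E_def)
  show ?thesis
  proof (rule that[OF c E])
    fix \<gamma> :: "'a \<Rightarrow> real" and \<Gamma> :: real
    assume [measurable]: "\<gamma> \<in> borel_measurable M" and \<gamma>: "\<And>x. 0 \<le> \<gamma> x" and \<Gamma>: "0 < \<Gamma>"
      and I: "(\<integral>\<^sup>+x. ennreal (\<gamma> x powr r) \<partial>M) \<le> ennreal \<Gamma>"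
    define h where "h x = \<gamma> x powr (r * \<beta> / \<delta>) * U x powr (- 1 / \<delta>)" for x
    have [measurable]: "h \<in> borel_measurable M" unfolding h_def by measurable
    have hq: "(g powr (r * \<beta> / \<delta>) * U x powr (- 1 / \<delta>)) powr q * v x = g powr r" if "0 \<le> g" for g x
    proof -
      have "(g powr (r * \<beta> / \<delta>) * U x powr (- 1 / \<delta>)) powr q = g powr r * U x powr (- 1 / \<beta>)"
        using that pos[of x] \<alpha> \<delta> by (simp add: powr_mult powr_powr q_def)
      then show ?thesis using pos[of x] by (simp add: v_def powr_add[symmetric])
    qed
    have "h x powr q * v x = \<gamma> x powr r" for x unfolding h_def by (rule hq) (rule \<gamma>)
    then have "(\<integral>\<^sup>+x. ennreal (h x powr q * v x) \<partial>M) \<le> ennreal \<Gamma>" using I by simp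
    from rdf[OF _ _ \<Gamma> this] obtain H where [measurable]: "H \<in> borel_measurable M" and H: "\<And>x. 0 < H x" "\<And>x. h x \<le> H x"
      and A1: "A1_bound M \<B> c H"
      and HI: "(\<integral>\<^sup>+x. ennreal (H x powr q * v x) \<partial>M) \<le> ennreal (c * \<Gamma>)"
      by (auto simp: h_def)
    define G where "G x = (H x * U x powr (1 / \<delta>)) powr (\<delta> / (r * \<beta>))" for x
    have [measurable]: "G \<in> borel_measurable M" unfolding G_def by measurable
    have Gpos: "0 < G x" for x using H(1)[of x] pos[of x] by (simp add: G_def)
    have HG: "G x powr (r * \<beta> / \<delta>) * U x powr (- 1 / \<delta>) = H x" for x
    proof -
      have "G x powr (r * \<beta> / \<delta>) = H x * U x powr (1 / \<delta>)"
        using H(1)[of x] pos[of x] \<alpha> \<delta> r by (simp add: G_def powr_powr)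
      then show ?thesis using pos[of x] by (simp add: mult.assoc powr_add[symmetric])
    qed
    have \<gamma>G: "\<gamma> x \<le> G x" for x
    proof -
      have "\<gamma> x powr (r * \<beta> / \<delta>) * U x powr (- 1 / \<delta>) \<le> G x powr (r * \<beta> / \<delta>) * U x powr (- 1 / \<delta>)"
        using H(2)[of x] unfolding HG h_def .
      then have "\<gamma> x powr (r * \<beta> / \<delta>) \<le> G x powr (r * \<beta> / \<delta>)" using pos[of x] by simp
      then show ?thesis using powr_less_mono2[of "r * \<beta> / \<delta>" "G x" "\<gamma> x"] Gpos[of x] r \<alpha> \<delta> by (force simp: not_less[symmetric])
    qed
    have GI: "(\<integral>\<^sup>+x. ennreal (G x powr r) \<partial>M) \<le> ennreal (c * \<Gamma>)"
    proof -
      have "H x powr q * v x = G x powr r" for x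
        using hq[of "G x" x] Gpos[of x] unfolding HG by simp
      then show ?thesis using HI by simp
    qed
    have "U x powr s * H x powr (- (\<alpha> + \<beta>) * (1 - s)) = U x * G x powr (- (r * \<beta> * (1 - s)))" for x
    proof -
      have "H x powr (- \<delta> * (1 - s)) = G x powr (- (r * \<beta> * (1 - s))) * U x powr (1 - s)"
        unfolding HG[symmetric] using Gpos[of x] pos[of x] \<delta> by (simp add: powr_mult powr_powr mult.assoc)
      then have "U x powr s * H x powr (- \<delta> * (1 - s)) = G x powr (- (r * \<beta> * (1 - s))) * (U x powr s * U x powr (1 - s))"
        by simp
      also have "U x powr s * U x powr (1 - s) = U x" using pos[of x] by (simp add: powr_add[symmetric])
      finally show ?thesis by (simp add: \<delta>_def mult.commute)
    qed
    moreover have "bump M \<B> (\<alpha> + \<beta> - s * \<beta>) (s * \<beta>) (\<lambda>x. U x powr s * H x powr (- (\<alpha> + \<beta>) * (1 - s))) E"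
      unfolding E_def \<delta>_def by (rule bump_times_A1) (use B pos H c D \<alpha> s U A1 in auto)
    ultimately have bump: "bump M \<B> (\<alpha> + \<beta> - s * \<beta>) (s * \<beta>) (\<lambda>x. U x * G x powr (- (r * \<beta> * (1 - s)))) E" by simp
    have A1': "A1_bound M \<B> c (\<lambda>x. G x powr (r * \<beta> / (\<alpha> + \<beta>)) * U x powr (- 1 / (\<alpha> + \<beta>)))"
      using A1 by (simp only: HG[unfolded \<delta>_def])
    show "\<exists>G\<in>borel_measurable M. (\<forall>x. 0 < G x) \<and> (\<forall>x. \<gamma> x \<le> G x) \<and>
         (\<integral>\<^sup>+x. ennreal (G x powr r) \<partial>M) \<le> ennreal (c * \<Gamma>) \<and>
         bump M \<B> (\<alpha> + \<beta> - s * \<beta>) (s * \<beta>) (\<lambda>x. U x * G x powr (- (r * \<beta> * (1 - s)))) E \<and>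
         A1_bound M \<B> c (\<lambda>x. G x powr (r * \<beta> / (\<alpha> + \<beta>)) * U x powr (- 1 / (\<alpha> + \<beta>)))"
      using Gpos \<gamma>G GI bump A1' by (intro bexI[of _ G]) auto
  qed
qed

text \<open>
  Young's inequality in the form needed for absorption: the coefficient of the power of a can be
  made small.
\<close>

lemma young_epsilon:
  fixes a b e t :: real
  assumes "0 < a" "0 \<le> b" "0 < e" "0 < t"
  shows "b * a \<le> e * a powr (1 + t) + e powr (- (1 / t)) * b powr (1 + 1 / t)"
proof (cases "b \<le> e * a powr t")
  case True
  then have "b * a \<le> e * a powr t * a" using assms by (intro mult_right_mono) auto
  also have "\<dots> = e * a powr (1 + t)" using assms by (simp add: powr_add)
  also have "\<dots> \<le> \<dots> + e powr (- (1 / t)) * b powr (1 + 1 / t)" using assms by simp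
  finally show ?thesis .
next
  case False
  then have b: "0 < b" "a powr t < b / e" using assms by (auto simp: field_simps intro: le_less_trans[OF _ False[unfolded not_le]])
  have "(a powr t) powr (1 / t) \<le> (b / e) powr (1 / t)" using b assms by (intro powr_mono2) auto
  then have "a \<le> (b / e) powr (1 / t)" using assms by (simp add: powr_powr)
  also have "\<dots> = e powr (- (1 / t)) * b powr (1 / t)" using b assms by (simp add: powr_divide powr_minus_divide)
  finally have "b * a \<le> b * (e powr (- (1 / t)) * b powr (1 / t))" using b by simp
  also have "\<dots> = e powr (- (1 / t)) * b powr (1 + 1 / t)" using b by (simp add: powr_add)
  also have "\<dots> \<le> e * a powr (1 + t) + \<dots>" using assms by simp
  finally show ?thesis .
qed

text \<open>
  The properties of m for one of the two powers p. The weight u^p0 m is admissible for p0 by the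
  last two lines, where ib stands for 1/b. Multiplication by m turns the p0-th power of an arbitrary
  value y into at least its p-th power, as long as the latter does not exceed y^p0 h, and it turns
  the p0-th power of \<gamma> into at most a multiple of its p-th power. Both hold up to integrable
  errors e1 and e2, and the second error comes with an arbitrarily small factor since its integral
  is bounded only in terms of Z, a bound that involves the quantity to be estimated.
\<close>

definition multiplier ::
  "'a measure \<Rightarrow> 'a set set \<Rightarrow> ('a \<Rightarrow> real) \<Rightarrow> real \<Rightarrow> real \<Rightarrow> real \<Rightarrow> real \<Rightarrow> real \<Rightarrow> real \<Rightarrow>
    ('a \<Rightarrow> real) \<Rightarrow> ('a \<Rightarrow> real) \<Rightarrow> real \<Rightarrow> real \<Rightarrow> ('a \<Rightarrow> real) \<Rightarrow> ('a \<Rightarrow> real) \<Rightarrow> ('a \<Rightarrow> real) \<Rightarrow> bool" where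
  "multiplier M \<B> u a ib p0 p c E \<gamma> h \<Gamma> Z m e1 e2 \<longleftrightarrow>
     (\<forall>x. 0 < m x \<and> 0 \<le> e1 x \<and> 0 \<le> e2 x) \<and>
     (\<integral>\<^sup>+x. ennreal (e1 x) \<partial>M) \<le> ennreal (c * \<Gamma>) \<and> (\<integral>\<^sup>+x. ennreal (e2 x) \<partial>M) \<le> ennreal (c * Z) \<and>
     (\<forall>x y. 0 \<le> y \<longrightarrow> min (y powr p) (y powr p0 * h x) \<le> y powr p0 * m x + e1 x) \<and>
     (\<forall>x e. 0 < e \<longrightarrow> \<gamma> x powr p0 * m x \<le> (1 + e powr (- ((p - p0) / p0))) * \<gamma> x powr p + e * e2 x) \<and>
     bump M \<B> (1 / a - 1 / p0) (1 / p0 - ib) (\<lambda>x. u x * m x powr (1 / p0)) E \<and>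
     (p0 = a \<longrightarrow> A1_bound M \<B> c (\<lambda>x. (u x * m x powr (1 / p0)) powr (1 / (1 / p0 - ib))))"

text \<open>
  If p < p0, take m = G^(p-p0) for a majorant G of \<gamma> in L^p: m is decreasing in G, so
  \<gamma>^p0 m \<le> \<gamma>^p, and y^p \<le> y^p0 m wherever y > G, while elsewhere y^p \<le> G^p
  is an error of controlled integral. If p > p0, such a power would increase with G and the weight
  need not be admissible; instead m = K is a majorant of h in L^(p/(p-p0)), constructed with 1 / u
  in place of u, and Young's inequality separates K from \<gamma>^p0. In both cases the majorant
  moves the exponents of the two-sided condition from p to p0.
\<close>

lemma one_sided_multiplier:
  fixes u :: "'a \<Rightarrow> real" and p p0 a ib :: real
  assumes sf: "sigma_finite_measure M" and mb: "muckenhoupt_basis M \<B>"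
    and [measurable]: "u \<in> borel_measurable M" and pos: "\<And>x. 0 < u x"
    and D: "0 < D" and u: "bump M \<B> (1 / a - 1 / p) (1 / p - ib) u D"
    and ex: "0 < a" "0 < p" "0 < p0" "0 < 1 / a - 1 / p" "0 < 1 / p - ib" "0 \<le> 1 / a - 1 / p0" "0 \<le> 1 / p0 - ib" "p \<noteq> p0"
  obtains c E :: real where "1 \<le> c" "0 < E"
    "\<And>\<gamma> h \<Gamma> Z. \<gamma> \<in> borel_measurable M \<Longrightarrow> (\<And>x. 0 \<le> \<gamma> x) \<Longrightarrow> h \<in> borel_measurable M \<Longrightarrow> (\<And>x. 0 \<le> h x) \<Longrightarrow>
       0 < \<Gamma> \<Longrightarrow> 0 < Z \<Longrightarrow> (\<integral>\<^sup>+x. ennreal (\<gamma> x powr p) \<partial>M) \<le> ennreal \<Gamma> \<Longrightarrow>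
       (p0 < p \<Longrightarrow> (\<integral>\<^sup>+x. ennreal (h x powr (p / (p - p0))) \<partial>M) \<le> ennreal Z) \<Longrightarrow>
       \<exists>m\<in>borel_measurable M. \<exists>e1\<in>borel_measurable M. \<exists>e2\<in>borel_measurable M.
         multiplier M \<B> u a ib p0 p c E \<gamma> h \<Gamma> Z m e1 e2"
proof -
  define \<alpha> where "\<alpha> = 1 / a - 1 / p"
  define \<beta> where "\<beta> = 1 / p - ib"
  define \<alpha>0 where "\<alpha>0 = 1 / a - 1 / p0"
  define \<beta>0 where "\<beta>0 = 1 / p0 - ib"
  have \<alpha>: "0 < \<alpha>" "0 < \<beta>" "0 \<le> \<alpha>0" "0 \<le> \<beta>0" and sum: "\<alpha> + \<beta> = \<alpha>0 + \<beta>0"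
    using ex by (auto simp: \<alpha>_def \<beta>_def \<alpha>0_def \<beta>0_def)
  have u': "bump M \<B> \<alpha> \<beta> u D" using u by (simp add: \<alpha>_def \<beta>_def)
  show ?thesis
  (* In the first case p0 may equal the upper endpoint b, where \<beta>0 = 0; in the second it
    may equal the lower endpoint a, where \<alpha>0 = 0. *)
  proof (cases "p < p0")
    case True
    have \<beta>\<beta>0: "\<beta>0 < \<beta>" using True ex by (simp add: \<beta>_def \<beta>0_def divide_strict_left_mono)
    define s where "s = \<beta>0 / \<beta>"
    have s: "0 \<le> s" "s < 1" using \<alpha> \<beta>\<beta>0 by (auto simp: s_def)
    have sb: "s * \<beta> = \<beta>0" "\<alpha> + \<beta> - \<beta>0 = \<alpha>0" using \<alpha> sum by (auto simp: s_def)
    (* The exponent of the majorant prescribed by weighted_majorant is the one for which u *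
      G^ex1 equals u * m^(1/p0). *)
    have ex1: "- (p * \<beta> * (1 - s)) = (p - p0) * (1 / p0)"
    proof -
      have "p * \<beta> * (1 - s) = p * (\<beta> - \<beta>0)" using sb by (simp add: algebra_simps)
      also have "\<dots> = (p0 - p) / p0" using ex by (simp add: \<beta>_def \<beta>0_def field_simps)
      finally show ?thesis using ex by (simp add: field_simps)
    qed
    obtain c E where c: "1 \<le> c" "0 < E" and maj: "\<And>\<gamma> \<Gamma>. \<gamma> \<in> borel_measurable M \<Longrightarrow> (\<And>x. 0 \<le> \<gamma> x) \<Longrightarrow> 0 < \<Gamma> \<Longrightarrow>
       (\<integral>\<^sup>+x. ennreal (\<gamma> x powr p) \<partial>M) \<le> ennreal \<Gamma> \<Longrightarrow>
       \<exists>G\<in>borel_measurable M. (\<forall>x. 0 < G x) \<and> (\<forall>x. \<gamma> x \<le> G x) \<and>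
         (\<integral>\<^sup>+x. ennreal (G x powr p) \<partial>M) \<le> ennreal (c * \<Gamma>) \<and>
         bump M \<B> \<alpha>0 \<beta>0 (\<lambda>x. u x * G x powr ((p - p0) * (1 / p0))) E \<and>
         A1_bound M \<B> c (\<lambda>x. G x powr (p * \<beta> / (\<alpha> + \<beta>)) * u x powr (- 1 / (\<alpha> + \<beta>)))"
      using weighted_majorant[OF sf mb assms(3) pos \<alpha>(1,2) D u' ex(2) s, unfolded sb ex1] by blast
    have p0a: "p0 \<noteq> a" using True ex(4,1,2) by (auto simp: field_simps)
    show ?thesis
    proof (rule that[OF c])
      fix \<gamma> h :: "'a \<Rightarrow> real" and \<Gamma> Z :: real
      assume *: "\<gamma> \<in> borel_measurable M" "\<And>x. 0 \<le> \<gamma> x" "h \<in> borel_measurable M" "\<And>x. 0 \<le> h x" "0 < \<Gamma>" "0 < Z"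
        "(\<integral>\<^sup>+x. ennreal (\<gamma> x powr p) \<partial>M) \<le> ennreal \<Gamma>"
      obtain G where [measurable]: "G \<in> borel_measurable M" and G: "\<And>x. 0 < G x" "\<And>x. \<gamma> x \<le> G x"
        "(\<integral>\<^sup>+x. ennreal (G x powr p) \<partial>M) \<le> ennreal (c * \<Gamma>)"
        "bump M \<B> \<alpha>0 \<beta>0 (\<lambda>x. u x * G x powr ((p - p0) * (1 / p0))) E"
        using maj[OF *(1,2,5,7)] by blast
      have m1: "min (y powr p) (y powr p0 * h x) \<le> y powr p0 * G x powr (p - p0) + G x powr p" if "0 \<le> y" for x y
      proof (cases "y \<le> G x")
        case True
        then have "y powr p \<le> G x powr p" using that ex by (intro powr_mono2) auto
        also have "\<dots> \<le> y powr p0 * G x powr (p - p0) + G x powr p" by simp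
        finally show ?thesis by simp
      next
        case False
        then have "y powr (p - p0) \<le> G x powr (p - p0)" using G(1)[of x] True \<open>p < p0\<close> by (intro powr_mono2') auto
        then have "y powr p0 * y powr (p - p0) \<le> y powr p0 * G x powr (p - p0)" by (intro mult_left_mono) auto
        then have "y powr p \<le> y powr p0 * G x powr (p - p0)" by (simp add: powr_add[symmetric])
        then show ?thesis by (simp add: min.coboundedI1 add_increasing2)
      qed
      have m2: "\<gamma> x powr p0 * G x powr (p - p0) \<le> (1 + e powr (- ((p - p0) / p0))) * \<gamma> x powr p + e * 0" if "0 < e" for x e
      proof (cases "\<gamma> x = 0")
        case False
        then have "0 < \<gamma> x" using *(2)[of x] by simp
        then have "G x powr (p - p0) \<le> \<gamma> x powr (p - p0)" using G(2)[of x] True by (intro powr_mono2') auto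
        then have "\<gamma> x powr p0 * G x powr (p - p0) \<le> \<gamma> x powr p0 * \<gamma> x powr (p - p0)" by (intro mult_left_mono) auto
        also have "\<dots> = \<gamma> x powr p" by (simp add: powr_add[symmetric])
        also have "\<dots> \<le> (1 + e powr (- ((p - p0) / p0))) * \<gamma> x powr p" by (simp add: algebra_simps)
        finally show ?thesis by simp
      qed simp
      have b: "bump M \<B> (1 / a - 1 / p0) (1 / p0 - ib) (\<lambda>x. u x * (G x powr (p - p0)) powr (1 / p0)) E"
        using G(4) by (simp add: powr_powr \<alpha>0_def \<beta>0_def)
      show "\<exists>m\<in>borel_measurable M. \<exists>e1\<in>borel_measurable M. \<exists>e2\<in>borel_measurable M.
         multiplier M \<B> u a ib p0 p c E \<gamma> h \<Gamma> Z m e1 e2"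
        unfolding multiplier_def
      proof (rule bexI[of _ "\<lambda>x. G x powr (p - p0)"], rule bexI[of _ "\<lambda>x. G x powr p"], rule bexI[of _ "\<lambda>x. 0"], intro conjI)
        show "\<forall>x y. 0 \<le> y \<longrightarrow> min (y powr p) (y powr p0 * h x) \<le> y powr p0 * G x powr (p - p0) + G x powr p"
          using m1 by blast
        show "\<forall>x e. 0 < e \<longrightarrow> \<gamma> x powr p0 * G x powr (p - p0) \<le> (1 + e powr (- ((p - p0) / p0))) * \<gamma> x powr p + e * 0"
          using m2 by blast
        show "\<forall>x. 0 < G x powr (p - p0) \<and> 0 \<le> G x powr p \<and> 0 \<le> (0::real)"
          using G(1) by (metis less_irrefl order_refl powr_ge_zero powr_gt_zero)
      qed (use G(3) b p0a in simp_all)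
    qed
  next
    case False
    then have pp0: "p0 < p" using ex by simp
    have \<alpha>\<alpha>0: "\<alpha>0 < \<alpha>" using pp0 ex by (simp add: \<alpha>_def \<alpha>0_def divide_strict_left_mono)
    define t where "t = p / (p - p0)"
    define s where "s = \<alpha>0 / \<alpha>"
    have s: "0 \<le> s" "s < 1" using \<alpha> \<alpha>\<alpha>0 by (auto simp: s_def)
    have sb: "s * \<alpha> = \<alpha>0" "\<beta> + \<alpha> - \<alpha>0 = \<beta>0" using \<alpha> sum by (auto simp: s_def)
    have t: "0 < t" using pp0 ex by (simp add: t_def)
    have ex1: "- (t * \<alpha> * (1 - s)) = - (1 / p0)"
    proof -
      have "t * \<alpha> * (1 - s) = t * (\<alpha> - \<alpha>0)" using sb by (simp add: algebra_simps)
      also have "\<alpha> - \<alpha>0 = (p - p0) / (p * p0)" using ex by (simp add: \<alpha>_def \<alpha>0_def field_simps)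
      also have "t * ((p - p0) / (p * p0)) = 1 / p0" using pp0 ex by (simp add: t_def)
      finally show ?thesis by simp
    qed
    (* In terms of 1 / u the roles of \<alpha> and \<beta> are exchanged, and it is again the
      second exponent that decreases. *)
    have inv: "bump M \<B> \<beta> \<alpha> (\<lambda>x. 1 / u x) D" by (rule bump_inverse) fact+
    have invm: "(\<lambda>x. 1 / u x) \<in> borel_measurable M" by measurable
    have posi: "0 < 1 / u x" for x using pos by simp
    obtain c E where c: "1 \<le> c" "0 < E" and maj: "\<And>\<gamma> \<Gamma>. \<gamma> \<in> borel_measurable M \<Longrightarrow> (\<And>x. 0 \<le> \<gamma> x) \<Longrightarrow> 0 < \<Gamma> \<Longrightarrow>
       (\<integral>\<^sup>+x. ennreal (\<gamma> x powr t) \<partial>M) \<le> ennreal \<Gamma> \<Longrightarrow>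
       \<exists>G\<in>borel_measurable M. (\<forall>x. 0 < G x) \<and> (\<forall>x. \<gamma> x \<le> G x) \<and>
         (\<integral>\<^sup>+x. ennreal (G x powr t) \<partial>M) \<le> ennreal (c * \<Gamma>) \<and>
         bump M \<B> \<beta>0 \<alpha>0 (\<lambda>x. 1 / u x * G x powr (- (1 / p0))) E \<and>
         A1_bound M \<B> c (\<lambda>x. G x powr (t * \<alpha> / (\<beta> + \<alpha>)) * (1 / u x) powr (- 1 / (\<beta> + \<alpha>)))"
      using weighted_majorant[OF sf mb invm posi \<alpha>(2,1) D inv t s, unfolded sb ex1] by blast
    show ?thesis
    proof (rule that[OF c])
      fix \<gamma> h :: "'a \<Rightarrow> real" and \<Gamma> Z :: real
      assume *: "\<gamma> \<in> borel_measurable M" "\<And>x. 0 \<le> \<gamma> x" "h \<in> borel_measurable M" "\<And>x. 0 \<le> h x" "0 < \<Gamma>" "0 < Z"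
        and "p0 < p \<Longrightarrow> (\<integral>\<^sup>+x. ennreal (h x powr (p / (p - p0))) \<partial>M) \<le> ennreal Z"
      then have hZ: "(\<integral>\<^sup>+x. ennreal (h x powr t) \<partial>M) \<le> ennreal Z" using pp0 by (simp add: t_def)
      obtain K where [measurable]: "K \<in> borel_measurable M" and K: "\<And>x. 0 < K x" "\<And>x. h x \<le> K x"
        "(\<integral>\<^sup>+x. ennreal (K x powr t) \<partial>M) \<le> ennreal (c * Z)"
        "bump M \<B> \<beta>0 \<alpha>0 (\<lambda>x. 1 / u x * K x powr (- (1 / p0))) E"
        "A1_bound M \<B> c (\<lambda>x. K x powr (t * \<alpha> / (\<beta> + \<alpha>)) * (1 / u x) powr (- 1 / (\<beta> + \<alpha>)))"
        using maj[OF *(3,4,6) hZ] by blast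
      have m1: "min (y powr p) (y powr p0 * h x) \<le> y powr p0 * K x + 0" if "0 \<le> y" for x y
        using K(2)[of x] by (simp add: min.coboundedI2 mult_left_mono)
      have m2: "\<gamma> x powr p0 * K x \<le> (1 + e powr (- ((p - p0) / p0))) * \<gamma> x powr p + e * K x powr t" if "0 < e" for x e
      proof -
        have t1: "1 + p0 / (p - p0) = t" using pp0 by (simp add: t_def field_simps)
        have t2: "1 / (p0 / (p - p0)) = (p - p0) / p0" by simp
        have t3: "(\<gamma> x powr p0) powr (1 + (p - p0) / p0) = \<gamma> x powr p"
          using ex by (simp add: powr_powr field_simps)
        have "\<gamma> x powr p0 * K x \<le> e * K x powr t + e powr (- ((p - p0) / p0)) * \<gamma> x powr p"
          using young_epsilon[of "K x" "\<gamma> x powr p0" e "p0 / (p - p0)"] K(1)[of x] that pp0 ex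
          unfolding t1 t2 t3 by simp
        also have "\<dots> \<le> (1 + e powr (- ((p - p0) / p0))) * \<gamma> x powr p + e * K x powr t"
          by (simp add: distrib_right)
        finally show ?thesis .
      qed
      have "bump M \<B> \<alpha>0 \<beta>0 (\<lambda>x. 1 / (1 / u x * K x powr (- (1 / p0)))) E" by (rule bump_inverse[OF K(4) c(2)])
      moreover have "1 / (1 / u x * K x powr (- (1 / p0))) = u x * K x powr (1 / p0)" for x
        using pos[of x] K(1)[of x] by (simp add: powr_minus_divide)
      ultimately have b: "bump M \<B> (1 / a - 1 / p0) (1 / p0 - ib) (\<lambda>x. u x * K x powr (1 / p0)) E"
        by (simp add: \<alpha>0_def \<beta>0_def)
      have mx: "A1_bound M \<B> c (\<lambda>x. (u x * K x powr (1 / p0)) powr (1 / (1 / p0 - ib)))" if "p0 = a"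
      proof -
        have "\<alpha>0 = 0" using that by (simp add: \<alpha>0_def)
        then have "\<beta>0 = \<alpha> + \<beta>" "0 < \<beta>0" using sum \<alpha> by auto
        moreover have "t * \<alpha> = 1 / p0" using ex1 \<open>\<alpha>0 = 0\<close> by (simp add: s_def)
        ultimately have "(u y * K y powr (1 / p0)) powr (1 / (1 / p0 - ib)) = K y powr (t * \<alpha> / (\<beta> + \<alpha>)) * (1 / u y) powr (- 1 / (\<beta> + \<alpha>))" for y
          unfolding \<beta>0_def[symmetric] using pos[of y] K(1)[of y]
          by (simp add: powr_mult powr_powr powr_divide powr_minus_divide add.commute)
        then show ?thesis using K(5) by simp
      qed
      show "\<exists>m\<in>borel_measurable M. \<exists>e1\<in>borel_measurable M. \<exists>e2\<in>borel_measurable M.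
         multiplier M \<B> u a ib p0 p c E \<gamma> h \<Gamma> Z m e1 e2"
        unfolding multiplier_def
      proof (rule bexI[of _ K], rule bexI[of _ "\<lambda>x. 0"], rule bexI[of _ "\<lambda>x. K x powr t"], intro conjI)
        show "\<forall>x y. 0 \<le> y \<longrightarrow> min (y powr p) (y powr p0 * h x) \<le> y powr p0 * K x + 0" using m1 by blast
        show "\<forall>x e. 0 < e \<longrightarrow> \<gamma> x powr p0 * K x \<le> (1 + e powr (- ((p - p0) / p0))) * \<gamma> x powr p + e * K x powr t"
          using m2 by blast
        show "\<forall>x. 0 < K x \<and> 0 \<le> (0::real) \<and> 0 \<le> K x powr t" using K(1) by simp
      qed (use K(3) b mx in simp_all)
    qed
  qed
qed

section \<open>The modular inequality\<close>

text \<open>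
  For p1 < p2 the integral of the p1-th power over large values and of the p2-th power over small
  ones. Its values at f / l for all l > 0 describe f relative to the couple L^p1 and L^p2, in the
  way a K-functional does.
\<close>

definition modular :: "real \<Rightarrow> real \<Rightarrow> 'a measure \<Rightarrow> ('a \<Rightarrow> real) \<Rightarrow> ennreal" where
  "modular p1 p2 M f = (\<integral>\<^sup>+x. ennreal (min (f x powr p1) (f x powr p2)) \<partial>M)"

text \<open>
  The hypothesis of the extrapolation theorem for a single pair, restricted to weights with
  constants at most L, for which its constant is a number \<kappa>.
\<close>

definition weighted_bound ::
  "'a measure \<Rightarrow> 'a set set \<Rightarrow> real \<Rightarrow> ereal \<Rightarrow> real \<Rightarrow> real \<Rightarrow> real \<Rightarrow> ('a \<Rightarrow> real) \<Rightarrow> ('a \<Rightarrow> real) \<Rightarrow> bool" where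
  "weighted_bound M \<B> a b p0 L \<kappa> f g \<longleftrightarrow>
     (\<forall>w\<in>A_class M \<B> (p0 / a) \<inter> RH_class M \<B> (holder_conj (b / ereal p0)).
        A_const M \<B> (p0 / a) w \<le> ennreal L \<longrightarrow> RH_const M \<B> (holder_conj (b / ereal p0)) w \<le> ennreal L \<longrightarrow>
        (\<integral>\<^sup>+x. ennreal (f x powr p0 * w x) \<partial>M) \<le> ennreal \<kappa> * (\<integral>\<^sup>+x. ennreal (g x powr p0 * w x) \<partial>M))"

text \<open>
  The estimate described at the outset. The number L bounds the constants of the one weight to which
  the hypothesis is applied. It is found before \<kappa>, the constant of the hypothesis at L, is
  known, so that \<epsilon> may depend on \<kappa>.
\<close>

lemma modular_estimate:
  fixes u :: "'a \<Rightarrow> real" and p1 p2 p0 a :: real and b :: ereal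
  assumes sf: "sigma_finite_measure M" and mb: "muckenhoupt_basis M \<B>"
    and um[measurable]: "u \<in> borel_measurable M" and pos: "\<And>x. 0 < u x"
    and D: "0 < D1" "0 < D2" and u1: "bump M \<B> (1 / a - 1 / p1) (1 / p1 - inv_exponent b) u D1"
    and u2: "bump M \<B> (1 / a - 1 / p2) (1 / p2 - inv_exponent b) u D2"
    and a: "0 < a" "a < p1" "p1 < p2" and b: "ereal p2 < b" and p0: "a \<le> p0" "ereal p0 \<le> b" "p1 \<noteq> p0" "p2 \<noteq> p0"
  obtains L :: real where
    "\<And>\<kappa>. 0 \<le> \<kappa> \<Longrightarrow> \<exists>C\<ge>1. \<forall>f g \<Gamma>. f \<in> borel_measurable M \<longrightarrow> g \<in> borel_measurable M \<longrightarrow>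
       (\<forall>x. 0 \<le> f x) \<longrightarrow> (\<forall>x. 0 \<le> g x) \<longrightarrow> 0 < \<Gamma> \<longrightarrow>
       weighted_bound M \<B> a b p0 L \<kappa> f g \<longrightarrow>
       modular p1 p2 M (\<lambda>x. g x * u x) \<le> ennreal \<Gamma> \<longrightarrow>
       modular p1 p2 M (\<lambda>x. f x * u x) < \<infinity> \<longrightarrow>
       modular p1 p2 M (\<lambda>x. f x * u x) \<le> ennreal (C * \<Gamma>)"
proof -
  define ib where "ib = inv_exponent b"
  have basis: "is_basis M \<B>" using mb by (simp add: muckenhoupt_basis_def)
  have "ereal p1 < ereal p2" using a by simp
  then have b1: "ereal p1 < b" using b by (rule less_trans)
  have "ereal a < ereal p1" using a by simp
  then have ab: "ereal a < b" using b1 by (rule less_trans)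
  have pp: "0 < p0" "0 < p1" "0 < p2" using a p0 by auto
  have exps: "0 < 1 / a - 1 / p1" "0 < 1 / p1 - ib" "0 < 1 / a - 1 / p2" "0 < 1 / p2 - ib" "0 \<le> 1 / a - 1 / p0" "0 \<le> 1 / p0 - ib"
    using a p0 pp inv_exponent_bounds(3)[of p1 b] inv_exponent_bounds(3)[of p2 b] inv_exponent_bounds(2)[of p0 b] b b1
    by (auto simp: ib_def divide_strict_left_mono frac_le less_imp_le)
  define \<alpha>0 where "\<alpha>0 = 1 / a - 1 / p0"
  define \<beta>0 where "\<beta>0 = 1 / p0 - ib"
  obtain c1 E1 where c1: "1 \<le> c1" "0 < E1" and side1: "\<And>\<gamma> h \<Gamma> Z. \<gamma> \<in> borel_measurable M \<Longrightarrow> (\<And>x. 0 \<le> \<gamma> x) \<Longrightarrow>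
       h \<in> borel_measurable M \<Longrightarrow> (\<And>x. 0 \<le> h x) \<Longrightarrow> 0 < \<Gamma> \<Longrightarrow> 0 < Z \<Longrightarrow> (\<integral>\<^sup>+x. ennreal (\<gamma> x powr p1) \<partial>M) \<le> ennreal \<Gamma> \<Longrightarrow>
       (p0 < p1 \<Longrightarrow> (\<integral>\<^sup>+x. ennreal (h x powr (p1 / (p1 - p0))) \<partial>M) \<le> ennreal Z) \<Longrightarrow>
       \<exists>m\<in>borel_measurable M. \<exists>e1\<in>borel_measurable M. \<exists>e2\<in>borel_measurable M. multiplier M \<B> u a ib p0 p1 c1 E1 \<gamma> h \<Gamma> Z m e1 e2"
    using one_sided_multiplier[OF sf mb um pos D(1) u1[folded ib_def] a(1) pp(2,1) exps(1,2,5,6) p0(3)] by blast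
  obtain c2 E2 where c2: "1 \<le> c2" "0 < E2" and side2: "\<And>\<gamma> h \<Gamma> Z. \<gamma> \<in> borel_measurable M \<Longrightarrow> (\<And>x. 0 \<le> \<gamma> x) \<Longrightarrow>
       h \<in> borel_measurable M \<Longrightarrow> (\<And>x. 0 \<le> h x) \<Longrightarrow> 0 < \<Gamma> \<Longrightarrow> 0 < Z \<Longrightarrow> (\<integral>\<^sup>+x. ennreal (\<gamma> x powr p2) \<partial>M) \<le> ennreal \<Gamma> \<Longrightarrow>
       (p0 < p2 \<Longrightarrow> (\<integral>\<^sup>+x. ennreal (h x powr (p2 / (p2 - p0))) \<partial>M) \<le> ennreal Z) \<Longrightarrow>
       \<exists>m\<in>borel_measurable M. \<exists>e1\<in>borel_measurable M. \<exists>e2\<in>borel_measurable M. multiplier M \<B> u a ib p0 p2 c2 E2 \<gamma> h \<Gamma> Z m e1 e2"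
    using one_sided_multiplier[OF sf mb um pos D(2) u2[folded ib_def] a(1) pp(3,1) exps(3,4,5,6) p0(4)] by blast
  define c where "c = max c1 c2"
  define E where "E = max E1 E2"
  define D where "D = 2 powr \<alpha>0 * E"
  define L where "L = 1 + D powr p0 + c powr (p0 * (1 / p0 - inv_exponent b))"
  have c: "1 \<le> c" "c1 \<le> c" "c2 \<le> c" and E: "0 < E" "E1 \<le> E" "E2 \<le> E" "0 < D" using c1 c2 by (auto simp: c_def E_def D_def)
  show ?thesis
  proof (rule that[of L])
    fix \<kappa> :: real assume \<kappa>: "0 \<le> \<kappa>"
    (* Small enough for \<kappa> * \<epsilon> * 2 c \<le> 1/2, the coefficient of the term to be
      absorbed. *)
    define \<epsilon> where "\<epsilon> = 1 / (4 * (\<kappa> + 1) * c)"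
    define Ce where "Ce = 1 + \<epsilon> powr (- ((p1 - p0) / p0)) + \<epsilon> powr (- ((p2 - p0) / p0))"
    define C where "C = 2 * \<kappa> * Ce + 1 + 4 * c"
    have \<epsilon>: "0 < \<epsilon>" using \<kappa> c by (simp add: \<epsilon>_def)
    have Ce: "1 \<le> Ce" "1 + \<epsilon> powr (- ((p1 - p0) / p0)) \<le> Ce" "1 + \<epsilon> powr (- ((p2 - p0) / p0)) \<le> Ce" by (auto simp: Ce_def add_nonneg_nonneg)
    have C: "1 \<le> C" using \<kappa> Ce c by (simp add: C_def)
    define \<Phi> where "\<Phi> y = min (y powr p1) (y powr p2)" for y :: real
    have \<Phi>m[measurable]: "\<Phi> \<in> borel_measurable borel" unfolding \<Phi>_def by measurable
    have \<Phi>0: "0 \<le> \<Phi> y" for y by (simp add: \<Phi>_def)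
    have main: "(\<integral>\<^sup>+x. ennreal (\<Phi> (f x * u x)) \<partial>M) \<le> ennreal (C * \<Gamma>)"
      if [measurable]: "f \<in> borel_measurable M" "g \<in> borel_measurable M" and f: "\<And>x. 0 \<le> f x" and g: "\<And>x. 0 \<le> g x" and \<Gamma>: "0 < \<Gamma>"
        and hyp: "\<And>w. w\<in>A_class M \<B> (p0 / a) \<inter> RH_class M \<B> (holder_conj (b / ereal p0)) \<Longrightarrow>
          A_const M \<B> (p0 / a) w \<le> ennreal L \<Longrightarrow> RH_const M \<B> (holder_conj (b / ereal p0)) w \<le> ennreal L \<Longrightarrow>
          (\<integral>\<^sup>+x. ennreal (f x powr p0 * w x) \<partial>M) \<le> ennreal \<kappa> * (\<integral>\<^sup>+x. ennreal (g x powr p0 * w x) \<partial>M)"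
        and gI: "(\<integral>\<^sup>+x. ennreal (\<Phi> (g x * u x)) \<partial>M) \<le> ennreal \<Gamma>"
        and fI: "(\<integral>\<^sup>+x. ennreal (\<Phi> (f x * u x)) \<partial>M) < \<infinity>" for f g \<Gamma>
    proof -
      define y where "y x = f x * u x" for x
      define \<gamma> where "\<gamma> x = g x * u x" for x
      have [measurable]: "y \<in> borel_measurable M" "\<gamma> \<in> borel_measurable M" unfolding y_def \<gamma>_def by measurable
      have y0: "0 \<le> y x" and \<gamma>0: "0 \<le> \<gamma> x" for x using f[of x] g[of x] pos[of x] by (auto simp: y_def \<gamma>_def)
      define I where "I = enn2real (\<integral>\<^sup>+x. ennreal (\<Phi> (y x)) \<partial>M)"
      have I: "(\<integral>\<^sup>+x. ennreal (\<Phi> (y x)) \<partial>M) = ennreal I" "0 \<le> I"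
        using fI unfolding I_def y_def by (auto simp: less_top)
      (* The summand \<Gamma> makes Z positive also when I = 0. *)
      define Z where "Z = I + \<Gamma>"
      have Z: "0 < Z" using I \<Gamma> by (simp add: Z_def)
      (* With this h the second argument of the minimum in the definition of multiplier is
        \<Phi>(y) itself. *)
      define h where "h x = \<Phi> (y x) * y x powr (- p0)" for x
      have hm[measurable]: "h \<in> borel_measurable M" unfolding h_def by measurable
      have h0: "0 \<le> h x" for x using \<Phi>0 by (simp add: h_def)
      have yh: "y x powr p0 * h x = \<Phi> (y x)" for x
      proof (cases "y x = 0")
        case False then show ?thesis using y0[of x] by (simp add: h_def powr_add[symmetric] mult.left_commute)
      qed (simp add: \<Phi>_def)
      have ht: "(\<integral>\<^sup>+x. ennreal (h x powr (p / (p - p0))) \<partial>M) \<le> ennreal Z" if p: "p0 < p" "p = p1 \<or> p = p2" for p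
      proof -
        have "h x powr (p / (p - p0)) \<le> \<Phi> (y x)" for x
        proof (cases "h x = 0")
          case False
          then have hx: "0 < h x" using h0[of x] by simp
          then have yx: "0 < y x" using y0[of x] by (auto simp: h_def less_le)
          have "h x \<le> y x powr p * y x powr (- p0)" unfolding h_def \<Phi>_def using p by (intro mult_right_mono) auto
          then have "h x \<le> y x powr (p - p0)" by (simp add: powr_add[symmetric])
          then have "h x powr (p0 / (p - p0)) \<le> (y x powr (p - p0)) powr (p0 / (p - p0))"
            using h0[of x] p pp by (intro powr_mono2) auto
          also have "\<dots> = y x powr p0" using p by (simp add: powr_powr)
          finally have "h x powr (p0 / (p - p0)) * h x \<le> y x powr p0 * h x" using hx by simp
          moreover have "h x powr (p0 / (p - p0)) * h x = h x powr (p0 / (p - p0) + 1)" using hx by (simp add: powr_add)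
          moreover have "p0 / (p - p0) + 1 = p / (p - p0)" using p by (simp add: field_simps)
          ultimately show ?thesis by (simp add: yh)
        qed (simp add: \<Phi>0)
        then have "(\<integral>\<^sup>+x. ennreal (h x powr (p / (p - p0))) \<partial>M) \<le> (\<integral>\<^sup>+x. ennreal (\<Phi> (y x)) \<partial>M)"
          by (intro nn_integral_mono ennreal_leI)
        also have "\<dots> \<le> ennreal Z" unfolding I using \<Gamma> by (intro ennreal_leI) (simp add: Z_def)
        finally show ?thesis .
      qed
      (* The modular of \<gamma> is the p1-th power for \<gamma> > 1 and the p2-th power for
        \<gamma> \<le> 1, so each part lies in the Lebesgue space of its multiplier. *)
      define \<gamma>1 where "\<gamma>1 x = (if 1 < \<gamma> x then \<gamma> x else 0)" for x
      define \<gamma>2 where "\<gamma>2 x = (if 1 < \<gamma> x then 0 else \<gamma> x)" for x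
      have [measurable]: "\<gamma>1 \<in> borel_measurable M" "\<gamma>2 \<in> borel_measurable M" unfolding \<gamma>1_def \<gamma>2_def by measurable
      have \<gamma>'0: "0 \<le> \<gamma>1 x" "0 \<le> \<gamma>2 x" for x using \<gamma>0 by (auto simp: \<gamma>1_def \<gamma>2_def)
      have \<gamma>\<Phi>1: "\<Phi> (\<gamma> x) = \<gamma> x powr p1" if "1 < \<gamma> x" for x
        using that a by (simp add: \<Phi>_def min_def)
      have \<gamma>\<Phi>2: "\<Phi> (\<gamma> x) = \<gamma> x powr p2" if "\<not> 1 < \<gamma> x" for x
      proof (cases "\<gamma> x = 0")
        case False
        then have "\<gamma> x powr p2 \<le> \<gamma> x powr p1" using that a \<gamma>0[of x] by (intro powr_mono') auto
        then show ?thesis by (simp add: \<Phi>_def)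
      qed (simp add: \<Phi>_def)
      have "\<gamma>1 x powr p1 \<le> \<Phi> (\<gamma> x)" "\<gamma>2 x powr p2 \<le> \<Phi> (\<gamma> x)" for x
        using \<gamma>\<Phi>1[of x] \<gamma>\<Phi>2[of x] \<Phi>0 by (auto simp: \<gamma>1_def \<gamma>2_def)
      then have "(\<integral>\<^sup>+x. ennreal (\<gamma>1 x powr p1) \<partial>M) \<le> (\<integral>\<^sup>+x. ennreal (\<Phi> (\<gamma> x)) \<partial>M)"
        "(\<integral>\<^sup>+x. ennreal (\<gamma>2 x powr p2) \<partial>M) \<le> (\<integral>\<^sup>+x. ennreal (\<Phi> (\<gamma> x)) \<partial>M)"
        by (auto intro!: nn_integral_mono ennreal_leI)
      then have \<gamma>I: "(\<integral>\<^sup>+x. ennreal (\<gamma>1 x powr p1) \<partial>M) \<le> ennreal \<Gamma>" "(\<integral>\<^sup>+x. ennreal (\<gamma>2 x powr p2) \<partial>M) \<le> ennreal \<Gamma>"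
        using gI unfolding \<gamma>_def by (auto intro: order_trans)
      obtain m1 e1 e1' where [measurable]: "m1 \<in> borel_measurable M" "e1 \<in> borel_measurable M" "e1' \<in> borel_measurable M"
        and P1: "multiplier M \<B> u a ib p0 p1 c1 E1 \<gamma>1 h \<Gamma> Z m1 e1 e1'"
        using side1[OF _ \<gamma>'0(1) hm h0 \<Gamma> Z \<gamma>I(1) ht] by auto
      obtain m2 e2 e2' where [measurable]: "m2 \<in> borel_measurable M" "e2 \<in> borel_measurable M" "e2' \<in> borel_measurable M"
        and P2: "multiplier M \<B> u a ib p0 p2 c2 E2 \<gamma>2 h \<Gamma> Z m2 e2 e2'"
        using side2[OF _ \<gamma>'0(2) hm h0 \<Gamma> Z \<gamma>I(2) ht] by auto
      have nn: "0 < m1 x" "0 \<le> e1 x" "0 \<le> e1' x" "0 < m2 x" "0 \<le> e2 x" "0 \<le> e2' x" for x using P1 P2 by (auto simp: multiplier_def)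
      define m where "m x = min (m1 x) (m2 x)" for x
      have [measurable]: "m \<in> borel_measurable M" unfolding m_def by measurable
      have m0: "0 < m x" for x using nn by (simp add: m_def)
      define W where "W x = u x * m x powr (1 / p0)" for x
      have Wm[measurable]: "W \<in> borel_measurable M" unfolding W_def by measurable
      have W0: "0 < W x" for x using pos[of x] m0[of x] by (simp add: W_def)
      have Wmin: "W x = min (u x * m1 x powr (1 / p0)) (u x * m2 x powr (1 / p0))" for x
      proof (cases "m1 x \<le> m2 x")
        case True
        then have "m1 x powr (1 / p0) \<le> m2 x powr (1 / p0)" using nn[of x] pp by (intro powr_mono2) auto
        then show ?thesis using True pos[of x] by (simp add: W_def m_def min_absorb1)
      next
        case False
        then have "m2 x powr (1 / p0) \<le> m1 x powr (1 / p0)" using nn[of x] pp by (intro powr_mono2) auto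
        then show ?thesis using False pos[of x] by (simp add: W_def m_def min_absorb2)
      qed
      have bW: "bump M \<B> \<alpha>0 \<beta>0 W D"
      proof -
        have "bump M \<B> \<alpha>0 \<beta>0 (\<lambda>x. u x * m1 x powr (1 / p0)) E"
          by (rule bump_mono[of _ _ _ _ _ E1]) (use P1 c1 E exps in \<open>auto simp: multiplier_def \<alpha>0_def \<beta>0_def\<close>)
        moreover have "bump M \<B> \<alpha>0 \<beta>0 (\<lambda>x. u x * m2 x powr (1 / p0)) E"
          by (rule bump_mono[of _ _ _ _ _ E2]) (use P2 c2 E exps in \<open>auto simp: multiplier_def \<alpha>0_def \<beta>0_def\<close>)
        ultimately show ?thesis unfolding Wmin[abs_def] D_def
          by (intro bump_min[OF basis]) (use pos nn E exps less_imp_neq[OF nn(1)] less_imp_neq[OF nn(4)] in \<open>auto simp: \<alpha>0_def \<beta>0_def less_imp_neq[symmetric]\<close>)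
      qed
      have mxW: "A1_bound M \<B> c (\<lambda>x. W x powr (1 / \<beta>0))" if "p0 = a"
      proof -
        have "AE x in M. maximal M \<B> (\<lambda>y. ennreal ((u y * m1 y powr (1 / p0)) powr (1 / \<beta>0))) x
            \<le> ennreal (c1 * (u x * m1 x powr (1 / p0)) powr (1 / \<beta>0))"
          "AE x in M. maximal M \<B> (\<lambda>y. ennreal ((u y * m2 y powr (1 / p0)) powr (1 / \<beta>0))) x
            \<le> ennreal (c2 * (u x * m2 x powr (1 / p0)) powr (1 / \<beta>0))"
          using P1 P2 that by (auto simp: multiplier_def \<beta>0_def A1_bound_def)
        then show ?thesis unfolding A1_bound_def
        proof eventually_elim
          case (elim x)
          have mono: "maximal M \<B> (\<lambda>y. ennreal (W y powr (1 / \<beta>0))) x \<le> maximal M \<B> (\<lambda>y. ennreal ((u y * k y powr (1 / p0)) powr (1 / \<beta>0))) x"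
            if "\<And>y. W y \<le> u y * k y powr (1 / p0)" for k
            unfolding maximal_def using that W0 exps
            by (intro SUP_mono' average_mono_AE AE_I2 impI ennreal_leI powr_mono2) (auto simp: \<beta>0_def less_imp_le)
          show ?case
          proof (cases "W x = u x * m1 x powr (1 / p0)")
            case True
            have "maximal M \<B> (\<lambda>y. ennreal (W y powr (1 / \<beta>0))) x \<le> ennreal (c1 * W x powr (1 / \<beta>0))"
              unfolding True using mono[of m1] elim(1) Wmin by (force intro: order_trans)
            also have "\<dots> \<le> ennreal (c * W x powr (1 / \<beta>0))" using c by (intro ennreal_leI mult_right_mono) auto
            finally show ?thesis .
          next
            case False
            then have eq: "W x = u x * m2 x powr (1 / p0)" using Wmin[of x] by (auto simp: min_def split: if_splits)
            have "maximal M \<B> (\<lambda>y. ennreal (W y powr (1 / \<beta>0))) x \<le> ennreal (c2 * W x powr (1 / \<beta>0))"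
              unfolding eq using mono[of m2] elim(2) Wmin by (force intro: order_trans)
            also have "\<dots> \<le> ennreal (c * W x powr (1 / \<beta>0))" using c by (intro ennreal_leI mult_right_mono) auto
            finally show ?thesis .
          qed
        qed
      qed
      have c0: "0 \<le> c" using c by simp
      note cl = class_of_bump[OF basis a(1) p0(1,2) ab Wm W0 E(4) c0 bW[unfolded \<alpha>0_def \<beta>0_def ib_def] mxW[unfolded \<beta>0_def ib_def], folded L_def]
      have Iw: "(\<integral>\<^sup>+x. ennreal (f x powr p0 * W x powr p0) \<partial>M) \<le> ennreal \<kappa> * (\<integral>\<^sup>+x. ennreal (g x powr p0 * W x powr p0) \<partial>M)"
        by (rule hyp) (use cl in auto)
      have Wp: "k x powr p0 * W x powr p0 = (k x * u x) powr p0 * m x" if "0 \<le> k x" for k x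
        using that pos[of x] m0[of x] pp by (simp add: W_def powr_mult powr_powr)
      (* Both terms of the minimum \<Phi> are at most y^p0 m_i up to an error, hence so is \<Phi>
        with m = min m1 m2. *)
      have ptf: "\<Phi> (y x) \<le> f x powr p0 * W x powr p0 + e1 x + e2 x" for x
      proof -
        have "min (y x powr p1) (y x powr p0 * h x) \<le> y x powr p0 * m1 x + e1 x" using P1 y0[of x] by (simp add: multiplier_def)
        moreover have "min (y x powr p2) (y x powr p0 * h x) \<le> y x powr p0 * m2 x + e2 x" using P2 y0[of x] by (simp add: multiplier_def)
        ultimately have "\<Phi> (y x) \<le> y x powr p0 * m1 x + e1 x" "\<Phi> (y x) \<le> y x powr p0 * m2 x + e2 x"
          unfolding yh by (auto simp: \<Phi>_def min_def split: if_splits)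
        then have "\<Phi> (y x) \<le> y x powr p0 * m x + e1 x + e2 x" using nn[of x] unfolding m_def by (cases "m1 x \<le> m2 x") (auto simp: min_def)
        then show ?thesis using Wp[of f x] f[of x] by (simp add: y_def)
      qed
      (* For an upper bound it suffices to use the multiplier that suits the size of \<gamma>,
        because m is below both. *)
      have ptg: "g x powr p0 * W x powr p0 \<le> Ce * \<Phi> (\<gamma> x) + \<epsilon> * (e1' x + e2' x)" for x
      proof -
        have 1: "\<gamma>1 x powr p0 * m1 x \<le> (1 + \<epsilon> powr (- ((p1 - p0) / p0))) * \<gamma>1 x powr p1 + \<epsilon> * e1' x" using P1 \<epsilon> by (simp add: multiplier_def)
        have 2: "\<gamma>2 x powr p0 * m2 x \<le> (1 + \<epsilon> powr (- ((p2 - p0) / p0))) * \<gamma>2 x powr p2 + \<epsilon> * e2' x" using P2 \<epsilon> by (simp add: multiplier_def)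
        have e: "0 \<le> \<epsilon> * e1' x" "0 \<le> \<epsilon> * e2' x" using \<epsilon> nn by auto
        have "\<gamma> x powr p0 * m x \<le> Ce * \<Phi> (\<gamma> x) + \<epsilon> * (e1' x + e2' x)"
        proof (cases "1 < \<gamma> x")
          case True
          have "\<gamma> x powr p0 * m x \<le> \<gamma>1 x powr p0 * m1 x" using True by (simp add: \<gamma>1_def m_def mult_left_mono)
          also note 1
          also have "(1 + \<epsilon> powr (- ((p1 - p0) / p0))) * \<gamma>1 x powr p1 \<le> Ce * \<Phi> (\<gamma> x)"
            using \<gamma>\<Phi>1[OF True] True Ce by (simp add: \<gamma>1_def mult_right_mono)
          finally show ?thesis using e by (simp add: algebra_simps)
        next
          case False
          have "\<gamma> x powr p0 * m x \<le> \<gamma>2 x powr p0 * m2 x" using False by (simp add: \<gamma>2_def m_def mult_left_mono)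
          also note 2
          also have "(1 + \<epsilon> powr (- ((p2 - p0) / p0))) * \<gamma>2 x powr p2 \<le> Ce * \<Phi> (\<gamma> x)"
            using \<gamma>\<Phi>2[OF False] False Ce by (simp add: \<gamma>2_def mult_right_mono)
          finally show ?thesis using e by (simp add: algebra_simps)
        qed
        then show ?thesis using Wp[of g x] g[of x] by (simp add: \<gamma>_def)
      qed
      have le_c: "ennreal (c1 * r) \<le> ennreal (c * r)" "ennreal (c2 * r) \<le> ennreal (c * r)" if "0 \<le> r" for r
        using that c by (auto intro!: ennreal_leI mult_right_mono)
      have eI: "(\<integral>\<^sup>+x. ennreal (e1 x) \<partial>M) \<le> ennreal (c * \<Gamma>)" "(\<integral>\<^sup>+x. ennreal (e2 x) \<partial>M) \<le> ennreal (c * \<Gamma>)"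
        "(\<integral>\<^sup>+x. ennreal (e1' x) \<partial>M) \<le> ennreal (c * Z)" "(\<integral>\<^sup>+x. ennreal (e2' x) \<partial>M) \<le> ennreal (c * Z)"
        using P1 P2 le_c[of \<Gamma>] le_c[of Z] \<Gamma> Z by (auto simp: multiplier_def intro: order_trans)
      have comb: "ennreal A * ennreal B + ennreal r * (ennreal s + ennreal t) = ennreal (A * B + r * (s + t))"
        if "0 \<le> A" "0 \<le> B" "0 \<le> r" "0 \<le> s" "0 \<le> t" for A B r s t
        using that by (simp add: ennreal_mult ennreal_plus)
      have gW: "(\<integral>\<^sup>+x. ennreal (g x powr p0 * W x powr p0) \<partial>M) \<le> ennreal (Ce * \<Gamma> + \<epsilon> * (2 * c * Z))"
      proof -
        have "(\<integral>\<^sup>+x. ennreal (g x powr p0 * W x powr p0) \<partial>M) \<le> (\<integral>\<^sup>+x. ennreal Ce * ennreal (\<Phi> (\<gamma> x)) + ennreal \<epsilon> * (ennreal (e1' x) + ennreal (e2' x)) \<partial>M)"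
        proof (intro nn_integral_mono)
          fix x
          have "ennreal Ce * ennreal (\<Phi> (\<gamma> x)) + ennreal \<epsilon> * (ennreal (e1' x) + ennreal (e2' x)) = ennreal (Ce * \<Phi> (\<gamma> x) + \<epsilon> * (e1' x + e2' x))"
            using Ce \<epsilon> \<Phi>0 nn[of x] by (simp add: ennreal_mult ennreal_plus)
          then show "ennreal (g x powr p0 * W x powr p0) \<le> ennreal Ce * ennreal (\<Phi> (\<gamma> x)) + ennreal \<epsilon> * (ennreal (e1' x) + ennreal (e2' x))"
            using ennreal_leI[OF ptg[of x]] by simp
        qed
        also have "\<dots> = ennreal Ce * (\<integral>\<^sup>+x. ennreal (\<Phi> (\<gamma> x)) \<partial>M) + ennreal \<epsilon> * ((\<integral>\<^sup>+x. ennreal (e1' x) \<partial>M) + (\<integral>\<^sup>+x. ennreal (e2' x) \<partial>M))"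
          by (simp add: nn_integral_add nn_integral_cmult)
        also have "\<dots> \<le> ennreal Ce * ennreal \<Gamma> + ennreal \<epsilon> * (ennreal (c * Z) + ennreal (c * Z))"
          using gI eI unfolding \<gamma>_def by (intro add_mono mult_left_mono) auto
        also have "\<dots> = ennreal (Ce * \<Gamma> + \<epsilon> * (c * Z + c * Z))"
          by (rule comb) (use Ce \<epsilon> \<Gamma> Z c in auto)
        also have "c * Z + c * Z = 2 * c * Z" by simp
        finally show ?thesis .
      qed
      have "ennreal I \<le> (\<integral>\<^sup>+x. ennreal (f x powr p0 * W x powr p0) + (ennreal (e1 x) + ennreal (e2 x)) \<partial>M)"
        unfolding I(1)[symmetric]
      proof (intro nn_integral_mono)
        fix x
        have "ennreal (f x powr p0 * W x powr p0) + (ennreal (e1 x) + ennreal (e2 x)) = ennreal (f x powr p0 * W x powr p0 + e1 x + e2 x)"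
          using nn[of x] by (simp add: ennreal_plus add.assoc)
        then show "ennreal (\<Phi> (y x)) \<le> ennreal (f x powr p0 * W x powr p0) + (ennreal (e1 x) + ennreal (e2 x))"
          using ennreal_leI[OF ptf[of x]] by simp
      qed
      also have "\<dots> = (\<integral>\<^sup>+x. ennreal (f x powr p0 * W x powr p0) \<partial>M) + ((\<integral>\<^sup>+x. ennreal (e1 x) \<partial>M) + (\<integral>\<^sup>+x. ennreal (e2 x) \<partial>M))"
        by (simp add: nn_integral_add)
      also have "\<dots> \<le> ennreal \<kappa> * ennreal (Ce * \<Gamma> + \<epsilon> * (2 * c * Z)) + (ennreal (c * \<Gamma>) + ennreal (c * \<Gamma>))"
        by (intro add_mono eI order_trans[OF Iw] mult_left_mono gW) auto
      also have "\<dots> = ennreal (\<kappa> * (Ce * \<Gamma> + \<epsilon> * (2 * c * Z)) + (c * \<Gamma> + c * \<Gamma>))"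
        using comb[of \<kappa> "Ce * \<Gamma> + \<epsilon> * (2 * c * Z)" 1 "c * \<Gamma>" "c * \<Gamma>"] \<kappa> Ce \<epsilon> \<Gamma> Z c by simp
      finally have "I \<le> \<kappa> * (Ce * \<Gamma> + \<epsilon> * (2 * c * Z)) + (c * \<Gamma> + c * \<Gamma>)"
        using \<kappa> Ce \<epsilon> \<Gamma> Z c by (subst (asm) ennreal_le_iff) (auto intro!: add_nonneg_nonneg mult_nonneg_nonneg)
      also have "\<dots> = \<kappa> * Ce * \<Gamma> + (\<kappa> * \<epsilon> * 2 * c) * Z + 2 * c * \<Gamma>" by (simp add: algebra_simps)
      also have "\<kappa> * \<epsilon> * 2 * c \<le> 1 / 2"
      proof -
        have "\<epsilon> * (2 * c) = 1 / (2 * (\<kappa> + 1))" using \<kappa> c by (simp add: \<epsilon>_def divide_simps)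
        then have "\<kappa> * \<epsilon> * 2 * c = \<kappa> / (2 * (\<kappa> + 1))" by (simp add: mult.assoc)
        also have "\<dots> \<le> 1 / 2" using \<kappa> by (simp add: divide_simps)
        finally show ?thesis .
      qed
      finally have "I \<le> \<kappa> * Ce * \<Gamma> + 1 / 2 * Z + 2 * c * \<Gamma>" using Z by (simp add: mult_right_mono)
      moreover have "C * \<Gamma> = 2 * (\<kappa> * Ce * \<Gamma>) + \<Gamma> + 2 * (2 * c * \<Gamma>)" by (simp add: C_def algebra_simps)
      moreover have "i \<le> k" if "i \<le> r + 1 / 2 * (i + s) + t" "k = 2 * r + s + 2 * t" for i k r s t :: real
        using that by (simp add: field_simps)
      ultimately have "I \<le> C * \<Gamma>" unfolding Z_def by blast
      then show ?thesis using I unfolding y_def by (simp add: ennreal_leI)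
    qed
    show "\<exists>C\<ge>1. \<forall>f g \<Gamma>. f \<in> borel_measurable M \<longrightarrow> g \<in> borel_measurable M \<longrightarrow>
       (\<forall>x. 0 \<le> f x) \<longrightarrow> (\<forall>x. 0 \<le> g x) \<longrightarrow> 0 < \<Gamma> \<longrightarrow>
       weighted_bound M \<B> a b p0 L \<kappa> f g \<longrightarrow>
       modular p1 p2 M (\<lambda>x. g x * u x) \<le> ennreal \<Gamma> \<longrightarrow>
       modular p1 p2 M (\<lambda>x. f x * u x) < \<infinity> \<longrightarrow>
       modular p1 p2 M (\<lambda>x. f x * u x) \<le> ennreal (C * \<Gamma>)"
      unfolding modular_def weighted_bound_def
    proof (intro exI[of _ C] conjI allI impI C)
      fix f g \<Gamma>
      assume *: "f \<in> borel_measurable M" "g \<in> borel_measurable M" "\<forall>x. 0 \<le> f x" "\<forall>x. 0 \<le> g x" "0 < \<Gamma>"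
        and hyp: "\<forall>w\<in>A_class M \<B> (p0 / a) \<inter> RH_class M \<B> (holder_conj (b / ereal p0)).
          A_const M \<B> (p0 / a) w \<le> ennreal L \<longrightarrow> RH_const M \<B> (holder_conj (b / ereal p0)) w \<le> ennreal L \<longrightarrow>
          (\<integral>\<^sup>+x. ennreal (f x powr p0 * w x) \<partial>M) \<le> ennreal \<kappa> * (\<integral>\<^sup>+x. ennreal (g x powr p0 * w x) \<partial>M)"
        and gf: "(\<integral>\<^sup>+x. ennreal (min ((g x * u x) powr p1) ((g x * u x) powr p2)) \<partial>M) \<le> ennreal \<Gamma>"
          "(\<integral>\<^sup>+x. ennreal (min ((f x * u x) powr p1) ((f x * u x) powr p2)) \<partial>M) < \<infinity>"
      show "(\<integral>\<^sup>+x. ennreal (min ((f x * u x) powr p1) ((f x * u x) powr p2)) \<partial>M) \<le> ennreal (C * \<Gamma>)"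
        unfolding \<Phi>_def[symmetric]
        by (rule main[of f g]) (use * gf in \<open>auto simp: \<Phi>_def intro!: hyp[rule_format]\<close>)
    qed
  qed
qed

text \<open>
  Where G is infinite its real value would be 0 and the inequality too strong; the condition
  confines the inequality to functions G that are finite almost everywhere.
\<close>

definition modular_dominated ::
  "'a measure \<Rightarrow> real \<Rightarrow> real \<Rightarrow> real \<Rightarrow> ('a \<Rightarrow> ennreal) \<Rightarrow> ('a \<Rightarrow> ennreal) \<Rightarrow> bool" where
  "modular_dominated M p1 p2 C F G \<longleftrightarrow>
     ((AE x in M. G x < \<infinity>) \<longrightarrow>
      (\<forall>l>0. emeasure M {x\<in>space M. ennreal l < F x} \<le> ennreal C * modular p1 p2 M (\<lambda>x. enn2real (G x) / l)))"

text \<open>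
  The pair (f, g) is divided by l and f is truncated at a multiple of a function k for which the
  modular of k u is finite; this is the finiteness needed for absorption. Truncation keeps the
  weighted inequalities, as their left-hand sides decrease. The function \<Phi> is at least 1 on (1,
  \<infinity>), which bounds the measure of a level set, and the truncation is removed by continuity
  of the measure.
\<close>

lemma weak_modular_estimate:
  fixes u :: "'a \<Rightarrow> real" and p1 p2 p0 a :: real and b :: ereal and \<phi> :: "ennreal \<Rightarrow> ennreal \<Rightarrow> ennreal"
  assumes sf: "sigma_finite_measure M" and mb: "muckenhoupt_basis M \<B>" and ext: "extrapolation_family M \<F>"
    and um[measurable]: "u \<in> borel_measurable M" and pos: "\<And>x. 0 < u x"
    and D: "0 < D1" "0 < D2" and u1: "bump M \<B> (1 / a - 1 / p1) (1 / p1 - inv_exponent b) u D1"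
    and u2: "bump M \<B> (1 / a - 1 / p2) (1 / p2 - inv_exponent b) u D2"
    and a: "0 < a" "a < p1" "p1 < p2" and b: "ereal p2 < b" and p0: "a \<le> p0" "ereal p0 \<le> b" "p1 \<noteq> p0" "p2 \<noteq> p0"
    and \<phi>: "\<And>a a' b b'. a \<le> a' \<Longrightarrow> b \<le> b' \<Longrightarrow> \<phi> a b \<le> \<phi> a' b'" "\<And>a b. a < \<infinity> \<Longrightarrow> b < \<infinity> \<Longrightarrow> \<phi> a b < \<infinity>"
    and hyp: "\<And>w f g. w\<in>A_class M \<B> (p0 / a) \<inter> RH_class M \<B> (holder_conj (b / ereal p0)) \<Longrightarrow> (f, g) \<in> \<F> \<Longrightarrow>
       Lp_norm (density M w) p0 f \<le> \<phi> (A_const M \<B> (p0 / a) w) (RH_const M \<B> (holder_conj (b / ereal p0)) w) * Lp_norm (density M w) p0 g"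
  obtains C :: real where "1 \<le> C"
    "\<And>f g. (f, g) \<in> \<F> \<Longrightarrow> modular_dominated M p1 p2 C (\<lambda>x. f x * ennreal (u x)) (\<lambda>x. g x * ennreal (u x))"
proof -
  have pp: "0 < p0" "0 < p1" "0 < p2" using a p0 by auto
  obtain L :: real where L: "\<And>\<kappa>. 0 \<le> \<kappa> \<Longrightarrow> \<exists>C\<ge>1. \<forall>f g \<Gamma>. f \<in> borel_measurable M \<longrightarrow> g \<in> borel_measurable M \<longrightarrow>
       (\<forall>x. 0 \<le> f x) \<longrightarrow> (\<forall>x. 0 \<le> g x) \<longrightarrow> 0 < \<Gamma> \<longrightarrow>
       weighted_bound M \<B> a b p0 L \<kappa> f g \<longrightarrow>
       modular p1 p2 M (\<lambda>x. g x * u x) \<le> ennreal \<Gamma> \<longrightarrow>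
       modular p1 p2 M (\<lambda>x. f x * u x) < \<infinity> \<longrightarrow>
       modular p1 p2 M (\<lambda>x. f x * u x) \<le> ennreal (C * \<Gamma>)"
    using modular_estimate[OF sf mb um pos D u1 u2 a b p0] by blast
  define \<phi>0 where "\<phi>0 = 1 + enn2real (\<phi> (ennreal L) (ennreal L))"
  have \<phi>0: "\<phi> (ennreal L) (ennreal L) \<le> ennreal \<phi>0" "1 \<le> \<phi>0"
  proof -
    have "\<phi> (ennreal L) (ennreal L) < \<infinity>" by (rule \<phi>(2)) auto
    then show "\<phi> (ennreal L) (ennreal L) \<le> ennreal \<phi>0" "1 \<le> \<phi>0"
      by (cases "\<phi> (ennreal L) (ennreal L)"; auto simp: \<phi>0_def ennreal_leI)+
  qed
  define \<kappa> where "\<kappa> = \<phi>0 powr p0"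
  obtain C where C: "1 \<le> C" and est: "\<And>f g \<Gamma>. f \<in> borel_measurable M \<Longrightarrow> g \<in> borel_measurable M \<Longrightarrow>
       (\<forall>x. 0 \<le> f x) \<Longrightarrow> (\<forall>x. 0 \<le> g x) \<Longrightarrow> 0 < \<Gamma> \<Longrightarrow>
       weighted_bound M \<B> a b p0 L \<kappa> f g \<Longrightarrow>
       modular p1 p2 M (\<lambda>x. g x * u x) \<le> ennreal \<Gamma> \<Longrightarrow>
       modular p1 p2 M (\<lambda>x. f x * u x) < \<infinity> \<Longrightarrow>
       modular p1 p2 M (\<lambda>x. f x * u x) \<le> ennreal (C * \<Gamma>)"
    using L[of \<kappa>] by (auto simp: \<kappa>_def)
  obtain k0 :: "'a \<Rightarrow> real" where k0[measurable]: "k0 \<in> borel_measurable M" "\<And>x. 0 < k0 x" "(\<integral>\<^sup>+x. ennreal (k0 x) \<partial>M) \<le> 1"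
    using positive_integrable_function[OF sf] by blast
  (* (k u)^p2 is integrable, so the truncated functions have finite modular. *)
  define k where "k x = k0 x powr (1 / p2) / u x" for x
  have km[measurable]: "k \<in> borel_measurable M" unfolding k_def by measurable
  have k: "0 < k x" "(k x * u x) powr p2 = k0 x" for x
    using k0(2)[of x] pos[of x] pp by (auto simp: k_def powr_powr)
  define \<Phi> where "\<Phi> y = min (y powr p1) (y powr p2)" for y :: real
  have \<Phi>m[measurable]: "\<Phi> \<in> borel_measurable borel" unfolding \<Phi>_def by measurable
  show ?thesis
  proof (rule that[OF C])
    fix f g :: "'a \<Rightarrow> ennreal"
    assume fg: "(f, g) \<in> \<F>"
    show "modular_dominated M p1 p2 C (\<lambda>x. f x * ennreal (u x)) (\<lambda>x. g x * ennreal (u x))"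
      unfolding modular_dominated_def
    proof (intro impI allI)
      fix l :: real
      assume gufin: "AE x in M. g x * ennreal (u x) < \<infinity>" and l: "0 < l"
      have gfin: "AE x in M. g x < \<infinity>"
        using gufin
      proof eventually_elim
        case (elim x)
        then show ?case using pos[of x] by (cases "g x") (auto simp: ennreal_top_mult)
      qed
      have fm[measurable]: "f \<in> borel_measurable M" and gm[measurable]: "g \<in> borel_measurable M"
        using ext fg by (auto simp: extrapolation_family_def)
      define gr where "gr x = enn2real (g x) / l" for x
      define fr where "fr n x = enn2real (min (f x) (ennreal (real n * k x))) / l" for n x
      have [measurable]: "gr \<in> borel_measurable M" "fr n \<in> borel_measurable M" for n
        unfolding gr_def fr_def by measurable
      have gr0: "0 \<le> gr x" and fr0: "0 \<le> fr n x" for n x using l by (auto simp: gr_def fr_def)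
      have fr_f: "ennreal (l * fr n x) \<le> f x" and fr_k: "l * fr n x \<le> real n * k x" for n x
      proof -
        have "min (f x) (ennreal (real n * k x)) < \<infinity>" by (simp add: min_less_iff_disj)
        then have e: "ennreal (l * fr n x) = min (f x) (ennreal (real n * k x))" using l by (simp add: fr_def less_top)
        then show "ennreal (l * fr n x) \<le> f x" by simp
        have "ennreal (l * fr n x) \<le> ennreal (real n * k x)" unfolding e by simp
        then show "l * fr n x \<le> real n * k x" using k(1)[of x] by (simp add: less_imp_le)
      qed
      have hyp': "(\<integral>\<^sup>+x. ennreal (fr n x powr p0 * w x) \<partial>M) \<le> ennreal \<kappa> * (\<integral>\<^sup>+x. ennreal (gr x powr p0 * w x) \<partial>M)"
        if w: "w\<in>A_class M \<B> (p0 / a) \<inter> RH_class M \<B> (holder_conj (b / ereal p0))"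
          "A_const M \<B> (p0 / a) w \<le> ennreal L" "RH_const M \<B> (holder_conj (b / ereal p0)) w \<le> ennreal L" for w n
      proof -
        have [measurable]: "w \<in> borel_measurable M" using w by (auto simp: A_class_def weight_def)
        have Lp: "Lp_norm (density M w) p0 h = ennpowr (\<integral>\<^sup>+x. ennpowr (h x) p0 * ennreal (w x) \<partial>M) (1 / p0)"
          if [measurable]: "h \<in> borel_measurable M" for h
          unfolding Lp_norm_def by (subst nn_integral_density) (auto simp: mult.commute)
        have "Lp_norm (density M w) p0 f \<le> \<phi> (A_const M \<B> (p0 / a) w) (RH_const M \<B> (holder_conj (b / ereal p0)) w) * Lp_norm (density M w) p0 g"
          by (rule hyp[OF w(1) fg])
        also have "\<dots> \<le> ennreal \<phi>0 * Lp_norm (density M w) p0 g"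
          by (intro mult_right_mono order_trans[OF \<phi>(1) \<phi>0(1)] w) auto
        finally have "ennpowr (Lp_norm (density M w) p0 f) p0 \<le> ennpowr (ennreal \<phi>0 * Lp_norm (density M w) p0 g) p0"
          using pp by (intro ennpowr_mono) auto
        then have fgI: "(\<integral>\<^sup>+x. ennpowr (f x) p0 * ennreal (w x) \<partial>M) \<le> ennreal \<kappa> * (\<integral>\<^sup>+x. ennpowr (g x) p0 * ennreal (w x) \<partial>M)"
          using \<phi>0 pp by (simp add: Lp ennpowr_mult ennpowr_ennpowr \<kappa>_def)
        have "(\<integral>\<^sup>+x. ennreal (fr n x powr p0 * w x) \<partial>M) \<le> (\<integral>\<^sup>+x. ennreal (l powr (- p0)) * (ennpowr (f x) p0 * ennreal (w x)) \<partial>M)"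
        proof (rule nn_integral_mono)
          fix x
          have "fr n x powr p0 = l powr (- p0) * (l * fr n x) powr p0"
            using l fr0[of n x] by (simp add: powr_mult powr_minus_divide)
          then have eq: "ennreal (fr n x powr p0 * w x) = ennreal (l powr (- p0)) * (ennreal ((l * fr n x) powr p0) * ennreal (w x))"
            by (simp add: ennreal_mult' mult.assoc)
          have "ennreal ((l * fr n x) powr p0) = ennpowr (ennreal (l * fr n x)) p0"
            using l fr0[of n x] by (simp add: ennpowr_ennreal)
          also have "\<dots> \<le> ennpowr (f x) p0" using pp by (intro ennpowr_mono fr_f) auto
          finally show "ennreal (fr n x powr p0 * w x) \<le> ennreal (l powr (- p0)) * (ennpowr (f x) p0 * ennreal (w x))"
            unfolding eq by (intro mult_left_mono mult_right_mono) auto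
        qed
        also have "\<dots> = ennreal (l powr (- p0)) * (\<integral>\<^sup>+x. ennpowr (f x) p0 * ennreal (w x) \<partial>M)"
          by (rule nn_integral_cmult) measurable
        also have "\<dots> \<le> ennreal (l powr (- p0)) * (ennreal \<kappa> * (\<integral>\<^sup>+x. ennpowr (g x) p0 * ennreal (w x) \<partial>M))"
          by (intro mult_left_mono fgI) auto
        also have "(\<integral>\<^sup>+x. ennpowr (g x) p0 * ennreal (w x) \<partial>M) = (\<integral>\<^sup>+x. ennreal (l powr p0) * ennreal (gr x powr p0 * w x) \<partial>M)"
        proof (rule nn_integral_cong_AE)
          show "AE x in M. ennpowr (g x) p0 * ennreal (w x) = ennreal (l powr p0) * ennreal (gr x powr p0 * w x)"
            using gfin
          proof eventually_elim
            case (elim x)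
            then obtain r where r: "g x = ennreal r" "0 \<le> r" by (cases "g x") auto
            then have "ennpowr (g x) p0 = ennreal (l powr p0 * gr x powr p0)"
              using l by (simp add: ennpowr_ennreal gr_def powr_mult[symmetric])
            then show ?case by (simp add: ennreal_mult' mult.assoc)
          qed
        qed
        also have "\<dots> = ennreal (l powr p0) * (\<integral>\<^sup>+x. ennreal (gr x powr p0 * w x) \<partial>M)"
          by (rule nn_integral_cmult) measurable
        also have "ennreal (l powr (- p0)) * (ennreal \<kappa> * (ennreal (l powr p0) * (\<integral>\<^sup>+x. ennreal (gr x powr p0 * w x) \<partial>M)))
            = ennreal (l powr (- p0) * \<kappa> * l powr p0) * (\<integral>\<^sup>+x. ennreal (gr x powr p0 * w x) \<partial>M)"
          by (simp add: ennreal_mult' mult.assoc \<kappa>_def)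
        also have "l powr (- p0) * \<kappa> * l powr p0 = \<kappa>" using l by (simp add: powr_minus_divide)
        finally show ?thesis .
      qed
      define J where "J = (\<integral>\<^sup>+x. ennreal (\<Phi> (gr x * u x)) \<partial>M)"
      (* The estimate asks for a positive bound of the modular of g; as J may be 0, it is applied
        with J + e / C. *)
      have bound: "emeasure M {x\<in>space M. 1 < fr n x * u x} \<le> ennreal C * J" for n
      proof (cases J)
        case top
        then show ?thesis using C by (simp add: ennreal_mult_top)
      next
        case (real j)
        have "(\<integral>\<^sup>+x. ennreal (\<Phi> (fr n x * u x)) \<partial>M) \<le> (\<integral>\<^sup>+x. ennreal ((real n / l) powr p2) * ennreal (k0 x) \<partial>M)"
        proof (rule nn_integral_mono)
          fix x
          have "fr n x \<le> real n / l * k x" using fr_k[of n x] l by (simp add: field_simps)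
          then have le: "fr n x * u x \<le> real n / l * (k x * u x)"
            using pos[of x] mult_right_mono[of "fr n x" "real n / l * k x" "u x"] by (simp add: mult.assoc)
          have "\<Phi> (fr n x * u x) \<le> (fr n x * u x) powr p2" by (simp add: \<Phi>_def)
          also have "(fr n x * u x) powr p2 \<le> (real n / l * (k x * u x)) powr p2"
            using pp fr0[of n x] pos[of x] le by (intro powr_mono2) auto
          also have "\<dots> = (real n / l) powr p2 * k0 x" using l k[of x] pos[of x] by (subst powr_mult) auto
          finally show "ennreal (\<Phi> (fr n x * u x)) \<le> ennreal ((real n / l) powr p2) * ennreal (k0 x)"
            using k0(2)[of x] by (simp add: ennreal_mult'[symmetric] ennreal_leI)
        qed
        also have "\<dots> = ennreal ((real n / l) powr p2) * (\<integral>\<^sup>+x. ennreal (k0 x) \<partial>M)" by (rule nn_integral_cmult) measurable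
        also have "\<dots> < \<infinity>" using k0(3) by (auto simp: ennreal_mult_less_top intro: le_less_trans)
        finally have fin: "(\<integral>\<^sup>+x. ennreal (\<Phi> (fr n x * u x)) \<partial>M) < \<infinity>" .
        have "(\<integral>\<^sup>+x. ennreal (\<Phi> (fr n x * u x)) \<partial>M) \<le> ennreal (C * j) + ennreal e" if e: "0 < e" for e
        proof -
          have j: "0 < j + e / C" using real C e by (simp add: add_nonneg_pos)
          have "(\<integral>\<^sup>+x. ennreal (\<Phi> (fr n x * u x)) \<partial>M) \<le> ennreal (C * (j + e / C))"
            unfolding \<Phi>_def modular_def[symmetric]
          proof (rule est[of "fr n" gr])
            show "modular p1 p2 M (\<lambda>x. gr x * u x) \<le> ennreal (j + e / C)"
              using real e C unfolding J_def \<Phi>_def modular_def by (simp add: ennreal_leI)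
            show "modular p1 p2 M (\<lambda>x. fr n x * u x) < \<infinity>"
              using fin unfolding \<Phi>_def modular_def .
            show "weighted_bound M \<B> a b p0 L \<kappa> (fr n) gr" using hyp' by (simp add: weighted_bound_def)
          qed (use fr0 gr0 j in auto)
          also have "C * (j + e / C) = C * j + e" using C by (simp add: field_simps)
          finally show ?thesis using real C e by (simp add: ennreal_plus)
        qed
        then have "(\<integral>\<^sup>+x. ennreal (\<Phi> (fr n x * u x)) \<partial>M) \<le> ennreal (C * j)" by (rule ennreal_le_epsilon)
        also have "\<dots> = ennreal C * J" using real C by (simp add: ennreal_mult)
        finally have le: "(\<integral>\<^sup>+x. ennreal (\<Phi> (fr n x * u x)) \<partial>M) \<le> ennreal C * J" .
        have "emeasure M {x\<in>space M. 1 < fr n x * u x} = (\<integral>\<^sup>+x. indicator {x\<in>space M. 1 < fr n x * u x} x \<partial>M)"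
          by (rule nn_integral_indicator[symmetric]) measurable
        also have "\<dots> \<le> (\<integral>\<^sup>+x. ennreal (\<Phi> (fr n x * u x)) \<partial>M)"
        proof (rule nn_integral_mono)
          fix x
          have "1 \<le> \<Phi> (fr n x * u x)" if "1 < fr n x * u x" using that pp by (auto simp: \<Phi>_def ge_one_powr_ge_zero)
          then show "indicator {x\<in>space M. 1 < fr n x * u x} x \<le> ennreal (\<Phi> (fr n x * u x))"
            by (auto split: split_indicator)
        qed
        finally show ?thesis using le by (rule order_trans)
      qed
      have "emeasure M {x\<in>space M. ennreal l < f x * ennreal (u x)} \<le> emeasure M (\<Union>n. {x\<in>space M. 1 < fr n x * u x})"
      proof (rule emeasure_mono)
        show "{x\<in>space M. ennreal l < f x * ennreal (u x)} \<subseteq> (\<Union>n. {x\<in>space M. 1 < fr n x * u x})"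
        proof
          fix x assume x: "x \<in> {x\<in>space M. ennreal l < f x * ennreal (u x)}"
          (* Once n k u > l, truncation at n k no longer affects whether f u exceeds l. *)
          obtain n :: nat where n: "l / (k x * u x) < real n" using reals_Archimedean2 by blast
          then have n': "l < real n * k x * u x" using k(1)[of x] pos[of x] by (simp add: field_simps)
          have "min (f x) (ennreal (real n * k x)) < \<infinity>" by (simp add: min_less_iff_disj)
          then have e: "ennreal (l * fr n x) = min (f x) (ennreal (real n * k x))" using l by (simp add: fr_def less_top)
          have "ennreal l < ennreal (l * fr n x) * ennreal (u x)"
          proof (cases "f x \<le> ennreal (real n * k x)")
            case True then show ?thesis using x unfolding e by (simp add: min_absorb1)
          next
            case False then show ?thesis using n' k(1)[of x] pos[of x] l unfolding e
              by (simp add: min_absorb2 ennreal_mult'[symmetric] ennreal_less_iff)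
          qed
          then have "l < l * fr n x * u x" using l fr0[of n x] pos[of x] by (simp add: ennreal_mult'[symmetric] ennreal_less_iff)
          then have "1 < fr n x * u x" using l by (simp add: mult.assoc)
          then show "x \<in> (\<Union>n. {x\<in>space M. 1 < fr n x * u x})" using x by auto
        qed
      qed measurable
      also have "\<dots> = (SUP n. emeasure M {x\<in>space M. 1 < fr n x * u x})"
      proof (rule SUP_emeasure_incseq[symmetric])
        show "incseq (\<lambda>n. {x\<in>space M. 1 < fr n x * u x})"
        proof (rule incseq_SucI)
          fix n
          have "fr n x \<le> fr (Suc n) x" for x
          proof -
            have "ennreal (real n * k x) \<le> ennreal (real (Suc n) * k x)" using k(1)[of x] by (intro ennreal_leI mult_right_mono) auto
            then have "min (f x) (ennreal (real n * k x)) \<le> min (f x) (ennreal (real (Suc n) * k x))" by (intro min.mono) auto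
            moreover have "min (f x) (ennreal (real (Suc n) * k x)) < top" by (simp add: min_less_iff_disj)
            ultimately show ?thesis unfolding fr_def using l by (intro divide_right_mono enn2real_mono) auto
          qed
          then have "fr n x * u x \<le> fr (Suc n) x * u x" for x using pos[of x] by (intro mult_right_mono) auto
          then show "{x\<in>space M. 1 < fr n x * u x} \<subseteq> {x\<in>space M. 1 < fr (Suc n) x * u x}" by (auto intro: less_le_trans)
        qed
      qed auto
      also have "\<dots> \<le> ennreal C * J" by (rule SUP_least) (rule bound)
      also have "J = modular p1 p2 M (\<lambda>x. enn2real (g x * ennreal (u x)) / l)"
        using pos by (simp add: J_def \<Phi>_def gr_def modular_def enn2real_mult less_imp_le)
      finally show "emeasure M {x\<in>space M. ennreal l < f x * ennreal (u x)} \<le> ennreal C *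
           modular p1 p2 M (\<lambda>x. enn2real (g x * ennreal (u x)) / l)" .
    qed
  qed
qed

text \<open>
  Lowering \<alpha> by self-improvement leaves room to decrease p from p_X to p1, since both
  exponents of the condition may be increased again. Applied to 1 / u, self-improvement lowers
  \<beta> instead and leaves room to increase q_X to p2. The value p0 is avoided because the
  construction of the multipliers divides by p - p0.
\<close>

lemma nearby_exponents:
  fixes u :: "'a \<Rightarrow> real" and pX qX p0 a :: real and b :: ereal
  assumes B: "is_basis M \<B>" and incl: "A_infty M \<B> \<subseteq> (\<Union>s\<in>{1<..}. RH_class M \<B> s)"
    and [measurable]: "u \<in> borel_measurable M" and pos: "\<And>x. 0 < u x"
    and a: "0 < a" "a < pX" "pX \<le> qX" and b: "ereal qX < b"
    and D: "0 < D" "bump M \<B> (1 / a - 1 / pX) (1 / pX - inv_exponent b) u D"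
    and E: "0 < E" "bump M \<B> (1 / a - 1 / qX) (1 / qX - inv_exponent b) u E"
  obtains p1 p2 D1 D2 :: real where "a < p1" "p1 < pX" "qX < p2" "ereal p2 < b" "p1 \<noteq> p0" "p2 \<noteq> p0" "0 < D1" "0 < D2"
    "bump M \<B> (1 / a - 1 / p1) (1 / p1 - inv_exponent b) u D1"
    "bump M \<B> (1 / a - 1 / p2) (1 / p2 - inv_exponent b) u D2"
proof -
  define ib where "ib = inv_exponent b"
  have "ereal pX \<le> ereal qX" using a by simp
  then have bX: "ereal pX < b" using b by (rule le_less_trans)
  have pp: "0 < pX" "0 < qX" using a by auto
  have ib: "0 \<le> ib" "ib < 1 / qX" "ib < 1 / pX"
    using inv_exponent_bounds[of qX b] inv_exponent_bounds[of pX b] b bX pp by (auto simp: ib_def less_imp_le)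
  define \<alpha> where "\<alpha> = 1 / a - 1 / pX"
  define \<beta> where "\<beta> = 1 / pX - ib"
  define \<alpha>' where "\<alpha>' = 1 / a - 1 / qX"
  define \<beta>' where "\<beta>' = 1 / qX - ib"
  have pos': "0 < \<alpha>" "0 < \<beta>" "0 < \<alpha>'" "0 < \<beta>'"
    using a ib by (auto simp: \<alpha>_def \<beta>_def \<alpha>'_def \<beta>'_def divide_strict_left_mono)
  have avoid: "\<exists>p. l < p \<and> p < r \<and> p \<noteq> p0" if lr: "l < r" for l r :: real
  proof -
    obtain p where p: "l < p" "p < r" using dense[OF lr] by blast
    obtain p' where "l < p'" "p' < p" using dense[OF p(1)] by blast
    then show ?thesis using p by (metis less_irrefl less_trans)
  qed
  obtain s1 D1 where s1: "1 < s1" "0 < D1" "bump M \<B> (\<alpha> / s1) \<beta> u D1"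
    using bump_self_improvement[OF B incl _ pos pos'(1,2) D(1) D(2)[folded ib_def, folded \<alpha>_def \<beta>_def]] by auto
  have "\<alpha> / s1 < \<alpha>" using s1 pos' by (simp add: divide_less_eq)
  (* 1/a - 1/P is the improved exponent; every p1 between P and p_X will do. *)
  define P where "P = 1 / (1 / a - \<alpha> / s1)"
  have d: "1 / pX < 1 / a - \<alpha> / s1" "1 / a - \<alpha> / s1 < 1 / a" using \<open>\<alpha> / s1 < \<alpha>\<close> s1 pos' by (auto simp: \<alpha>_def)
  then have dp: "0 < 1 / a - \<alpha> / s1" using pp by (meson less_trans zero_less_divide_1_iff)
  have P: "a < P" "P < pX" using d dp a pp unfolding P_def by (auto simp: field_simps)
  obtain p1 where p1: "P < p1" "p1 < pX" "p1 \<noteq> p0" using avoid[OF P(2)] by blast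
  have p1': "0 < p1" "1 / p1 \<le> 1 / a - \<alpha> / s1" "1 / pX \<le> 1 / p1"
  proof -
    show "0 < p1" using p1 P a by simp
    have "1 / p1 \<le> 1 / P" using p1 P a by (intro frac_le) auto
    then show "1 / p1 \<le> 1 / a - \<alpha> / s1" by (simp add: P_def)
    show "1 / pX \<le> 1 / p1" using p1 P a by (intro frac_le) auto
  qed
  have b1: "bump M \<B> (1 / a - 1 / p1) (1 / p1 - ib) u D1"
    by (rule bump_mono_exponent[OF B _ pos s1(2) _ _ _ _ s1(3)]) (use p1' s1 pos' in \<open>auto simp: \<beta>_def\<close>)
  have inv: "bump M \<B> \<beta>' \<alpha>' (\<lambda>x. 1 / u x) E" using bump_inverse[OF E(2,1)] by (simp add: \<alpha>'_def \<beta>'_def ib_def)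
  have posi: "0 < 1 / u x" for x using pos by simp
  obtain s2 D2 where s2: "1 < s2" "0 < D2" "bump M \<B> (\<beta>' / s2) \<alpha>' (\<lambda>x. 1 / u x) D2"
    using bump_self_improvement[OF B incl _ posi pos'(4,3) E(1) inv] by auto
  have b2': "bump M \<B> \<alpha>' (\<beta>' / s2) u D2" using bump_inverse[OF s2(3,2)] by simp
  have "\<beta>' / s2 < \<beta>'" using s2 pos' by (simp add: divide_less_eq)
  then have d2: "ib + \<beta>' / s2 < 1 / qX" by (simp add: \<beta>'_def)
  have dp2: "0 < ib + \<beta>' / s2" using ib pos' s2 by (simp add: add_nonneg_pos)
  (* Here 1/Q - 1/b is the improved exponent. *)
  define Q where "Q = 1 / (ib + \<beta>' / s2)"
  have Q: "qX < Q" using d2 dp2 pp unfolding Q_def by (simp add: field_simps)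
  obtain p2 where p2: "qX < p2" "p2 < Q" "p2 \<noteq> p0" using avoid[OF Q] by blast
  have p2': "0 < p2" "ib + \<beta>' / s2 \<le> 1 / p2" "1 / p2 \<le> 1 / qX"
  proof -
    show "0 < p2" using p2 pp by simp
    have "1 / Q \<le> 1 / p2" using p2 pp by (intro frac_le) auto
    then show "ib + \<beta>' / s2 \<le> 1 / p2" by (simp add: Q_def)
    show "1 / p2 \<le> 1 / qX" using p2 pp by (intro frac_le) auto
  qed
  have b2: "bump M \<B> (1 / a - 1 / p2) (1 / p2 - ib) u D2"
    by (rule bump_mono_exponent[OF B _ pos s2(2) _ _ _ _ b2']) (use p2' s2 pos' in \<open>auto simp: \<alpha>'_def\<close>)
  have "ib < 1 / p2" using p2'(2) pos'(4) s2(1) by (smt (verit) divide_pos_pos)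
  then have "ereal p2 < b" using p2'(1) b pp
    by (cases b) (auto simp: ib_def inv_exponent_def divide_less_eq_1 less_divide_eq_1 divide_less_eq less_divide_eq split: if_splits)
  moreover have "a < p1" using P p1 by simp
  ultimately show ?thesis using that p1 p2 s1 s2 b1 b2 unfolding ib_def by blast
qed

section \<open>Function norms, rearrangements and dilations\<close>

lemma function_norm_mono:
  assumes "function_norm M N" "f \<in> borel_measurable M" "g \<in> borel_measurable M" "AE x in M. f x \<le> g x"
  shows "N f \<le> N g"
  using assms unfolding function_norm_def by blast

lemma function_norm_cmult:
  assumes "function_norm M N" "f \<in> borel_measurable M" "0 \<le> c"
  shows "N (\<lambda>x. ennreal c * f x) = ennreal c * N f"
  using assms unfolding function_norm_def by blast

lemma function_norm_add:
  assumes "function_norm M N" "f \<in> borel_measurable M" "g \<in> borel_measurable M"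
  shows "N (\<lambda>x. f x + g x) \<le> N f + N g"
  using assms unfolding function_norm_def by blast

lemma function_norm_zero:
  assumes "function_norm M N" "f \<in> borel_measurable M"
  shows "N f = 0 \<longleftrightarrow> (AE x in M. f x = 0)"
  using assms unfolding function_norm_def by blast

lemma function_norm_SUP:
  fixes F :: "nat \<Rightarrow> 'a \<Rightarrow> ennreal"
  assumes "function_norm M N" "f \<in> borel_measurable M" "\<And>j. F j \<in> borel_measurable M"
    and "AE x in M. incseq (\<lambda>j. F j x) \<and> (SUP j. F j x) = f x"
  shows "(SUP j. N (F j)) = N f"
  using assms unfolding function_norm_def by blast

text \<open>
  Countable subadditivity: the finite sums increase to the series, so this is the Fatou property.
\<close>

lemma function_norm_suminf:
  fixes f :: "nat \<Rightarrow> 'a \<Rightarrow> ennreal"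
  assumes N: "function_norm M N" and [measurable]: "\<And>n. f n \<in> borel_measurable M"
  shows "N (\<lambda>x. \<Sum>n. f n x) \<le> (\<Sum>n. N (f n))"
proof -
  have part: "N (\<lambda>x. \<Sum>i<j. f i x) \<le> (\<Sum>i<j. N (f i))" for j
  proof (induction j)
    case 0
    then show ?case using function_norm_zero[OF N, of "\<lambda>_. 0"] by simp
  next
    case (Suc j)
    have "N (\<lambda>x. (\<Sum>i<j. f i x) + f j x) \<le> N (\<lambda>x. \<Sum>i<j. f i x) + N (f j)"
      by (rule function_norm_add[OF N]) measurable
    also have "\<dots> \<le> (\<Sum>i<j. N (f i)) + N (f j)" by (intro add_right_mono Suc)
    finally show ?case by simp
  qed
  have "N (\<lambda>x. \<Sum>n. f n x) = (SUP j. N (\<lambda>x. \<Sum>i<j. f i x))"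
  proof (rule function_norm_SUP[OF N, symmetric])
    show "AE x in M. incseq (\<lambda>j. \<Sum>i<j. f i x) \<and> (SUP j. \<Sum>i<j. f i x) = (\<Sum>n. f n x)"
      by (intro AE_I2 conjI incseq_SucI) (auto simp: suminf_eq_SUP)
  qed measurable
  also have "\<dots> \<le> (\<Sum>n. N (f n))"
    by (intro SUP_least order_trans[OF part] sum_le_suminf) auto
  finally show ?thesis .
qed

text \<open>
  The carrier of \<open>halfline m\<close>, named so that level sets of rearrangements, which have
  the same form, can be written as intersections of such sets.
\<close>

definition half :: "ennreal \<Rightarrow> real set" where
  "half m = {t. 0 \<le> t \<and> ennreal t < m}"

lemma half_top: "half \<infinity> = {0..}"
  by (auto simp: half_def)

lemma half_ennreal: "0 \<le> r \<Longrightarrow> half (ennreal r) = {0..<r}"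
  by (auto simp: half_def ennreal_less_iff)

lemma half_lebesgue [measurable, simp]: "half m \<in> sets lebesgue"
  by (cases m) (auto simp: half_ennreal half_top[simplified])

lemma emeasure_half: "emeasure lebesgue (half m) = m"
proof (cases m)
  case (real r)
  then show ?thesis by (simp add: half_ennreal)
next
  case top
  have "ennreal (real n) \<le> emeasure lebesgue {0::real..}" for n :: nat
  proof -
    have "ennreal (real n) = emeasure lebesgue {0..real n}" by simp
    also have "\<dots> \<le> emeasure lebesgue {0::real..}" by (intro emeasure_mono) auto
    finally show ?thesis .
  qed
  note le = this
  have "emeasure lebesgue {0::real..} = top"
  proof (rule ccontr)
    assume "emeasure lebesgue {0::real..} \<noteq> top"
    then obtain r where r: "emeasure lebesgue {0::real..} = ennreal r" "0 \<le> r"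
      by (cases "emeasure lebesgue {0::real..}") auto
    obtain n :: nat where "r < real n" using reals_Archimedean2 by blast
    then show False using le[of n] r by simp
  qed
  then show ?thesis using top by (simp add: half_top[simplified])
qed

lemma half_mono: "a \<le> b \<Longrightarrow> half a \<subseteq> half b"
  by (auto simp: half_def)

lemma half_Int: "half a \<inter> half b = half (min a b)"
  by (auto simp: half_def)

lemma space_halfline [simp]: "space (halfline m) = half m"
  by (simp add: halfline_def half_def)

lemma sets_halfline: "A \<in> sets (halfline m) \<longleftrightarrow> A \<subseteq> half m \<and> A \<in> sets lebesgue"
  unfolding halfline_def half_def[symmetric] by (subst sets_restrict_space_iff) auto

lemma emeasure_halfline: "A \<subseteq> half m \<Longrightarrow> emeasure (halfline m) A = emeasure lebesgue A"
  unfolding halfline_def half_def[symmetric] by (subst emeasure_restrict_space) auto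

lemma halfline_level_set:
  fixes f :: "real \<Rightarrow> ennreal"
  assumes "f \<in> borel_measurable (halfline m)"
  shows "{x \<in> half m. y < f x} \<in> sets lebesgue"
  using borel_measurable_less[of "\<lambda>_. y" "halfline m" f] assms by (simp add: sets_halfline)

lemma borel_measurable_halflineI:
  fixes f :: "real \<Rightarrow> ennreal"
  assumes "\<And>y. {x \<in> half m. y < f x} \<in> sets lebesgue"
  shows "f \<in> borel_measurable (halfline m)"
  by (rule borel_measurableI_greater) (use assms in \<open>auto simp: sets_halfline\<close>)

lemma distribution_halfline:
  "distribution_function (halfline m) f y = emeasure lebesgue {x \<in> half m. y < f x}"
  unfolding distribution_function_def by (simp add: emeasure_halfline Collect_conj_eq)

lemma distribution_antimono:
  assumes "f \<in> borel_measurable M" "s \<le> t"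
  shows "distribution_function M f t \<le> distribution_function M f s"
  unfolding distribution_function_def
  by (rule emeasure_mono) (use assms in \<open>auto intro: le_less_trans\<close>)

text \<open>
  The infimum in the definition of the rearrangement is attained, because the distribution function
  is continuous from the right. Every fact about rearrangements below is read off from this
  equivalence.
\<close>

lemma less_rearrangement_iff:
  fixes f :: "'a \<Rightarrow> ennreal"
  assumes [measurable]: "f \<in> borel_measurable M"
  shows "s < decreasing_rearrangement M f t \<longleftrightarrow> ennreal t < distribution_function M f s"
proof
  assume "s < decreasing_rearrangement M f t"
  then show "ennreal t < distribution_function M f s"
    unfolding decreasing_rearrangement_def by (metis (mono_tags, lifting) Inf_lower leD mem_Collect_eq not_less)
next
  assume lt: "ennreal t < distribution_function M f s"
  have "s \<noteq> \<infinity>"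
  proof
    assume "s = \<infinity>"
    then have "distribution_function M f s = 0" by (simp add: distribution_function_def)
    then show False using lt by simp
  qed
  then obtain r where r: "s = ennreal r" "0 \<le> r" by (cases s) auto
  define A where "A n = {x\<in>space M. ennreal (r + 1 / real (Suc n)) < f x}" for n
  have "{x\<in>space M. s < f x} = (\<Union>n. A n)"
  proof
    show "{x\<in>space M. s < f x} \<subseteq> (\<Union>n. A n)"
    proof
      fix x assume x: "x \<in> {x\<in>space M. s < f x}"
      show "x \<in> (\<Union>n. A n)"
      proof (cases "f x")
        case (real v)
        then have "r < v" using x r by (simp add: ennreal_less_iff)
        then obtain n where "1 / real (Suc n) < v - r" using nat_approx_posE[of "v - r"] by (metis diff_gt_0_iff_gt of_nat_Suc)
        then have "ennreal (r + 1 / real (Suc n)) < f x" using real r by (simp add: ennreal_less_iff del: ennreal_plus)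
        then show ?thesis using x by (auto simp: A_def)
      next
        case top
        then show ?thesis using x by (auto simp: A_def)
      qed
    qed
    have "s \<le> ennreal (r + 1 / real (Suc n))" for n using r by (auto intro!: ennreal_leI)
    then show "(\<Union>n. A n) \<subseteq> {x\<in>space M. s < f x}" by (auto simp: A_def intro: le_less_trans)
  qed
  moreover have "incseq A"
  proof (rule incseq_SucI)
    fix n
    have "ennreal (r + 1 / real (Suc (Suc n))) \<le> ennreal (r + 1 / real (Suc n))"
      by (intro ennreal_leI add_left_mono frac_le) auto
    then show "A n \<subseteq> A (Suc n)" by (auto simp: A_def intro: le_less_trans)
  qed
  ultimately have "distribution_function M f s = (SUP n. emeasure M (A n))"
    unfolding distribution_function_def by (subst SUP_emeasure_incseq) (auto simp: A_def)
  then obtain n where n: "ennreal t < emeasure M (A n)" using lt by (auto simp: less_SUP_iff)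
  have "ennreal (r + 1 / real (Suc n)) \<le> decreasing_rearrangement M f t"
    unfolding decreasing_rearrangement_def
  proof (rule Inf_greatest)
    fix s' assume "s' \<in> {s. distribution_function M f s \<le> ennreal t}"
    then have "distribution_function M f s' < distribution_function M f (ennreal (r + 1 / real (Suc n)))"
      using n by (auto simp: distribution_function_def A_def)
    then show "ennreal (r + 1 / real (Suc n)) \<le> s'"
      using distribution_antimono[OF assms, of s' "ennreal (r + 1 / real (Suc n))"] by (meson leD le_cases)
  qed
  moreover have "s < ennreal (r + 1 / real (Suc n))" using r by (simp add: ennreal_less_iff)
  ultimately show "s < decreasing_rearrangement M f t" by (rule less_le_trans[rotated])
qed

lemma rearrangement_antimono:
  "s \<le> t \<Longrightarrow> decreasing_rearrangement M f t \<le> decreasing_rearrangement M f s"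
  unfolding decreasing_rearrangement_def by (intro Inf_superset_mono) (auto intro: order_trans ennreal_leI)

lemma rearrangement_level_set:
  assumes f: "f \<in> borel_measurable M"
  shows "{x \<in> half m. y < decreasing_rearrangement M f x} = half (min m (distribution_function M f y))"
  using less_rearrangement_iff[OF f] by (auto simp: half_def)

lemma rearrangement_measurable [measurable]:
  assumes f: "f \<in> borel_measurable M"
  shows "decreasing_rearrangement M f \<in> borel_measurable (halfline m)"
  by (rule borel_measurable_halflineI) (simp add: rearrangement_level_set[OF f])

lemma distribution_le_space: "distribution_function M f y \<le> emeasure M (space M)"
  unfolding distribution_function_def by (rule emeasure_mono) auto

lemma distribution_rearrangement:
  assumes f: "f \<in> borel_measurable M"
  shows "distribution_function (halfline (emeasure M (space M))) (decreasing_rearrangement M f) = distribution_function M f"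
  by (rule ext) (simp add: distribution_halfline rearrangement_level_set[OF f] emeasure_half min_absorb2 distribution_le_space)

lemma emeasure_space_halfline: "emeasure (halfline m) (space (halfline m)) = m"
  by (simp add: emeasure_halfline emeasure_half)

lemma norm_rearrangement:
  assumes N: "rearrangement_invariant (halfline m) N" and f: "f \<in> borel_measurable (halfline m)"
  shows "N (decreasing_rearrangement (halfline m) f) = N f"
  using N rearrangement_measurable[OF f] f distribution_rearrangement[OF f]
  unfolding rearrangement_invariant_def emeasure_space_halfline by blast

text \<open>
  Pass to the rearrangements, which are ordered pointwise.
\<close>

lemma norm_le_of_distribution_le:
  assumes fn: "function_norm (halfline m) N" and ri: "rearrangement_invariant (halfline m) N"
    and fg: "f \<in> borel_measurable (halfline m)" "g \<in> borel_measurable (halfline m)"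
    and le: "\<And>y. distribution_function (halfline m) f y \<le> distribution_function (halfline m) g y"
  shows "N f \<le> N g"
proof -
  have "decreasing_rearrangement (halfline m) f t \<le> decreasing_rearrangement (halfline m) g t" for t
    unfolding decreasing_rearrangement_def by (intro Inf_superset_mono) (auto intro: order_trans[OF le])
  then have "N (decreasing_rearrangement (halfline m) f) \<le> N (decreasing_rearrangement (halfline m) g)"
    by (intro function_norm_mono[OF fn] rearrangement_measurable fg) auto
  then show ?thesis by (simp add: norm_rearrangement[OF ri] fg)
qed

lemma rearrangement_zero_beyond:
  assumes f: "f \<in> borel_measurable M" and t: "emeasure M (space M) \<le> ennreal t"
  shows "decreasing_rearrangement M f t = 0"
proof -
  have "\<not> 0 < decreasing_rearrangement M f t"
    unfolding less_rearrangement_iff[OF f] using distribution_le_space[of M f 0] t by (simp add: not_less)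
  then show ?thesis by simp
qed

lemma lebesgue_affine_image:
  fixes S :: "real set"
  assumes c: "0 < c" and S: "S \<in> sets lebesgue"
  shows "(\<lambda>x. c * x + d) ` S \<in> sets lebesgue" "emeasure lebesgue ((\<lambda>x. c * x + d) ` S) = ennreal c * emeasure lebesgue S"
proof -
  have "(*\<^sub>R) (1 / c) -` S \<inter> space lebesgue \<in> sets lebesgue"
    using measurable_sets[OF lebesgue_measurable_scaling S] by simp
  moreover have "(*\<^sub>R) (1 / c) -` S \<inter> space lebesgue = (\<lambda>x. c * x) ` S"
    using c by (auto simp: image_iff) (metis mult.commute nonzero_divide_eq_eq less_irrefl)
  ultimately have "(\<lambda>x. d + x) ` (\<lambda>x. c * x) ` S \<in> sets lebesgue"
    by (intro lebesgue_sets_translation) simp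
  then show "(\<lambda>x. c * x + d) ` S \<in> sets lebesgue" by (simp add: image_image add.commute)
  show "emeasure lebesgue ((\<lambda>x. c * x + d) ` S) = ennreal c * emeasure lebesgue S"
    using emeasure_lebesgue_affine[of c d S] c by simp
qed

lemma ennreal_scale_less_iff:
  assumes t: "0 < t" and s: "0 \<le> s"
  shows "ennreal s < m * ennreal t \<longleftrightarrow> ennreal (s / t) < m"
proof (cases m)
  case (real r)
  then show ?thesis using assms by (simp add: ennreal_mult[symmetric] ennreal_less_iff field_simps)
next
  case top
  then show ?thesis using assms by (simp add: ennreal_top_mult)
qed

text \<open>
  The intersection accounts for the part of f that dilation moves out of [0, m) when t > 1 and m is
  finite.
\<close>

lemma dilation_level_set:
  assumes t: "0 < t"
  shows "{s \<in> half m. y < dilation m t f s} = (\<lambda>x. t * x + 0) ` ({x \<in> half m. y < f x} \<inter> half (m * ennreal (1 / t)))"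
proof (intro subset_antisym subsetI)
  fix s assume s: "s \<in> {s \<in> half m. y < dilation m t f s}"
  then have s': "0 \<le> s" "ennreal s < m * min 1 (ennreal t)" "y < f (s / t)" "ennreal s < m"
    by (auto simp: dilation_def half_def split: if_splits)
  have "ennreal s < m * ennreal t" using s'(2) by (rule less_le_trans) (auto intro: mult_left_mono)
  then have "ennreal (s / t) < m" using t s' by (simp add: ennreal_scale_less_iff)
  moreover have "ennreal (s / t) < m * ennreal (1 / t)" using s' t by (subst ennreal_scale_less_iff) auto
  ultimately show "s \<in> (\<lambda>x. t * x + 0) ` ({x \<in> half m. y < f x} \<inter> half (m * ennreal (1 / t)))"
    using s' t by (intro image_eqI[of _ _ "s / t"]) (auto simp: half_def)
next
  fix s assume "s \<in> (\<lambda>x. t * x + 0) ` ({x \<in> half m. y < f x} \<inter> half (m * ennreal (1 / t)))"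
  then obtain x where x: "s = t * x" "0 \<le> x" "ennreal x < m" "y < f x" "ennreal x < m * ennreal (1 / t)"
    by (auto simp: half_def)
  have 1: "ennreal s < m" using x t ennreal_scale_less_iff[of "1/t" x m] by (simp add: mult.commute)
  have 2: "ennreal s < m * ennreal t" using x t ennreal_scale_less_iff[of t s m] by simp
  have "ennreal s < m * min 1 (ennreal t)" using 1 2 by (auto simp: min_def)
  then show "s \<in> {s \<in> half m. y < dilation m t f s}" using x t 1 by (simp add: dilation_def half_def)
qed

lemma dilation_measurable [measurable]:
  assumes t: "0 < t" and f: "f \<in> borel_measurable (halfline m)"
  shows "dilation m t f \<in> borel_measurable (halfline m)"
proof (rule borel_measurable_halflineI)
  fix y
  show "{x \<in> half m. y < dilation m t f x} \<in> sets lebesgue"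
    unfolding dilation_level_set[OF t]
    by (rule lebesgue_affine_image(1)[OF t]) (use halfline_level_set[OF f] in auto)
qed

lemma distribution_dilation:
  assumes t: "0 < t" and f: "f \<in> borel_measurable (halfline m)"
  shows "distribution_function (halfline m) (dilation m t f) y
    = ennreal t * emeasure lebesgue ({x \<in> half m. y < f x} \<inter> half (m * ennreal (1 / t)))"
  unfolding distribution_halfline dilation_level_set[OF t]
  by (rule lebesgue_affine_image(2)[OF t]) (use halfline_level_set[OF f] in auto)

locale ri_norm =
  fixes m :: ennreal and N :: "(real \<Rightarrow> ennreal) \<Rightarrow> ennreal"
  assumes fn: "function_norm (halfline m) N" and ri: "rearrangement_invariant (halfline m) N" and m: "0 < m"
begin

abbreviation "star \<equiv> decreasing_rearrangement (halfline m)"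
abbreviation "dn \<equiv> dilation_norm m N"

text \<open>
  For t > 1 and finite m, dilation discards the values of f far from the origin. Rearranging moves
  the large values towards the origin, where they are kept. Hence only decreasing functions matter
  for the norm of a dilation.
\<close>

lemma dilation_star:
  assumes t: "0 < t" and f: "f \<in> borel_measurable (halfline m)"
  shows "N (dilation m t f) \<le> N (dilation m t (star f))"
proof (rule norm_le_of_distribution_le[OF fn ri])
  fix y
  let ?A = "{x \<in> half m. y < f x}" and ?k = "m * ennreal (1 / t)"
  have A: "?A \<in> sets lebesgue" by (rule halfline_level_set[OF f])
  have "emeasure lebesgue (?A \<inter> half ?k) \<le> min (emeasure lebesgue ?A) (emeasure lebesgue (half ?k))"
    by (intro min.boundedI emeasure_mono) (use A in auto)
  also have "\<dots> = emeasure lebesgue ({x \<in> half m. y < star f x} \<inter> half ?k)"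
  proof -
    have "emeasure lebesgue ?A \<le> emeasure lebesgue (half m)" by (rule emeasure_mono) auto
    then show ?thesis
      unfolding rearrangement_level_set[OF f] half_Int emeasure_half distribution_halfline by (simp add: min_absorb2)
  qed
  finally show "distribution_function (halfline m) (dilation m t f) y \<le> distribution_function (halfline m) (dilation m t (star f)) y"
    unfolding distribution_dilation[OF t f] distribution_dilation[OF t rearrangement_measurable[OF f]]
    by (rule mult_left_mono) simp
qed (use t f in measurable)

lemma dilation_le_dn:
  assumes "f \<in> borel_measurable (halfline m)" "N f \<le> 1"
  shows "N (dilation m t f) \<le> dn t"
  unfolding dilation_norm_def using assms by (intro SUP_upper) auto

text \<open>
  For decreasing functions the dilation increases with t pointwise; the general case reduces to this
  by \<open>dilation_star\<close>.
\<close>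

lemma dn_mono:
  assumes t: "0 < t" "t \<le> t'"
  shows "dn t \<le> dn t'"
  unfolding dilation_norm_def[of m N t]
proof (rule SUP_least)
  fix f assume "f \<in> {f \<in> borel_measurable (halfline m). N f \<le> 1}"
  then have f: "f \<in> borel_measurable (halfline m)" "N f \<le> 1" by auto
  note s = rearrangement_measurable[OF f(1), of m]
  have "N (dilation m t f) \<le> N (dilation m t (star f))" by (rule dilation_star[OF t(1) f(1)])
  also have "\<dots> \<le> N (dilation m t' (star f))"
  proof (rule function_norm_mono[OF fn])
    have "dilation m t (star f) x \<le> dilation m t' (star f) x" if "x \<in> half m" for x
    proof -
      have "m * min 1 (ennreal t) \<le> m * min 1 (ennreal t')" using t by (intro mult_left_mono min.mono ennreal_leI) auto
      moreover have "star f (x / t) \<le> star f (x / t')" using t that by (intro rearrangement_antimono frac_le) (auto simp: half_def)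
      ultimately show ?thesis by (auto simp: dilation_def intro: less_le_trans)
    qed
    then show "AE x in halfline m. dilation m t (star f) x \<le> dilation m t' (star f) x" by (intro AE_I2) simp
  qed (use t s in \<open>auto intro: dilation_measurable\<close>)
  also have "\<dots> \<le> dn t'" by (rule dilation_le_dn[OF s]) (simp add: norm_rearrangement[OF ri f(1)] f)
  finally show "N (dilation m t f) \<le> dn t'" .
qed

lemma dilation_cmult: "dilation m t (\<lambda>x. c * f x) = (\<lambda>x. c * dilation m t f x)"
  by (auto simp: dilation_def)

text \<open>
  If N f = 0, normalisation is impossible; all multiples of f then lie in the unit ball, and
  finiteness of the dilation norm forces the dilation to have norm 0.
\<close>

lemma norm_dilation_le:
  assumes t: "0 < t" and f: "f \<in> borel_measurable (halfline m)" "N f < \<infinity>" and d: "dn t < \<infinity>"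
  shows "N (dilation m t f) \<le> dn t * N f"
proof (cases "N f = 0")
  case False
  obtain r where r: "N f = ennreal r" "0 < r" using f False by (cases "N f") (auto simp: less_le)
  have "N (\<lambda>x. ennreal (1 / r) * f x) = ennreal (1 / r) * N f" by (rule function_norm_cmult[OF fn f(1)]) (use r in auto)
  also have "\<dots> = 1" using r by (simp add: ennreal_mult[symmetric])
  finally have "N (dilation m t (\<lambda>x. ennreal (1 / r) * f x)) \<le> dn t"
    by (intro dilation_le_dn) (use f in auto)
  then have "ennreal (1 / r) * N (dilation m t f) \<le> dn t"
    unfolding dilation_cmult using function_norm_cmult[OF fn dilation_measurable[OF t f(1)], of "1 / r"] r by simp
  then have "ennreal r * (ennreal (1 / r) * N (dilation m t f)) \<le> ennreal r * dn t" by (rule mult_left_mono) simp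
  moreover have "ennreal r * (ennreal (1 / r) * N (dilation m t f)) = N (dilation m t f)"
    using r by (simp add: mult.assoc[symmetric] ennreal_mult[symmetric])
  ultimately show ?thesis using r by (simp add: mult.commute)
next
  case True
  have le: "ennreal (real n) * N (dilation m t f) \<le> dn t" for n :: nat
  proof -
    have "N (\<lambda>x. ennreal (real n) * f x) = 0" using function_norm_cmult[OF fn f(1), of "real n"] True by simp
    then have "N (dilation m t (\<lambda>x. ennreal (real n) * f x)) \<le> dn t"
      by (intro dilation_le_dn) (use f in auto)
    then show ?thesis
      unfolding dilation_cmult using function_norm_cmult[OF fn dilation_measurable[OF t f(1)], of "real n"] by simp
  qed
  obtain D where D: "dn t = ennreal D" "0 \<le> D" using d by (cases "dn t") auto
  have "N (dilation m t f) \<noteq> \<infinity>" using le[of 1] D by (auto simp: top_unique)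
  then obtain x where x: "N (dilation m t f) = ennreal x" "0 \<le> x" by (cases "N (dilation m t f)") auto
  have "real n * x \<le> D" for n using le[of n] x D by (simp add: ennreal_mult[symmetric])
  then have "x \<le> 0" using reals_Archimedean3[of x] D by (meson not_le)
  then show ?thesis using x by simp
qed

text \<open>
  For t and s on different sides of 1 the identity may fail when m is finite: the inner dilation may
  discard values that the composite one keeps.
\<close>

lemma dilation_dilation:
  assumes t: "1 \<le> t \<and> 1 \<le> s \<or> 0 < t \<and> t \<le> 1 \<and> 0 < s \<and> s \<le> 1" and x: "x \<in> half m"
  shows "dilation m t (dilation m s f) x = dilation m (t * s) f x"
  using t
proof
  assume ts: "1 \<le> t \<and> 1 \<le> s"
  then have "1 \<le> t * s" using mult_mono[of 1 t 1 s] by simp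
  then have min: "min 1 (ennreal t) = 1" "min 1 (ennreal s) = 1" "min 1 (ennreal (t * s)) = 1"
    using ts by (auto simp: min_absorb1)
  have "ennreal (x / t) \<le> ennreal x" using ts x by (intro ennreal_leI) (auto simp: half_def divide_le_eq mult_le_cancel_left1)
  then have "ennreal (x / t) < m" by (rule le_less_trans) (use x in \<open>simp add: half_def\<close>)
  then show ?thesis using x by (simp add: dilation_def min half_def divide_divide_eq_left)
next
  assume ts: "0 < t \<and> t \<le> 1 \<and> 0 < s \<and> s \<le> 1"
  then have "t * s \<le> 1" "t * s \<le> t" by (auto simp: mult_le_one mult_le_cancel_left1)
  then have min: "min 1 (ennreal t) = ennreal t" "min 1 (ennreal s) = ennreal s" "min 1 (ennreal (t * s)) = ennreal (t * s)"
    using ts \<open>t * s \<le> 1\<close> by (simp_all add: min_absorb2)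
  have "m * ennreal (t * s) \<le> m * ennreal t" using \<open>t * s \<le> t\<close> by (intro mult_left_mono ennreal_leI) auto
  then have sub: "ennreal x < m * ennreal t" if "ennreal x < m * ennreal (t * s)" using that by simp
  have "ennreal x < m * ennreal (t * s) \<longleftrightarrow> ennreal (x / (t * s)) < m"
    using ts x by (intro ennreal_scale_less_iff) (auto simp: half_def)
  also have "\<dots> \<longleftrightarrow> ennreal (x / t) < m * ennreal s"
    using ts x ennreal_scale_less_iff[of s "x / t" m] by (auto simp: half_def)
  finally show ?thesis using sub by (auto simp: dilation_def min)
qed

lemma dn_submult:
  assumes ts: "1 \<le> t \<and> 1 \<le> s \<or> 0 < t \<and> t \<le> 1 \<and> 0 < s \<and> s \<le> 1" and fin: "dn t < \<infinity>" "dn s < \<infinity>"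
  shows "dn (t * s) \<le> dn t * dn s"
  unfolding dilation_norm_def[of m N "t * s"]
proof (rule SUP_least)
  fix f assume "f \<in> {f \<in> borel_measurable (halfline m). N f \<le> 1}"
  then have f: "f \<in> borel_measurable (halfline m)" "N f \<le> 1" by auto
  have pos: "0 < t" "0 < s" using ts by auto
  note ms = dilation_measurable[OF pos(2) f(1)]
  have le: "N (dilation m s f) \<le> dn s" by (rule dilation_le_dn[OF f])
  have "N (dilation m (t * s) f) \<le> N (dilation m t (dilation m s f))"
  proof (rule function_norm_mono[OF fn])
    show "AE x in halfline m. dilation m (t * s) f x \<le> dilation m t (dilation m s f) x"
      by (intro AE_I2) (simp add: dilation_dilation[OF ts])
  qed (use pos f ms in \<open>auto intro: dilation_measurable\<close>)
  also have "\<dots> \<le> dn t * N (dilation m s f)"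
    by (rule norm_dilation_le[OF pos(1) ms _ fin(1)]) (use le fin in \<open>auto intro: le_less_trans\<close>)
  also have "\<dots> \<le> dn t * dn s" by (rule mult_left_mono[OF le]) simp
  finally show "N (dilation m (t * s) f) \<le> dn t * dn s" .
qed

lemma dn_one_le: "dn 1 \<le> 1"
  unfolding dilation_norm_def
proof (rule SUP_least)
  fix f assume "f \<in> {f \<in> borel_measurable (halfline m). N f \<le> 1}"
  then have f: "f \<in> borel_measurable (halfline m)" "N f \<le> 1" by auto
  have "N (dilation m 1 f) \<le> N f"
    by (rule function_norm_mono[OF fn]) (use f in \<open>auto intro: dilation_measurable AE_I2 simp: dilation_def half_def\<close>)
  then show "N (dilation m 1 f) \<le> 1" using f by simp
qed

text \<open>
  Up to the point 2 l, the dilation of f by 2 has the same distribution as f on [0, l) plus its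
  translate to [l, 2 l), and the two summands are equimeasurable.
\<close>

lemma norm_half_dilation_le:
  assumes l: "0 < l" "ennreal (2 * l) \<le> m" and f: "f \<in> borel_measurable (halfline m)"
  shows "N (\<lambda>x. if x < 2 * l then f (x / 2) else 0) \<le> 2 * N f"
proof -
  define g1 where "g1 x = (if x < l then f x else 0)" for x
  define g2 where "g2 x = (if l \<le> x \<and> x < 2 * l then f (x - l) else 0)" for x
  define h where "h x = (if x < 2 * l then f (x / 2) else 0)" for x
  have "ennreal l \<le> ennreal (2 * l)" using l by (intro ennreal_leI) auto
  then have lm: "ennreal l \<le> m" by (rule order_trans[OF _ l(2)])
  have in_m: "ennreal x < m" if "x < l" for x
    using that l lm by (metis ennreal_less_iff ennreal_neg less_le_trans linorder_not_le m not_less_iff_gr_or_eq)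
  have in_m2: "ennreal x < m" if "x < 2 * l" for x
    using that l by (metis ennreal_less_iff ennreal_neg less_le_trans linorder_not_le m not_less_iff_gr_or_eq)
  define A where "A y = {x \<in> half m. y < f x} \<inter> {0..<l}" for y
  have A: "A y \<in> sets lebesgue" for y unfolding A_def by (intro sets.Int halfline_level_set[OF f]) auto
  have L1: "{x \<in> half m. y < g1 x} = A y" for y by (auto simp: g1_def A_def half_def split: if_splits)
  have L2: "{x \<in> half m. y < g2 x} = (\<lambda>x. 1 * x + l) ` A y" for y
  proof (intro subset_antisym subsetI)
    fix x assume "x \<in> {x \<in> half m. y < g2 x}"
    then have "l \<le> x" "x < 2 * l" "y < f (x - l)" by (auto simp: g2_def split: if_splits)
    then show "x \<in> (\<lambda>x. 1 * x + l) ` A y" using in_m[of "x - l"]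
      by (intro image_eqI[of _ _ "x - l"]) (auto simp: A_def half_def)
  next
    fix x assume "x \<in> (\<lambda>x. 1 * x + l) ` A y"
    then obtain z where "x = z + l" "0 \<le> z" "z < l" "y < f z" by (auto simp: A_def)
    then show "x \<in> {x \<in> half m. y < g2 x}" using in_m2[of x] l by (auto simp: g2_def half_def)
  qed
  have Lh: "{x \<in> half m. y < h x} = (\<lambda>x. 2 * x + 0) ` A y" for y
  proof (intro subset_antisym subsetI)
    fix x assume "x \<in> {x \<in> half m. y < h x}"
    then have "0 \<le> x" "x < 2 * l" "y < f (x / 2)" by (auto simp: h_def half_def split: if_splits)
    then show "x \<in> (\<lambda>x. 2 * x + 0) ` A y" using in_m[of "x / 2"]
      by (intro image_eqI[of _ _ "x / 2"]) (auto simp: A_def half_def)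
  next
    fix x assume "x \<in> (\<lambda>x. 2 * x + 0) ` A y"
    then obtain z where "x = 2 * z" "0 \<le> z" "z < l" "y < f z" by (auto simp: A_def)
    then show "x \<in> {x \<in> half m. y < h x}" using in_m2[of x] l by (auto simp: h_def half_def)
  qed
  have m1: "g1 \<in> borel_measurable (halfline m)" by (rule borel_measurable_halflineI) (simp add: L1 A)
  have m2: "g2 \<in> borel_measurable (halfline m)"
    by (rule borel_measurable_halflineI) (unfold L2, rule lebesgue_affine_image(1), simp, rule A)
  have mh: "h \<in> borel_measurable (halfline m)"
    by (rule borel_measurable_halflineI) (unfold Lh, rule lebesgue_affine_image(1), simp, rule A)
  have d2: "distribution_function (halfline m) g2 = distribution_function (halfline m) g1"
    unfolding distribution_halfline L1 L2 lebesgue_affine_image(2)[OF zero_less_one A] by simp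
  have "{x \<in> half m. y < g1 x + g2 x} = {x \<in> half m. y < g1 x} \<union> {x \<in> half m. y < g2 x}" for y
    using l by (auto simp: g1_def g2_def split: if_splits)
  then have "distribution_function (halfline m) (\<lambda>x. g1 x + g2 x) y = emeasure lebesgue {x \<in> half m. y < g1 x} + emeasure lebesgue {x \<in> half m. y < g2 x}" for y
    unfolding distribution_halfline
    by (simp, intro plus_emeasure[symmetric] halfline_level_set m1 m2) (auto simp: g1_def g2_def split: if_splits)
  also have "\<dots> y = 2 * emeasure lebesgue (A y)" for y
    using fun_cong[OF d2, of y] unfolding distribution_halfline L1 by (simp add: mult_2)
  finally have dsum: "distribution_function (halfline m) (\<lambda>x. g1 x + g2 x) y = 2 * emeasure lebesgue (A y)" for y .
  have dh: "distribution_function (halfline m) h y = 2 * emeasure lebesgue (A y)" for y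
    unfolding distribution_halfline Lh using lebesgue_affine_image(2)[OF _ A, of 2 0] by simp
  have "N h \<le> N (\<lambda>x. g1 x + g2 x)"
    by (rule norm_le_of_distribution_le[OF fn ri mh]) (use m1 m2 in \<open>auto simp: dsum dh\<close>)
  also have "\<dots> \<le> N g1 + N g2" by (rule function_norm_add[OF fn m1 m2])
  also have "N g2 = N g1" using ri m1 m2 d2 unfolding rearrangement_invariant_def by blast
  also have "N g1 + N g1 \<le> N f + N f"
    by (intro add_mono function_norm_mono[OF fn m1 f]) (auto simp: g1_def)
  also have "\<dots> = 2 * N f" by (rule mult_2[symmetric])
  finally show ?thesis unfolding h_def .
qed

text \<open>
  For infinite m the translates are available only on bounded intervals; the Fatou property passes
  to the limit.
\<close>

lemma dn_two_le: "dn 2 \<le> 2"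
  unfolding dilation_norm_def
proof (rule SUP_least)
  fix f assume "f \<in> {f \<in> borel_measurable (halfline m). N f \<le> 1}"
  then have f: "f \<in> borel_measurable (halfline m)" "N f \<le> 1" by auto
  (* For finite m the half length m/2 can be used for every n. *)
  define l where "l n = (if m = \<infinity> then real (Suc n) else enn2real m / 2)" for n
  have l: "0 < l n" "ennreal (2 * l n) \<le> m" for n
    using m by (cases m; auto simp: l_def enn2real_positive_iff)+
  define h where "h n x = (if x < 2 * l n then f (x / 2) else 0)" for n x
  have inc: "l n \<le> l (Suc n)" for n by (simp add: l_def)
  have mh: "h n \<in> borel_measurable (halfline m)" for n
  proof (rule borel_measurable_halflineI)
    fix y
    have "{x \<in> half m. y < h n x} = {x \<in> half m. y < dilation m 2 f x} \<inter> {..<2 * l n}"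
      by (auto simp: h_def dilation_def half_def min_absorb1)
    then show "{x \<in> half m. y < h n x} \<in> sets lebesgue"
      using halfline_level_set[OF dilation_measurable[OF _ f(1), of 2]] by auto
  qed
  have "(SUP n. N (h n)) = N (dilation m 2 f)"
  proof (rule function_norm_SUP[OF fn _ mh], rule dilation_measurable)
    show "AE x in halfline m. incseq (\<lambda>n. h n x) \<and> (SUP n. h n x) = dilation m 2 f x"
    proof (rule AE_I2)
      fix x assume "x \<in> space (halfline m)"
      then have x: "0 \<le> x" "ennreal x < m" by (auto simp: half_def)
      have "incseq (\<lambda>n. h n x)"
      proof (rule incseq_SucI)
        fix n show "h n x \<le> h (Suc n) x" using inc[of n] by (auto simp: h_def)
      qed
      moreover have "\<exists>n. x < 2 * l n"
      proof (cases m)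
        case (real r) then show ?thesis using x by (auto simp: l_def ennreal_less_iff)
      next
        case top
        obtain n where "x < real n" using reals_Archimedean2 by blast
        then show ?thesis using top by (intro exI[of _ n]) (auto simp: l_def)
      qed
      then obtain n where n: "x < 2 * l n" by blast
      have dx: "dilation m 2 f x = f (x / 2)" using x by (simp add: dilation_def min_absorb1)
      have "(SUP n. h n x) = f (x / 2)"
      proof (rule antisym)
        show "(SUP n. h n x) \<le> f (x / 2)" by (rule SUP_least) (simp add: h_def)
        show "f (x / 2) \<le> (SUP n. h n x)" by (rule SUP_upper2[of n]) (use n in \<open>auto simp: h_def\<close>)
      qed
      ultimately show "incseq (\<lambda>n. h n x) \<and> (SUP n. h n x) = dilation m 2 f x" by (simp add: dx)
    qed
  qed (use f in auto)
  moreover have "N (h n) \<le> 2" for n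
  proof -
    have "N (h n) \<le> 2 * N f" unfolding h_def by (rule norm_half_dilation_le[OF l f(1)])
    also have "\<dots> \<le> 2 * 1" by (rule mult_left_mono[OF f(2)]) simp
    finally show ?thesis by simp
  qed
  ultimately show "N (dilation m 2 f) \<le> 2" by (metis SUP_least)
qed

text \<open>
  By submultiplicativity from powers of 2, and by monotonicity in between.
\<close>

lemma dn_finite: assumes "0 < t" shows "dn t < \<infinity>"
proof -
  have pow: "dn (2 ^ n) \<le> ennreal (2 ^ n)" for n
  proof (induction n)
    case 0 then show ?case using dn_one_le by simp
  next
    case (Suc n)
    have "dn 2 < \<infinity>" using dn_two_le by (rule le_less_trans) simp
    moreover have "dn (2 ^ n) < \<infinity>" using Suc by (rule le_less_trans) simp
    moreover have "1 \<le> (2::real) ^ n" by simp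
    ultimately have "dn (2 * 2 ^ n) \<le> dn 2 * dn (2 ^ n)" by (intro dn_submult) auto
    also have "\<dots> \<le> ennreal 2 * ennreal (2 ^ n)" using dn_two_le Suc by (intro mult_mono) auto
    also have "\<dots> = ennreal (2 ^ Suc n)" by (subst ennreal_mult[symmetric]) auto
    finally show ?case by simp
  qed
  obtain n where "t < 2 ^ n" using real_arch_pow[of 2 t] by auto
  then have "dn t \<le> dn (2 ^ n)" using assms by (intro dn_mono) auto
  also note pow
  also have "ennreal (2 ^ n) < \<infinity>" by simp
  finally show ?thesis .
qed

text \<open>
  Tested on the indicator of an interval of finite length, whose dilation is an indicator of
  positive measure.
\<close>

lemma dn_positive: assumes t: "0 < t" shows "0 < dn t"
proof -
  define c where "c = (if m = \<infinity> then 1 else enn2real m)"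
  have c: "0 < c" "ennreal c \<le> m" using m by (cases m; auto simp: c_def enn2real_positive_iff)+
  have cm: "half (ennreal c) \<subseteq> half m" by (rule half_mono[OF c(2)])
  define f :: "real \<Rightarrow> ennreal" where "f = indicator (half (ennreal c))"
  have E: "half (ennreal c) \<in> sets (halfline m)" using cm by (simp add: sets_halfline)
  have em: "emeasure (halfline m) (half (ennreal c)) = ennreal c" using cm by (simp add: emeasure_halfline emeasure_half)
  have fm: "f \<in> borel_measurable (halfline m)" unfolding f_def using E by measurable
  have fin: "N f < \<infinity>" unfolding f_def using fn E em by (auto simp: function_norm_def)
  have nz: "N (dilation m t f) \<noteq> 0"
  proof
    assume "N (dilation m t f) = 0"
    then have "AE x in halfline m. dilation m t f x = 0"
      using function_norm_zero[OF fn dilation_measurable[OF t fm]] by simp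
    moreover have "{x \<in> space (halfline m). \<not> dilation m t f x = 0} \<in> sets (halfline m)"
      using dilation_measurable[OF t fm] by measurable
    ultimately have "emeasure (halfline m) {x \<in> space (halfline m). \<not> dilation m t f x = 0} = 0"
      by (simp only: AE_iff_measurable[OF _ refl])
    then have "distribution_function (halfline m) (dilation m t f) 0 = 0"
      unfolding distribution_function_def by (simp add: zero_less_iff_neq_zero)
    then have "ennreal t * emeasure lebesgue ({x \<in> half m. 0 < f x} \<inter> half (m * ennreal (1 / t))) = 0"
      unfolding distribution_dilation[OF t fm] .
    moreover have "{x \<in> half m. 0 < f x} = half (ennreal c)" using cm by (auto simp: f_def split: split_indicator_asm)
    ultimately have "ennreal t * min (ennreal c) (m * ennreal (1 / t)) = 0" by (simp add: half_Int emeasure_half)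
    then show False using t c m by (auto simp: min_def ennreal_zero_less_mult_iff split: if_splits)
  qed
  then have "0 < N (dilation m t f)" by (simp add: zero_less_iff_neq_zero)
  also have "\<dots> \<le> dn t * N f" by (rule norm_dilation_le[OF t fm fin dn_finite[OF t]])
  finally show ?thesis by (auto simp: zero_less_iff_neq_zero)
qed

lemma dn_one: "dn 1 = 1"
proof (rule antisym[OF dn_one_le])
  have "dn 1 \<le> dn 1 * dn 1" using dn_submult[of 1 1] dn_finite[of 1] by simp
  moreover obtain r where "dn 1 = ennreal r" "0 < r"
    using dn_finite[of 1] dn_positive[of 1] by (cases "dn 1") auto
  ultimately show "1 \<le> dn 1" by (simp add: ennreal_mult[symmetric])
qed

text \<open>
  Real valued, so that its logarithm can be taken.
\<close>

definition dr :: "real \<Rightarrow> real" where "dr t = enn2real (dn t)"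

lemma dr: "0 < t \<Longrightarrow> dn t = ennreal (dr t)" "0 < t \<Longrightarrow> 0 < dr t"
  unfolding dr_def using dn_finite[of t] dn_positive[of t] by (auto simp: less_top enn2real_positive_iff)

lemma dr_mono: "0 < t \<Longrightarrow> t \<le> t' \<Longrightarrow> dr t \<le> dr t'"
  using dn_mono[of t t'] dr[of t] dr[of t'] by simp

lemma dr_submult:
  assumes "1 \<le> t \<and> 1 \<le> s \<or> 0 < t \<and> t \<le> 1 \<and> 0 < s \<and> s \<le> 1"
  shows "dr (t * s) \<le> dr t * dr s"
proof -
  have p: "0 < t" "0 < s" "0 < t * s" using assms by auto
  have "ennreal (dr (t * s)) \<le> ennreal (dr t * dr s)"
    using dn_submult[OF assms dn_finite dn_finite] p dr[of t] dr[of s] dr[of "t * s"] by (simp add: ennreal_mult)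
  then show ?thesis using dr[of t] dr[of s] p by simp
qed

lemma dr_one: "dr 1 = 1" by (simp add: dr_def dn_one)

end

text \<open>
  Fekete's lemma for the reciprocal quotient: the limit is the supremum of the quotients. It is
  needed because the Boyd index is a \<open>Lim\<close>, about which nothing is known until the
  limit has been shown to exist. The function \<psi> may vanish; the quotient is then \<infinity>.
\<close>

lemma subadditive_quotient_convergent:
  fixes \<psi> :: "real \<Rightarrow> real"
  assumes nonneg: "\<And>x. 0 \<le> x \<Longrightarrow> 0 \<le> \<psi> x" and mono: "\<And>x y. 0 \<le> x \<Longrightarrow> x \<le> y \<Longrightarrow> \<psi> x \<le> \<psi> y"
    and sub: "\<And>x y. 0 \<le> x \<Longrightarrow> 0 \<le> y \<Longrightarrow> \<psi> (x + y) \<le> \<psi> x + \<psi> y"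
  shows "\<exists>L. ((\<lambda>x. ereal x / ereal (\<psi> x)) \<longlongrightarrow> L) at_top"
proof (intro exI order_tendstoI)
  define L where "L = (SUP x\<in>{0<..}. ereal x / ereal (\<psi> x))"
  fix c assume "c < L"
  then obtain x0 where x0: "0 < x0" "c < ereal x0 / ereal (\<psi> x0)"
    unfolding L_def less_SUP_iff by blast
  (* The summand \<psi>(0), which subadditivity does not force to vanish, is lost in the limit. *)
  have mult: "\<psi> (real n * x0) \<le> real n * \<psi> x0 + \<psi> 0" for n
  proof (induction n)
    case (Suc n)
    have "\<psi> (real n * x0 + x0) \<le> \<psi> (real n * x0) + \<psi> x0" using x0 by (intro sub) auto
    then show ?case using Suc by (simp add: algebra_simps)
  qed simp
  have growth: "\<psi> x \<le> (x / x0 + 1) * \<psi> x0 + \<psi> 0" if x: "0 \<le> x" for x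
  proof -
    define n where "n = nat \<lceil>x / x0\<rceil>"
    have n: "x / x0 \<le> real n" "real n \<le> x / x0 + 1" using x x0 by (auto simp: n_def)
    then have "x \<le> real n * x0" using x0 by (simp add: field_simps)
    then have "\<psi> x \<le> \<psi> (real n * x0)" using x by (intro mono)
    also note mult
    also have "real n * \<psi> x0 \<le> (x / x0 + 1) * \<psi> x0" using n nonneg[of x0] x0 by (intro mult_right_mono) auto
    finally show ?thesis by simp
  qed
  show "eventually (\<lambda>x. c < ereal x / ereal (\<psi> x)) at_top"
  proof (cases "c < 0")
    case True
    show ?thesis
      using eventually_ge_at_top[of 0]
    proof eventually_elim
      case (elim x)
      then have "0 \<le> ereal x / ereal (\<psi> x)" using nonneg[of x] by (intro zero_le_divide_ereal) auto
      with True show ?case by (rule less_le_trans)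
    qed
  next
    case False
    have "c \<noteq> \<infinity>" using \<open>c < L\<close> by auto
    then obtain r where r: "c = ereal r" "0 \<le> r" using False by (cases c) auto
    have rx0: "r * \<psi> x0 < x0"
    proof (cases "\<psi> x0 = 0")
      case True then show ?thesis using x0 by simp
    next
      case False
      then have "0 < \<psi> x0" using nonneg[of x0] x0 by simp
      then show ?thesis using x0 r by (simp add: less_divide_eq)
    qed
    define d where "d = 1 - r * \<psi> x0 / x0"
    have d: "0 < d" using rx0 x0 by (simp add: d_def field_simps)
    have "eventually (\<lambda>x. (r * \<psi> x0 + r * \<psi> 0) / d < x \<and> 0 < x) at_top"
      by (intro eventually_conj eventually_gt_at_top)
    then show ?thesis
    proof eventually_elim
      case (elim x)
      have "r * \<psi> x \<le> r * ((x / x0 + 1) * \<psi> x0 + \<psi> 0)" using elim r by (intro mult_left_mono growth) auto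
      also have "\<dots> = x - d * x + (r * \<psi> x0 + r * \<psi> 0)" using x0 by (simp add: d_def field_simps)
      also have "\<dots> < x" using elim d by (simp add: pos_divide_less_eq mult.commute)
      finally have lt: "r * \<psi> x < x" .
      show ?case
      proof (cases "\<psi> x = 0")
        case True
        then show ?thesis using elim r by (simp add: divide_ereal_def)
      next
        case False
        then have "0 < \<psi> x" using nonneg[of x] elim by simp
        then show ?thesis using lt r by (simp add: less_divide_eq)
      qed
    qed
  qed
next
  fix c assume c: "(SUP x\<in>{0<..}. ereal x / ereal (\<psi> x)) < c"
  show "eventually (\<lambda>x. ereal x / ereal (\<psi> x) < c) at_top"
    using eventually_gt_at_top[of 0]
  proof eventually_elim
    case (elim x)
    then have "ereal x / ereal (\<psi> x) \<le> (SUP x\<in>{0<..}. ereal x / ereal (\<psi> x))" by (intro SUP_upper) auto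
    then show ?case using c by (rule le_less_trans)
  qed
qed

text \<open>
  The dual form, where the limit is the infimum of the quotients. If \<psi> vanishes at a point, the
  quotient there is \<infinity> and does not contribute to the infimum.
\<close>

lemma superadditive_quotient_convergent:
  fixes \<psi> :: "real \<Rightarrow> real"
  assumes nonneg: "\<And>x. 0 \<le> x \<Longrightarrow> 0 \<le> \<psi> x" and mono: "\<And>x y. 0 \<le> x \<Longrightarrow> x \<le> y \<Longrightarrow> \<psi> x \<le> \<psi> y"
    and super: "\<And>x y. 0 \<le> x \<Longrightarrow> 0 \<le> y \<Longrightarrow> \<psi> x + \<psi> y \<le> \<psi> (x + y)"
  shows "\<exists>L. ((\<lambda>x. ereal x / ereal (\<psi> x)) \<longlongrightarrow> L) at_top"
proof (intro exI order_tendstoI)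
  fix c assume "(INF x\<in>{0<..}. ereal x / ereal (\<psi> x)) < c"
  then obtain x0 where x0: "0 < x0" "ereal x0 / ereal (\<psi> x0) < c"
    unfolding INF_less_iff by blast
  have "\<psi> x0 \<noteq> 0"
  proof
    assume "\<psi> x0 = 0"
    then have "ereal x0 / ereal (\<psi> x0) = \<infinity>" using x0 by (simp add: divide_ereal_def)
    then show False using x0 by simp
  qed
  then have p0: "0 < \<psi> x0" using nonneg[of x0] x0 by simp
  have mult: "real n * \<psi> x0 \<le> \<psi> (real n * x0)" for n
  proof (induction n)
    case 0 then show ?case using nonneg[of 0] by simp
  next
    case (Suc n)
    have "\<psi> (real n * x0) + \<psi> x0 \<le> \<psi> (real n * x0 + x0)" using x0 by (intro super) auto
    then show ?case using Suc by (simp add: algebra_simps)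
  qed
  have growth: "(x / x0 - 1) * \<psi> x0 \<le> \<psi> x" if x: "0 \<le> x" for x
  proof -
    define n where "n = nat \<lfloor>x / x0\<rfloor>"
    have "0 \<le> x / x0" using x x0 by simp
    then have n: "real n \<le> x / x0" "x / x0 - 1 \<le> real n" by (auto simp: n_def)
    have "(x / x0 - 1) * \<psi> x0 \<le> real n * \<psi> x0" using n p0 by (intro mult_right_mono) auto
    also note mult
    also have "real n * x0 \<le> x" using n x0 by (simp add: field_simps)
    then have "\<psi> (real n * x0) \<le> \<psi> x" using x0 by (intro mono) auto
    finally show ?thesis .
  qed
  have "ereal (x0 / \<psi> x0) < c" using x0 p0 by simp
  then obtain r where r: "x0 / \<psi> x0 < r" "ereal r < c" using ereal_dense2 by (metis less_ereal.simps(1))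
  have r0: "0 < r" using r x0 p0 by (meson divide_pos_pos less_trans)
  define d where "d = r * \<psi> x0 / x0 - 1"
  have d: "0 < d" using r x0 p0 by (simp add: d_def field_simps)
  have "eventually (\<lambda>x. r * \<psi> x0 / d < x \<and> 0 < x) at_top"
    by (intro eventually_conj eventually_gt_at_top)
  then show "eventually (\<lambda>x. ereal x / ereal (\<psi> x) < c) at_top"
  proof eventually_elim
    case (elim x)
    have "x < x + (d * x - r * \<psi> x0)" using elim d by (simp add: pos_divide_less_eq mult.commute)
    also have "\<dots> = r * ((x / x0 - 1) * \<psi> x0)" using x0 by (simp add: d_def field_simps)
    also have "\<dots> \<le> r * \<psi> x" using elim r0 by (intro mult_left_mono growth) auto
    finally have lt: "x < r * \<psi> x" .
    then have "0 < r * \<psi> x" using elim by simp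
    then have "0 < \<psi> x" using r0 by (simp add: zero_less_mult_iff)
    then have "ereal x / ereal (\<psi> x) < ereal r" using lt by (simp add: divide_less_eq)
    then show ?case using r(2) by (rule less_trans)
  qed
next
  fix c assume c: "c < (INF x\<in>{0<..}. ereal x / ereal (\<psi> x))"
  show "eventually (\<lambda>x. c < ereal x / ereal (\<psi> x)) at_top"
    using eventually_gt_at_top[of 0]
  proof eventually_elim
    case (elim x)
    then have "(INF x\<in>{0<..}. ereal x / ereal (\<psi> x)) \<le> ereal x / ereal (\<psi> x)" by (intro INF_lower) auto
    with c show ?case by (rule less_le_trans)
  qed
qed

context ri_norm
begin

text \<open>
  With \<psi>(x) = ln of the dilation norm at e^x, the index is the limit of x / \<psi>(x), so for r
  below it the norm is at most t^(1/r) for large t. On the remaining bounded range of t the norm is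
  bounded by monotonicity.
\<close>

lemma lower_boyd_growth:
  assumes r: "0 < r" "ereal r < lower_boyd_index m N"
  obtains K where "0 < K" "\<And>t. 1 \<le> t \<Longrightarrow> dr t \<le> K * t powr (1 / r)"
proof -
  define \<psi> where "\<psi> x = ln (dr (exp x))" for x
  have dr1: "1 \<le> dr t" if "1 \<le> t" for t using dr_mono[of 1 t] that dr_one by simp
  have quot: "boyd_quotient m N t = ereal (ln t) / ereal (ln (dr t))" if "1 \<le> t" for t
    using dr1[OF that] that unfolding boyd_quotient_def dr_def[symmetric] by (simp only: abs_of_nonneg ln_ge_zero)
  have "\<exists>L. ((\<lambda>x. ereal x / ereal (\<psi> x)) \<longlongrightarrow> L) at_top"
  proof (rule subadditive_quotient_convergent)
    show "0 \<le> \<psi> x" if "0 \<le> x" for x using dr1[of "exp x"] that by (simp add: \<psi>_def)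
    show "\<psi> x \<le> \<psi> y" if "0 \<le> x" "x \<le> y" for x y
      using that dr_mono[of "exp x" "exp y"] dr(2)[of "exp x"] dr(2)[of "exp y"] by (simp add: \<psi>_def)
    show "\<psi> (x + y) \<le> \<psi> x + \<psi> y" if "0 \<le> x" "0 \<le> y" for x y
    proof -
      have "dr (exp x * exp y) \<le> dr (exp x) * dr (exp y)" using that by (intro dr_submult) auto
      then have "ln (dr (exp (x + y))) \<le> ln (dr (exp x) * dr (exp y))"
        using dr(2)[of "exp (x + y)"] dr(2)[of "exp x"] dr(2)[of "exp y"] by (simp add: exp_add)
      then show ?thesis using dr(2)[of "exp x"] dr(2)[of "exp y"] by (simp add: \<psi>_def ln_mult)
    qed
  qed
  then obtain L where L: "((\<lambda>x. ereal x / ereal (\<psi> x)) \<longlongrightarrow> L) at_top" by blast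
  have "((\<lambda>t. ereal (ln t) / ereal (\<psi> (ln t))) \<longlongrightarrow> L) at_top"
    by (rule filterlim_compose[OF L ln_at_top])
  moreover have "eventually (\<lambda>t. ereal (ln t) / ereal (\<psi> (ln t)) = boyd_quotient m N t) at_top"
    using eventually_ge_at_top[of 1]
  proof eventually_elim
    case (elim t)
    then have "exp (ln t) = t" by simp
    then show ?case unfolding quot[OF elim] \<psi>_def by (simp only:)
  qed
  ultimately have lim: "(boyd_quotient m N \<longlongrightarrow> L) at_top" by (rule Lim_transform_eventually)
  then have "lower_boyd_index m N = L" unfolding lower_boyd_index_def by (intro tendsto_Lim) auto
  then have "eventually (\<lambda>t. ereal r < boyd_quotient m N t) at_top" using lim r by (intro order_tendstoD) auto
  then obtain T where T: "\<And>t. T \<le> t \<Longrightarrow> ereal r < boyd_quotient m N t" by (auto simp: eventually_at_top_linorder)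
  define T' where "T' = max T 2"
  have big: "dr t \<le> t powr (1 / r)" if t: "T' \<le> t" for t
  proof -
    have t1: "1 < t" using t by (simp add: T'_def)
    have q: "ereal r < ereal (ln t) / ereal (ln (dr t))"
      using T[of t] t t1 quot[of t] by (simp only: T'_def max.bounded_iff less_imp_le)
    have "r * ln (dr t) \<le> ln t"
    proof (cases "ln (dr t) = 0")
      case True then show ?thesis using t1 by simp
    next
      case False
      then have "0 < ln (dr t)" using dr1[of t] t1 by simp
      then show ?thesis using q by (simp add: less_divide_eq)
    qed
    then have "ln (dr t) \<le> 1 / r * ln t" using r by (simp add: field_simps)
    then have "exp (ln (dr t)) \<le> exp (1 / r * ln t)" by simp
    then show ?thesis using dr(2)[of t] t1 by (simp add: powr_def)
  qed
  show ?thesis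
  proof (rule that[of "max 1 (dr T')"])
    fix t :: real assume t: "1 \<le> t"
    have p: "1 \<le> t powr (1 / r)" using t r by (simp add: ge_one_powr_ge_zero)
    show "dr t \<le> max 1 (dr T') * t powr (1 / r)"
    proof (cases "T' \<le> t")
      case True
      have "t powr (1 / r) \<le> max 1 (dr T') * t powr (1 / r)" using p by (simp add: mult_le_cancel_right1)
      with big[OF True] show ?thesis by (rule order_trans)
    next
      case False
      then have "dr t \<le> max 1 (dr T') * 1" using dr_mono[of t T'] t by simp
      also have "\<dots> \<le> max 1 (dr T') * t powr (1 / r)" using p by (intro mult_left_mono) auto
      finally show ?thesis .
    qed
  qed simp
qed

text \<open>
  The same argument near 0, where submultiplicativity becomes superadditivity of \<psi>(x) = - ln of
  the dilation norm at e^(-x).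
\<close>

lemma upper_boyd_growth:
  assumes r: "0 < r" "upper_boyd_index m N < ereal r"
  obtains K where "0 < K" "\<And>t. 0 < t \<Longrightarrow> t \<le> 1 \<Longrightarrow> dr t \<le> K * t powr (1 / r)"
proof -
  define \<psi> where "\<psi> x = - ln (dr (exp (- x)))" for x
  have dr1: "dr t \<le> 1" if "0 < t" "t \<le> 1" for t using dr_mono[of t 1] that dr_one by simp
  have quot: "boyd_quotient m N t = ereal (- ln t) / ereal (- ln (dr t))" if t: "0 < t" "t < 1" for t
  proof -
    have "\<bar>ln t\<bar> = - ln t" "\<bar>ln (dr t)\<bar> = - ln (dr t)"
      using dr1[of t] dr(2)[of t] t by (auto simp: abs_if)
    then show ?thesis unfolding boyd_quotient_def dr_def[symmetric] by (simp only:)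
  qed
  have "\<exists>L. ((\<lambda>x. ereal x / ereal (\<psi> x)) \<longlongrightarrow> L) at_top"
  proof (rule superadditive_quotient_convergent)
    show "0 \<le> \<psi> x" if "0 \<le> x" for x using dr1[of "exp (- x)"] dr(2)[of "exp (- x)"] that by (simp add: \<psi>_def)
    show "\<psi> x \<le> \<psi> y" if "0 \<le> x" "x \<le> y" for x y
      using that dr_mono[of "exp (- y)" "exp (- x)"] dr(2)[of "exp (- x)"] dr(2)[of "exp (- y)"] by (simp add: \<psi>_def)
    show "\<psi> x + \<psi> y \<le> \<psi> (x + y)" if "0 \<le> x" "0 \<le> y" for x y
    proof -
      have "dr (exp (- x) * exp (- y)) \<le> dr (exp (- x)) * dr (exp (- y))" using that by (intro dr_submult) auto
      moreover have "exp (- x) * exp (- y) = exp (- (x + y))" by (simp add: exp_add[symmetric])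
      ultimately have "ln (dr (exp (- (x + y)))) \<le> ln (dr (exp (- x)) * dr (exp (- y)))"
        using dr(2)[of "exp (- (x + y))"] dr(2)[of "exp (- x)"] dr(2)[of "exp (- y)"] by simp
      then show ?thesis using dr(2)[of "exp (- x)"] dr(2)[of "exp (- y)"] by (simp add: \<psi>_def ln_mult)
    qed
  qed
  then obtain L where L: "((\<lambda>x. ereal x / ereal (\<psi> x)) \<longlongrightarrow> L) at_top" by blast
  have "filterlim (\<lambda>t. - ln t) at_top (at_right (0::real))"
    by (simp add: filterlim_uminus_at_top ln_at_0)
  from filterlim_compose[OF L this]
  have "((\<lambda>t. ereal (- ln t) / ereal (\<psi> (- ln t))) \<longlongrightarrow> L) (at_right 0)" .
  moreover have ev: "eventually (\<lambda>t. 0 < t \<and> t < (1::real)) (at_right 0)"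
    by (auto simp: eventually_at_right_field intro!: exI[of _ 1])
  then have "eventually (\<lambda>t. ereal (- ln t) / ereal (\<psi> (- ln t)) = boyd_quotient m N t) (at_right 0)"
  proof eventually_elim
    case (elim t)
    then have "exp (- (- ln t)) = t" by simp
    then show ?case using quot[of t] elim unfolding \<psi>_def by (simp only:)
  qed
  ultimately have lim: "(boyd_quotient m N \<longlongrightarrow> L) (at_right 0)" by (rule Lim_transform_eventually)
  then have "upper_boyd_index m N = L" unfolding upper_boyd_index_def by (intro tendsto_Lim) auto
  then have "eventually (\<lambda>t. boyd_quotient m N t < ereal r) (at_right 0)" using lim r by (intro order_tendstoD) auto
  then obtain T where T: "0 < T" "\<And>t. 0 < t \<Longrightarrow> t < T \<Longrightarrow> boyd_quotient m N t < ereal r"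
    by (auto simp: eventually_at_right_field)
  define T' where "T' = min T 1"
  have T': "0 < T'" using T by (simp add: T'_def)
  have small: "dr t \<le> t powr (1 / r)" if t: "0 < t" "t < T'" for t
  proof -
    have t1: "t < 1" using t by (simp add: T'_def)
    have q: "ereal (- ln t) / ereal (- ln (dr t)) < ereal r"
      using T(2)[of t] t t1 quot[of t] by (simp only: T'_def min_less_iff_conj)
    have "- ln (dr t) \<noteq> 0"
    proof
      assume "- ln (dr t) = 0"
      then have "ereal (- ln t) / ereal (- ln (dr t)) = \<infinity>" using t t1 by (simp add: divide_ereal_def)
      then show False using q by simp
    qed
    then have "0 < - ln (dr t)" using dr1[of t] dr(2)[of t] t t1 by simp
    then have "- ln t \<le> r * (- ln (dr t))" using q by (simp add: divide_less_eq)
    then have "ln (dr t) \<le> 1 / r * ln t" using r by (simp add: field_simps)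
    then have "exp (ln (dr t)) \<le> exp (1 / r * ln t)" by simp
    then show ?thesis using dr(2)[of t] t by (simp add: powr_def)
  qed
  have c: "1 \<le> T' powr (- (1 / r))" using T' r by (simp add: T'_def powr_minus_divide powr_le1)
  show ?thesis
  proof (rule that[of "T' powr (- (1 / r))"])
    fix t :: real assume t: "0 < t" "t \<le> 1"
    show "dr t \<le> T' powr (- (1 / r)) * t powr (1 / r)"
    proof (cases "t < T'")
      case True
      have "t powr (1 / r) \<le> T' powr (- (1 / r)) * t powr (1 / r)" using c by (simp add: mult_le_cancel_right1)
      with small[OF t(1) True] show ?thesis by (rule order_trans)
    next
      case False
      have "T' powr (- (1 / r)) * T' powr (1 / r) \<le> T' powr (- (1 / r)) * t powr (1 / r)"
        using False T' r by (intro mult_left_mono powr_mono2) auto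
      moreover have "T' powr (- (1 / r)) * T' powr (1 / r) = 1" using T' by (simp add: powr_minus_divide)
      ultimately show ?thesis using dr1[OF t] by simp
    qed
  qed (use T' in simp)
qed

end

section \<open>Interpolation between the Boyd indices\<close>

lemma suminf_geometric_powr_finite:
  assumes "c < 0"
  shows "(\<Sum>n. ennreal (2 powr (real n * c))) < \<infinity>"
proof -
  have "2 powr c < (1::real)" using assms powr_less_mono[of c 0 2] by simp
  moreover have "2 powr (real n * c) = (2 powr c) ^ n" for n
    by (simp add: powr_powr mult.commute flip: powr_realpow)
  ultimately have "(\<Sum>n. ennreal (2 powr (real n * c))) = ennreal (\<Sum>n. (2 powr c) ^ n)"
    by (simp add: suminf_ennreal2 summable_geometric)
  then show ?thesis by simp
qed

text \<open>
  A positive value x \<le> \<theta> lies between two consecutive thresholds a (Suc n) and a n, a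
  value x > \<theta> between b n and b (Suc n); the corresponding term of the series alone is the
  bound. On the first part the modular is at most the p2-th power, on the second at most the p1-th
  power, and p1 < p2 together with \<theta> \<le> 1 allows the common factor \<theta>^p1.
\<close>

lemma dyadic_modular_bound:
  fixes p1 p2 r1 r2 \<theta> x :: real
  assumes p: "0 < p1" "p1 < r1" "r1 < r2" "r2 < p2" and \<theta>: "0 < \<theta>" "\<theta> \<le> 1" and x: "0 \<le> x"
  defines "a \<equiv> \<lambda>n::nat. \<theta> * 2 powr (- (real n / r2))" and "b \<equiv> \<lambda>n::nat. \<theta> * 2 powr (real n / r1)"
  shows "ennreal (min (x powr p1) (x powr p2)) \<le>
     (\<Sum>n. ennreal (\<theta> powr p1 * 2 powr (real n * (- (p2 / r2)))) * indicator {y. a (Suc n) < y} x) +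
     (\<Sum>n. ennreal (\<theta> powr p1 * 2 powr (real (Suc n) * (p1 / r1))) * indicator {y. b n < y} x)"
proof -
  have r: "0 < r1" "0 < r2" "0 < p2" using p by auto
  let ?S = "\<lambda>n. ennreal (\<theta> powr p1 * 2 powr (real n * (- (p2 / r2)))) * indicator {y. a (Suc n) < y} x :: ennreal"
  let ?T = "\<lambda>n. ennreal (\<theta> powr p1 * 2 powr (real (Suc n) * (p1 / r1))) * indicator {y. b n < y} x :: ennreal"
  have single: "f n \<le> (\<Sum>n. f n)" for f :: "nat \<Rightarrow> ennreal" and n
    using sum_le_suminf[of f "{n}"] by simp
  consider "x = 0" | "0 < x" "x \<le> \<theta>" | "\<theta> < x" using x by linarith
  then show ?thesis
  proof cases
    case 1
    then show ?thesis by simp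
  next
    case 2
    (* x = \<theta> 2^(-z/r2), so the integer part of z is the index of the layer. *)
    define z where "z = r2 * log 2 (\<theta> / x)"
    have z0: "0 \<le> z" using 2 r by (simp add: z_def zero_le_log_cancel_iff)
    have xz: "x = \<theta> * 2 powr (- (z / r2))" using 2 \<theta> r by (simp add: z_def powr_minus_divide)
    define n where "n = nat \<lfloor>z\<rfloor>"
    have n: "real n \<le> z" "z < real (Suc n)" using z0 by (auto simp: n_def) linarith+
    have lt: "a (Suc n) < x" unfolding a_def xz using n \<theta> r by (intro mult_strict_left_mono powr_less_mono) (auto simp: divide_strict_right_mono)
    have le: "x \<le> \<theta> * 2 powr (- (real n / r2))" unfolding xz using n \<theta> r by (intro mult_left_mono powr_mono) (auto simp: divide_right_mono)
    have "min (x powr p1) (x powr p2) \<le> x powr p2" by simp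
    also have "\<dots> \<le> (\<theta> * 2 powr (- (real n / r2))) powr p2" using le x r by (intro powr_mono2) auto
    also have "\<dots> = \<theta> powr p2 * 2 powr (real n * (- (p2 / r2)))" using \<theta> by (simp add: powr_mult powr_powr)
    also have "\<dots> \<le> \<theta> powr p1 * 2 powr (real n * (- (p2 / r2)))" using \<theta> p by (intro mult_right_mono powr_mono') auto
    finally have "ennreal (min (x powr p1) (x powr p2)) \<le> ?S n" using lt by (simp add: ennreal_leI)
    also have "\<dots> \<le> (\<Sum>n. ?S n)" by (rule single)
    finally show ?thesis by (simp add: add_increasing2)
  next
    case 3
    define z where "z = r1 * log 2 (x / \<theta>)"
    have z0: "0 < z" using 3 \<theta> r by (simp add: z_def)
    have xz: "x = \<theta> * 2 powr (z / r1)" using 3 \<theta> r by (simp add: z_def)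
    (* Rounding up and subtracting 1 makes the inequality b n < x strict also for integral z. *)
    define n where "n = nat (\<lceil>z\<rceil> - 1)"
    have n: "real n < z" "z \<le> real (Suc n)" using z0 by (auto simp: n_def) linarith+
    have lt: "b n < x" unfolding b_def xz using n \<theta> r by (intro mult_strict_left_mono powr_less_mono) (auto simp: divide_strict_right_mono)
    have le: "x \<le> \<theta> * 2 powr (real (Suc n) / r1)" unfolding xz using n \<theta> r by (intro mult_left_mono powr_mono divide_right_mono) auto
    have "min (x powr p1) (x powr p2) \<le> x powr p1" by simp
    also have "\<dots> \<le> (\<theta> * 2 powr (real (Suc n) / r1)) powr p1" using le x p by (intro powr_mono2) auto
    also have "\<dots> = \<theta> powr p1 * 2 powr (real (Suc n) * (p1 / r1))" using \<theta> by (simp add: powr_mult powr_powr)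
    finally have "ennreal (min (x powr p1) (x powr p2)) \<le> ?T n" using lt by (simp add: ennreal_leI)
    also have "\<dots> \<le> (\<Sum>n. ?T n)" by (rule single)
    finally show ?thesis by (simp add: add_increasing)
  qed
qed

text \<open>
  If some l < F*(t) exceeded all terms of the two series, the distribution function of G would
  satisfy \<mu> {G > l a_n} \<le> 2^n t and \<mu> {G > l b_n} \<le> t / 2^n for all n. Summing the
  layers bounds the modular of G / l by \<theta>^p1 S t, where S is finite since p2 > r2 and p1 <
  r1, and with it the measure of {F > l} by t. That contradicts l < F*(t) as soon as C S \<theta>^p1
  \<le> 1. The bounds at b_n also show that G is finite almost everywhere.
\<close>

lemma rearrangement_dominated:
  fixes M :: "'a measure" and p1 p2 r1 r2 C :: real
  assumes p: "0 < p1" "p1 < r1" "r1 < r2" "r2 < p2" and C: "1 \<le> C"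
  shows "\<exists>\<theta>>0. \<forall>F\<in>borel_measurable M. \<forall>G\<in>borel_measurable M.
      modular_dominated M p1 p2 C F G \<longrightarrow>
      (\<forall>t>0. decreasing_rearrangement M F t \<le>
        (\<Sum>n. ennreal (2 powr (real n / r2) / \<theta>) * decreasing_rearrangement M G (2 ^ n * t)) +
        (\<Sum>n. ennreal (2 powr (- (real n / r1)) / \<theta>) * decreasing_rearrangement M G (t / 2 ^ n)))"
proof -
  have r: "0 < r1" "0 < r2" "0 < p2" using p by auto
  have "1 < p2 / r2" "p1 / r1 < 1" using p r by auto
  then have neg: "1 - p2 / r2 < 0" "p1 / r1 - 1 < 0" by auto
  note fin = suminf_geometric_powr_finite[OF neg(1)] suminf_geometric_powr_finite[OF neg(2)]
  obtain A B where AB: "(\<Sum>n. ennreal (2 powr (real n * (1 - p2 / r2)))) = ennreal A" "0 \<le> A"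
    "(\<Sum>n. ennreal (2 powr (real n * (p1 / r1 - 1)))) = ennreal B" "0 \<le> B"
  proof -
    have ex: "\<exists>r. s = ennreal r \<and> 0 \<le> r" if "s < \<infinity>" for s :: ennreal using that by (cases s) auto
    show thesis using ex[OF fin(1)] ex[OF fin(2)] that by blast
  qed
  define S where "S = 2 * A + 2 powr (p1 / r1) * B"
  have S: "0 \<le> S" using AB by (simp add: S_def)
  (* The added 1 makes \<theta> positive and C S \<theta>^p1 < 1 even if S = 0, and \<theta>
    \<le> 1. *)
  define \<theta> where "\<theta> = (1 / (C * S + 1)) powr (1 / p1)"
  have CS: "1 \<le> C * S + 1" using C S by simp
  have \<theta>: "0 < \<theta>" "\<theta> \<le> 1" "\<theta> powr p1 = 1 / (C * S + 1)"
    using CS p by (auto simp: \<theta>_def powr_powr intro!: powr_le1)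
  show ?thesis
  proof (intro exI[of _ \<theta>] conjI \<theta>(1) ballI impI allI)
    fix F G :: "'a \<Rightarrow> ennreal" and t :: real
    assume Fm[measurable]: "F \<in> borel_measurable M" and Gm[measurable]: "G \<in> borel_measurable M" and t: "0 < t"
      and weak: "modular_dominated M p1 p2 C F G"
    define a where "a n = \<theta> * 2 powr (- (real n / r2))" for n :: nat
    define b where "b n = \<theta> * 2 powr (real n / r1)" for n :: nat
    have ab: "0 < a n" "0 < b n" for n using \<theta> by (auto simp: a_def b_def)
    (* A positive l below F*(t) is exceeded by one of the terms of the two series. *)
    have claim: "\<exists>n. ennreal (l * a n) < decreasing_rearrangement M G (2 ^ n * t) \<or> ennreal (l * b n) < decreasing_rearrangement M G (t / 2 ^ n)"
      if l: "0 < l" "ennreal l < decreasing_rearrangement M F t" for l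
    proof (rule ccontr)
      assume "\<not> ?thesis"
      then have Ga: "emeasure M {x\<in>space M. ennreal (l * a n) < G x} \<le> ennreal (2 ^ n * t)"
        and Gb: "emeasure M {x\<in>space M. ennreal (l * b n) < G x} \<le> ennreal (t / 2 ^ n)" for n
        by (auto simp: less_rearrangement_iff not_less distribution_function_def)
      have fin: "AE x in M. G x < \<infinity>"
      proof -
        have "emeasure M {x\<in>space M. G x = \<infinity>} \<le> ennreal (t / 2 ^ n)" for n
        proof -
          have "emeasure M {x\<in>space M. G x = \<infinity>} \<le> emeasure M {x\<in>space M. ennreal (l * b n) < G x}"
            by (rule emeasure_mono) auto
          then show ?thesis using Gb[of n] by (rule order_trans)
        qed
        moreover have "(\<lambda>n. ennreal (t / 2 ^ n)) \<longlonglongrightarrow> ennreal 0"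
          by (intro tendsto_ennrealI LIMSEQ_divide_realpow_zero) simp
        ultimately have "emeasure M {x\<in>space M. G x = \<infinity>} \<le> ennreal 0"
          by (intro LIMSEQ_le_const) auto
        then show ?thesis by (subst AE_iff_measurable[of "{x\<in>space M. G x = \<infinity>}"]) (auto simp: less_top[symmetric])
      qed
      have "(\<integral>\<^sup>+x. ennreal (min ((enn2real (G x) / l) powr p1) ((enn2real (G x) / l) powr p2)) \<partial>M)
          \<le> (\<integral>\<^sup>+x. (\<Sum>n. ennreal (\<theta> powr p1 * 2 powr (real n * (- (p2 / r2)))) * indicator {x\<in>space M. ennreal (l * a (Suc n)) < G x} x) +
              (\<Sum>n. ennreal (\<theta> powr p1 * 2 powr (real (Suc n) * (p1 / r1))) * indicator {x\<in>space M. ennreal (l * b n) < G x} x) \<partial>M)"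
      proof (rule nn_integral_mono_AE)
        show "AE x in M. ennreal (min ((enn2real (G x) / l) powr p1) ((enn2real (G x) / l) powr p2))
          \<le> (\<Sum>n. ennreal (\<theta> powr p1 * 2 powr (real n * (- (p2 / r2)))) * indicator {x\<in>space M. ennreal (l * a (Suc n)) < G x} x) +
              (\<Sum>n. ennreal (\<theta> powr p1 * 2 powr (real (Suc n) * (p1 / r1))) * indicator {x\<in>space M. ennreal (l * b n) < G x} x)"
          using fin AE_space
        proof eventually_elim
          case (elim x)
          then obtain g where g: "G x = ennreal g" "0 \<le> g" by (cases "G x") auto
          have ind: "indicator {y. c < y} (g / l) = (indicator {x\<in>space M. ennreal (l * c) < G x} x :: ennreal)" if "0 < c" for c
            using g l that elim(2) by (auto simp: ennreal_less_iff less_divide_eq mult.commute split: split_indicator)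
          show ?case
            using dyadic_modular_bound[OF p \<theta>(1,2), of "g / l", folded a_def b_def] g l
            by (simp only: ind[OF ab(1)] ind[OF ab(2)] enn2real_ennreal divide_nonneg_pos)
        qed
      qed
      also have "\<dots> = (\<Sum>n. ennreal (\<theta> powr p1 * 2 powr (real n * (- (p2 / r2)))) * emeasure M {x\<in>space M. ennreal (l * a (Suc n)) < G x}) +
          (\<Sum>n. ennreal (\<theta> powr p1 * 2 powr (real (Suc n) * (p1 / r1))) * emeasure M {x\<in>space M. ennreal (l * b n) < G x})"
        by (simp add: nn_integral_add nn_integral_suminf nn_integral_cmult_indicator)
      also have "\<dots> \<le> (\<Sum>n. ennreal (\<theta> powr p1 * 2 powr (real n * (- (p2 / r2)))) * ennreal (2 ^ Suc n * t)) +
          (\<Sum>n. ennreal (\<theta> powr p1 * 2 powr (real (Suc n) * (p1 / r1))) * ennreal (t / 2 ^ n))"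
        by (intro add_mono suminf_le mult_left_mono Ga Gb) auto
      also have "\<dots> = (\<Sum>n. ennreal (\<theta> powr p1 * t * 2) * ennreal (2 powr (real n * (1 - p2 / r2)))) +
          (\<Sum>n. ennreal (\<theta> powr p1 * t * 2 powr (p1 / r1)) * ennreal (2 powr (real n * (p1 / r1 - 1))))"
      proof -
        have q1: "\<theta> powr p1 * 2 powr (real n * (- (p2 / r2))) * (2 ^ Suc n * t) = \<theta> powr p1 * t * 2 * 2 powr (real n * (1 - p2 / r2))" for n
        proof -
          have "2 powr (real n * (1 - p2 / r2)) = 2 powr (real n * (- (p2 / r2))) * 2 powr real n"
            by (simp add: powr_add[symmetric] algebra_simps)
          also have "2 powr real n = (2::real) ^ n" by (simp add: powr_realpow)
          finally show ?thesis by simp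
        qed
        have q2: "\<theta> powr p1 * 2 powr (real (Suc n) * (p1 / r1)) * (t / 2 ^ n) = \<theta> powr p1 * t * 2 powr (p1 / r1) * 2 powr (real n * (p1 / r1 - 1))" for n
        proof -
          have "2 powr (real (Suc n) * (p1 / r1)) = 2 powr (p1 / r1) * 2 powr (real n * (p1 / r1 - 1)) * 2 powr real n"
            by (simp add: powr_add[symmetric] algebra_simps)
          also have "2 powr real n = (2::real) ^ n" by (simp add: powr_realpow)
          finally show ?thesis by simp
        qed
        have comb: "ennreal c * ennreal d = ennreal c' * ennreal d'" if "c * d = c' * d'" "0 \<le> c" "0 \<le> c'" for c d c' d' :: real
          using that by (simp add: ennreal_mult'[symmetric])
        have "ennreal (\<theta> powr p1 * 2 powr (real n * (- (p2 / r2)))) * ennreal (2 ^ Suc n * t)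
            = ennreal (\<theta> powr p1 * t * 2) * ennreal (2 powr (real n * (1 - p2 / r2)))" for n
          by (rule comb[OF q1]) (use t in auto)
        moreover have "ennreal (\<theta> powr p1 * 2 powr (real (Suc n) * (p1 / r1))) * ennreal (t / 2 ^ n)
            = ennreal (\<theta> powr p1 * t * 2 powr (p1 / r1)) * ennreal (2 powr (real n * (p1 / r1 - 1)))" for n
          by (rule comb[OF q2]) (use t in auto)
        ultimately show ?thesis by (simp only:)
      qed
      also have "\<dots> = ennreal (\<theta> powr p1 * t * 2) * ennreal A + ennreal (\<theta> powr p1 * t * 2 powr (p1 / r1)) * ennreal B"
        by (simp only: ennreal_suminf_cmult AB(1,3))
      also have "\<dots> = ennreal (\<theta> powr p1 * t * 2 * A + \<theta> powr p1 * t * 2 powr (p1 / r1) * B)"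
        using t AB by (simp add: ennreal_mult ennreal_plus)
      also have "\<theta> powr p1 * t * 2 * A + \<theta> powr p1 * t * 2 powr (p1 / r1) * B = \<theta> powr p1 * S * t"
        by (simp add: S_def algebra_simps)
      finally have Ile: "(\<integral>\<^sup>+x. ennreal (min ((enn2real (G x) / l) powr p1) ((enn2real (G x) / l) powr p2)) \<partial>M)
          \<le> ennreal (\<theta> powr p1 * S * t)" .
      have "ennreal t < emeasure M {x\<in>space M. ennreal l < F x}"
        using l(2) unfolding less_rearrangement_iff[OF Fm] by (simp add: distribution_function_def)
      also have "\<dots> \<le> ennreal C * (\<integral>\<^sup>+x. ennreal (min ((enn2real (G x) / l) powr p1) ((enn2real (G x) / l) powr p2)) \<partial>M)"
        by (rule weak[unfolded modular_dominated_def modular_def, rule_format, OF fin l(1)])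
      also have "\<dots> \<le> ennreal C * ennreal (\<theta> powr p1 * S * t)" by (rule mult_left_mono[OF Ile]) simp
      also have "\<dots> = ennreal (C * S / (C * S + 1) * t)" using C by (simp add: ennreal_mult'[symmetric] \<theta>(3) mult.assoc)
      also have "\<dots> \<le> ennreal t"
      proof (rule ennreal_leI)
        have "C * S / (C * S + 1) \<le> 1" using CS by simp
        then show "C * S / (C * S + 1) * t \<le> t" using t mult_right_mono[of "C * S / (C * S + 1)" 1 t] by simp
      qed
      finally show False by simp
    qed
    let ?A = "\<lambda>n. ennreal (2 powr (real n / r2) / \<theta>) * decreasing_rearrangement M G (2 ^ n * t)"
    let ?B = "\<lambda>n. ennreal (2 powr (- (real n / r1)) / \<theta>) * decreasing_rearrangement M G (t / 2 ^ n)"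
    have single: "f n \<le> (\<Sum>n. f n)" for f :: "nat \<Rightarrow> ennreal" and n
      using sum_le_suminf[of f "{n}"] by simp
    show "decreasing_rearrangement M F t \<le> (\<Sum>n. ?A n) + (\<Sum>n. ?B n)"
    proof (rule dense_le)
      fix y assume y: "y < decreasing_rearrangement M F t"
      then obtain l where l: "y = ennreal l" "0 \<le> l" by (cases y) auto
      show "y \<le> (\<Sum>n. ?A n) + (\<Sum>n. ?B n)"
      proof (cases "l = 0")
        case True then show ?thesis using l by simp
      next
        case False
        then have l0: "0 < l" using l by simp
        obtain n where n: "ennreal (l * a n) < decreasing_rearrangement M G (2 ^ n * t) \<or> ennreal (l * b n) < decreasing_rearrangement M G (t / 2 ^ n)"
          using claim[OF l0] y l by blast
        from n show ?thesis
        proof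
          assume *: "ennreal (l * a n) < decreasing_rearrangement M G (2 ^ n * t)"
          have "l = 2 powr (real n / r2) / \<theta> * (l * a n)" using \<theta> by (simp add: a_def powr_minus_divide)
          then have "y = ennreal (2 powr (real n / r2) / \<theta>) * ennreal (l * a n)"
            using l \<theta> by (simp add: ennreal_mult'[symmetric])
          also have "\<dots> \<le> ?A n" using * by (intro mult_left_mono) auto
          also have "\<dots> \<le> (\<Sum>n. ?A n)" by (rule single)
          finally show ?thesis by (simp add: add_increasing2)
        next
          assume *: "ennreal (l * b n) < decreasing_rearrangement M G (t / 2 ^ n)"
          have "l = 2 powr (- (real n / r1)) / \<theta> * (l * b n)" using \<theta> by (simp add: b_def powr_minus_divide)
          then have "y = ennreal (2 powr (- (real n / r1)) / \<theta>) * ennreal (l * b n)"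
            using l \<theta> by (simp add: ennreal_mult'[symmetric])
          also have "\<dots> \<le> ?B n" using * by (intro mult_left_mono) auto
          also have "\<dots> \<le> (\<Sum>n. ?B n)" by (rule single)
          finally show ?thesis by (simp add: add_increasing)
        qed
      qed
    qed
  qed
qed

text \<open>
  Insert s1 and s2 with r1 < s1 < p_X and q_X < s2 < r2. The dilation by 2^n has norm at most a
  multiple of 2^(n/s1), the one by 2^(-n) a multiple of 2^(-n/s2), so both series of norms are
  dominated by geometric series with ratio less than 1.
\<close>

lemma boyd_interpolation:
  fixes M :: "'a measure" and pX qX p1 p2 C :: real
  assumes M: "0 < emeasure M (space M)" and lux: "luxemburg_representation M X N"
    and pX: "ereal pX = lower_boyd_index (emeasure M (space M)) N" and qX: "ereal qX = upper_boyd_index (emeasure M (space M)) N"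
    and p: "0 < p1" "p1 < pX" "pX \<le> qX" "qX < p2" and C: "1 \<le> C"
  obtains K :: real where "0 < K"
    "\<And>F G. F \<in> borel_measurable M \<Longrightarrow> G \<in> borel_measurable M \<Longrightarrow>
      modular_dominated M p1 p2 C F G \<Longrightarrow> X F \<le> ennreal K * X G"
proof -
  define m where "m = emeasure M (space M)"
  interpret ri_norm m N
    by standard (use M lux in \<open>auto simp: m_def luxemburg_representation_def\<close>)
  have X: "X f = N (decreasing_rearrangement M f)" if "f \<in> borel_measurable M" for f
    using lux that by (auto simp: luxemburg_representation_def)
  obtain r1 where r1: "p1 < r1" "r1 < pX" using dense[OF p(2)] by blast
  obtain s1 where s1: "r1 < s1" "s1 < pX" using dense[OF r1(2)] by blast
  obtain r2 where r2: "qX < r2" "r2 < p2" using dense[OF p(4)] by blast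
  obtain s2 where s2: "qX < s2" "s2 < r2" using dense[OF r2(1)] by blast
  have pos: "0 < r1" "0 < s1" "0 < s2" "0 < r2" "r1 < r2" using p r1 s1 r2 s2 by auto
  obtain K1 where K1: "0 < K1" "\<And>t. 1 \<le> t \<Longrightarrow> dr t \<le> K1 * t powr (1 / s1)"
  proof -
    have "ereal s1 < lower_boyd_index m N" using s1 pX[folded m_def] by (simp flip: pX[folded m_def])
    then show ?thesis using lower_boyd_growth[OF pos(2)] that by blast
  qed
  obtain K2 where K2: "0 < K2" "\<And>t. 0 < t \<Longrightarrow> t \<le> 1 \<Longrightarrow> dr t \<le> K2 * t powr (1 / s2)"
  proof -
    have "upper_boyd_index m N < ereal s2" using s2 by (simp flip: qX[folded m_def])
    then show ?thesis using upper_boyd_growth[OF pos(3)] that by blast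
  qed
  obtain \<theta> :: real where \<theta>: "0 < \<theta>" and dom: "\<forall>F\<in>borel_measurable M. \<forall>G\<in>borel_measurable M.
      modular_dominated M p1 p2 C F G \<longrightarrow>
      (\<forall>t>0. decreasing_rearrangement M F t \<le>
        (\<Sum>n. ennreal (2 powr (real n / r2) / \<theta>) * decreasing_rearrangement M G (2 ^ n * t)) +
        (\<Sum>n. ennreal (2 powr (- (real n / r1)) / \<theta>) * decreasing_rearrangement M G (t / 2 ^ n)))"
    using rearrangement_dominated[OF p(1) r1(1) pos(5) r2(2) C] by blast
  have pw: "(2 ^ n) powr c = 2 powr (real n * c)" "(1 / 2 ^ n) powr c = 2 powr (- (real n * c))" for n and c :: real
  proof -
    have e: "(2::real) ^ n = 2 powr real n" by (simp add: powr_realpow)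
    show "(2 ^ n) powr c = 2 powr (real n * c)" unfolding e by (simp add: powr_powr)
    then show "(1 / 2 ^ n) powr c = 2 powr (- (real n * c))" by (simp add: powr_divide powr_minus_divide)
  qed
  define U where "U = (\<Sum>n. ennreal (2 powr (real n / r2) / \<theta>) * dn (1 / 2 ^ n))"
  define V where "V = (\<Sum>n. ennreal (2 powr (- (real n / r1)) / \<theta>) * dn (2 ^ n))"
  have mult_fin: "ennreal c * s < \<infinity>" if "s < \<infinity>" for c and s :: ennreal
    using that by (auto simp: ennreal_mult_less_top)
  have Ufin: "U < \<infinity>"
  proof -
    have "U \<le> (\<Sum>n. ennreal (K2 / \<theta>) * ennreal (2 powr (real n * (1 / r2 - 1 / s2))))"
      unfolding U_def
    proof (rule suminf_le)
      fix n
      have "dn (1 / 2 ^ n) = ennreal (dr (1 / 2 ^ n))" by (rule dr) simp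
      also have "\<dots> \<le> ennreal (K2 * (1 / 2 ^ n) powr (1 / s2))" by (intro ennreal_leI K2) auto
      finally have "ennreal (2 powr (real n / r2) / \<theta>) * dn (1 / 2 ^ n)
          \<le> ennreal (2 powr (real n / r2) / \<theta>) * ennreal (K2 * (1 / 2 ^ n) powr (1 / s2))" by (rule mult_left_mono) simp
      also have "\<dots> = ennreal (2 powr (real n / r2) / \<theta> * (K2 * (1 / 2 ^ n) powr (1 / s2)))"
        using \<theta> by (intro ennreal_mult'[symmetric]) simp
      also have "2 powr (real n / r2) / \<theta> * (K2 * (1 / 2 ^ n) powr (1 / s2)) = K2 / \<theta> * 2 powr (real n * (1 / r2 - 1 / s2))"
        unfolding pw by (simp add: powr_diff powr_minus_divide right_diff_distrib)
      also have "ennreal \<dots> = ennreal (K2 / \<theta>) * ennreal (2 powr (real n * (1 / r2 - 1 / s2)))"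
        using K2 \<theta> by (intro ennreal_mult') simp
      finally show "ennreal (2 powr (real n / r2) / \<theta>) * dn (1 / 2 ^ n) \<le> ennreal (K2 / \<theta>) * ennreal (2 powr (real n * (1 / r2 - 1 / s2)))" .
    qed auto
    also have "\<dots> = ennreal (K2 / \<theta>) * (\<Sum>n. ennreal (2 powr (real n * (1 / r2 - 1 / s2))))" by (rule ennreal_suminf_cmult)
    also have "\<dots> < \<infinity>"
    proof (rule mult_fin, rule suminf_geometric_powr_finite)
      show "1 / r2 - 1 / s2 < 0" using pos s2 by (simp add: divide_strict_left_mono)
    qed
    finally show ?thesis .
  qed
  have Vfin: "V < \<infinity>"
  proof -
    have "V \<le> (\<Sum>n. ennreal (K1 / \<theta>) * ennreal (2 powr (real n * (1 / s1 - 1 / r1))))"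
      unfolding V_def
    proof (rule suminf_le)
      fix n
      have "dn (2 ^ n) = ennreal (dr (2 ^ n))" by (rule dr) simp
      also have "\<dots> \<le> ennreal (K1 * (2 ^ n) powr (1 / s1))" by (intro ennreal_leI K1) auto
      finally have "ennreal (2 powr (- (real n / r1)) / \<theta>) * dn (2 ^ n)
          \<le> ennreal (2 powr (- (real n / r1)) / \<theta>) * ennreal (K1 * (2 ^ n) powr (1 / s1))" by (rule mult_left_mono) simp
      also have "\<dots> = ennreal (2 powr (- (real n / r1)) / \<theta> * (K1 * (2 ^ n) powr (1 / s1)))"
        using \<theta> by (intro ennreal_mult'[symmetric]) simp
      also have "2 powr (- (real n / r1)) / \<theta> * (K1 * (2 ^ n) powr (1 / s1)) = K1 / \<theta> * 2 powr (real n * (1 / s1 - 1 / r1))"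
        unfolding pw by (simp add: powr_diff powr_minus_divide right_diff_distrib)
      also have "ennreal \<dots> = ennreal (K1 / \<theta>) * ennreal (2 powr (real n * (1 / s1 - 1 / r1)))"
        using K1 \<theta> by (intro ennreal_mult') simp
      finally show "ennreal (2 powr (- (real n / r1)) / \<theta>) * dn (2 ^ n) \<le> ennreal (K1 / \<theta>) * ennreal (2 powr (real n * (1 / s1 - 1 / r1)))" .
    qed auto
    also have "\<dots> = ennreal (K1 / \<theta>) * (\<Sum>n. ennreal (2 powr (real n * (1 / s1 - 1 / r1))))" by (rule ennreal_suminf_cmult)
    also have "\<dots> < \<infinity>"
    proof (rule mult_fin, rule suminf_geometric_powr_finite)
      show "1 / s1 - 1 / r1 < 0" using pos s1 by (simp add: divide_strict_left_mono)
    qed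
    finally show ?thesis .
  qed
  define K where "K = 1 + enn2real (U + V)"
  have K: "0 < K" "U + V \<le> ennreal K"
  proof -
    obtain w where w: "U + V = ennreal w" "0 \<le> w" using Ufin Vfin by (cases "U + V") auto
    then show "0 < K" "U + V \<le> ennreal K" by (auto simp: K_def intro!: ennreal_leI)
  qed
  show ?thesis
  proof (rule that[OF K(1)])
    fix F G :: "'a \<Rightarrow> ennreal"
    assume Fm: "F \<in> borel_measurable M" and Gm: "G \<in> borel_measurable M"
      and weak: "modular_dominated M p1 p2 C F G"
    show "X F \<le> ennreal K * X G"
    proof (cases "X G = \<infinity>")
      case True then show ?thesis using K by (simp add: ennreal_mult_top)
    next
      case False
      define Fs where "Fs = decreasing_rearrangement M F"
      define Gs where "Gs = decreasing_rearrangement M G"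
      have Fsm: "Fs \<in> borel_measurable (halfline m)" unfolding Fs_def by (rule rearrangement_measurable[OF Fm])
      have Gsm: "Gs \<in> borel_measurable (halfline m)" unfolding Gs_def by (rule rearrangement_measurable[OF Gm])
      have Gfin: "N Gs < \<infinity>" using False X[OF Gm] by (simp add: Gs_def less_top)
      have dm[measurable]: "dilation m c Gs \<in> borel_measurable (halfline m)" if "0 < c" for c
        by (rule dilation_measurable[OF that Gsm])
      define P where "P n x = ennreal (2 powr (real n / r2) / \<theta>) * dilation m (1 / 2 ^ n) Gs x" for n x
      define Q where "Q n x = ennreal (2 powr (- (real n / r1)) / \<theta>) * dilation m (2 ^ n) Gs x" for n x
      have Pm[measurable]: "P n \<in> borel_measurable (halfline m)" for n unfolding P_def using dm[of "1 / 2 ^ n"] by measurable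
      have Qm[measurable]: "Q n \<in> borel_measurable (halfline m)" for n unfolding Q_def using dm[of "2 ^ n"] by measurable
      have pt: "Fs x \<le> (\<Sum>n. P n x) + (\<Sum>n. Q n x)" if x: "x \<in> half m" "0 < x" for x
      proof -
        (* Where the dilation is cut off, the argument lies beyond m and the rearrangement vanishes
          as well. *)
        have d1: "dilation m (1 / 2 ^ n) Gs x = Gs (2 ^ n * x)" for n
        proof (cases "ennreal x < m * ennreal (1 / 2 ^ n)")
          case True
          then show ?thesis by (simp add: dilation_def min_absorb2 mult.commute)
        next
          case nl: False
          have "\<not> ennreal (x / (1 / 2 ^ n)) < m" using nl x by (subst ennreal_scale_less_iff[symmetric]) auto
          then have "Gs (2 ^ n * x) = 0" unfolding Gs_def m_def
            by (intro rearrangement_zero_beyond[OF Gm]) (simp add: not_less mult.commute)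
          then show ?thesis using nl by (simp add: dilation_def min_absorb2)
        qed
        have d2: "dilation m (2 ^ n) Gs x = Gs (x / 2 ^ n)" for n
        proof -
          have "(1::ennreal) \<le> ennreal (2 ^ n)" by simp
          then show ?thesis using x by (simp add: dilation_def min_absorb1 half_def)
        qed
        show ?thesis unfolding P_def Q_def d1 d2 unfolding Gs_def Fs_def by (rule dom[rule_format, OF Fm Gm weak x(2)])
      qed
      have "N Fs \<le> N (\<lambda>x. (\<Sum>n. P n x) + (\<Sum>n. Q n x))"
      proof (rule function_norm_mono[OF fn Fsm])
        (* The pointwise bound excludes x = 0, a null set. *)
        have "{0::real} \<inter> half m \<in> null_sets (halfline m)"
        proof -
          have "{0::real} \<inter> half m \<in> sets (halfline m)" by (auto simp: sets_halfline)
          moreover have "emeasure lebesgue ({0::real} \<inter> half m) \<le> emeasure lebesgue {0::real}" by (rule emeasure_mono) auto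
          ultimately show ?thesis by (auto simp: null_sets_def emeasure_halfline)
        qed
        then have "AE x in halfline m. x \<notin> {0} \<inter> half m" by (rule AE_not_in)
        then show "AE x in halfline m. Fs x \<le> (\<Sum>n. P n x) + (\<Sum>n. Q n x)"
          using AE_space
        proof eventually_elim
          case (elim x)
          then have "x \<in> half m" "0 < x" by (auto simp: half_def less_le)
          then show ?case by (rule pt)
        qed
      qed measurable
      also have "\<dots> \<le> N (\<lambda>x. \<Sum>n. P n x) + N (\<lambda>x. \<Sum>n. Q n x)" by (rule function_norm_add[OF fn]) measurable
      also have "\<dots> \<le> (\<Sum>n. N (P n)) + (\<Sum>n. N (Q n))" by (intro add_mono function_norm_suminf[OF fn]) measurable
      also have "\<dots> \<le> (\<Sum>n. ennreal (2 powr (real n / r2) / \<theta>) * dn (1 / 2 ^ n) * N Gs) + (\<Sum>n. ennreal (2 powr (- (real n / r1)) / \<theta>) * dn (2 ^ n) * N Gs)"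
      proof (intro add_mono suminf_le)
        fix n
        have "N (P n) = ennreal (2 powr (real n / r2) / \<theta>) * N (dilation m (1 / 2 ^ n) Gs)"
          unfolding P_def using \<theta> by (intro function_norm_cmult[OF fn] dm) auto
        also have "\<dots> \<le> ennreal (2 powr (real n / r2) / \<theta>) * (dn (1 / 2 ^ n) * N Gs)"
          by (intro mult_left_mono norm_dilation_le Gsm Gfin dn_finite) auto
        finally show "N (P n) \<le> ennreal (2 powr (real n / r2) / \<theta>) * dn (1 / 2 ^ n) * N Gs" by (simp add: mult.assoc)
        have "N (Q n) = ennreal (2 powr (- (real n / r1)) / \<theta>) * N (dilation m (2 ^ n) Gs)"
          unfolding Q_def using \<theta> by (intro function_norm_cmult[OF fn] dm) auto
        also have "\<dots> \<le> ennreal (2 powr (- (real n / r1)) / \<theta>) * (dn (2 ^ n) * N Gs)"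
          by (intro mult_left_mono norm_dilation_le Gsm Gfin dn_finite) auto
        finally show "N (Q n) \<le> ennreal (2 powr (- (real n / r1)) / \<theta>) * dn (2 ^ n) * N Gs" by (simp add: mult.assoc)
      qed auto
      also have "\<dots> = (U + V) * N Gs" by (simp add: U_def V_def ennreal_suminf_multc distrib_right)
      also have "\<dots> \<le> ennreal K * N Gs" by (rule mult_right_mono[OF K(2)]) simp
      finally show ?thesis by (simp add: X Fm Gm Fs_def Gs_def)
    qed
  qed
qed

theorem theorem3p44:
  fixes M :: "'a measure"
    and \<B> :: "'a set set"
    and \<F> :: "(('a \<Rightarrow> ennreal) \<times> ('a \<Rightarrow> ennreal)) set"
    and pminus p0 :: real
    and pplus :: ereal
    and X :: "('a \<Rightarrow> ennreal) \<Rightarrow> ennreal"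
    and Xbar :: "(real \<Rightarrow> ennreal) \<Rightarrow> ennreal"
    and pX qX :: real
    and u :: "'a \<Rightarrow> real"
  assumes "sigma_finite_measure M" and "nonatomic M" and "0 < emeasure M (space M)"
    and "muckenhoupt_basis M \<B>"
    and "A_infty M \<B> \<subseteq> (\<Union>s\<in>{1<..}. RH_class M \<B> s)"
    and "extrapolation_family M \<F>"
    and "1 \<le> pminus" and "ereal pminus < pplus"
    and "pminus \<le> p0" and "ereal p0 \<le> pplus"
    and "\<exists>\<phi> :: ennreal \<Rightarrow> ennreal \<Rightarrow> ennreal.
           (\<forall>a a' b b'. a \<le> a' \<longrightarrow> b \<le> b' \<longrightarrow> \<phi> a b \<le> \<phi> a' b') \<and>
           (\<forall>a b. a < \<infinity> \<longrightarrow> b < \<infinity> \<longrightarrow> \<phi> a b < \<infinity>) \<and>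
           (\<forall>w\<in>A_class M \<B> (p0 / pminus) \<inter> RH_class M \<B> (holder_conj (pplus / ereal p0)).
              \<forall>(f, g)\<in>\<F>.
                Lp_norm (density M w) p0 f
                  \<le> \<phi> (A_const M \<B> (p0 / pminus) w) (RH_const M \<B> (holder_conj (pplus / ereal p0)) w)
                     * Lp_norm (density M w) p0 g)"
    and "function_norm M X" and "rearrangement_invariant M X"
    and "\<exists>r>pminus. function_norm M (power_norm (1 / r) X)"
    and "luxemburg_representation M X Xbar"
    and "ereal pX = lower_boyd_index (emeasure M (space M)) Xbar"
    and "ereal qX = upper_boyd_index (emeasure M (space M)) Xbar"
    and "pminus < pX" and "pX \<le> qX" and "ereal qX < pplus"
    and "weight M u"
    and "(\<lambda>x. u x powr pX) \<in> A_class M \<B> (pX / pminus) \<inter> RH_class M \<B> (holder_conj (pplus / ereal pX))"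
    and "(\<lambda>x. u x powr qX) \<in> A_class M \<B> (qX / pminus) \<inter> RH_class M \<B> (holder_conj (pplus / ereal qX))"
  shows "\<exists>C<\<infinity>. \<forall>(f, g)\<in>\<F>. X (\<lambda>x. f x * ennreal (u x)) \<le> C * X (\<lambda>x. g x * ennreal (u x))"
proof -
  let ?m = "emeasure M (space M)"
  have mb: "muckenhoupt_basis M \<B>" and basis: "is_basis M \<B>" using assms(4) by (auto simp: muckenhoupt_basis_def)
  have um[measurable]: "u \<in> borel_measurable M" and upos: "AE x in M. 0 < u x" using assms(21) by (auto simp: weight_def)
  (* A version of u that is positive everywhere; it agrees with u almost everywhere. *)
  define U where "U x = (if 0 < u x then u x else 1)" for x
  have Um[measurable]: "U \<in> borel_measurable M" unfolding U_def by measurable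
  have U: "0 < U x" for x by (simp add: U_def)
  have uU: "AE x in M. u x = U x" using upos by eventually_elim (simp add: U_def)
  have a: "0 < pminus" "pminus < pX" "pX \<le> qX" "pminus < qX" using assms(7,18,19) by auto
  have "ereal pX \<le> ereal qX" using a by simp
  then have bX: "ereal pX < pplus" using assms(20) by (rule le_less_trans)
  obtain D where D: "0 < D" "bump M \<B> (1 / pminus - 1 / pX) (1 / pX - inv_exponent pplus) U D"
    using bump_of_class[OF basis a(1,2) bX assms(22) Um U uU] by blast
  obtain E where E: "0 < E" "bump M \<B> (1 / pminus - 1 / qX) (1 / qX - inv_exponent pplus) U E"
    using bump_of_class[OF basis a(1,4) assms(20,23) Um U uU] by blast
  obtain p1 p2 D1 D2 where p: "pminus < p1" "p1 < pX" "qX < p2" "ereal p2 < pplus" "p1 \<noteq> p0" "p2 \<noteq> p0" "0 < D1" "0 < D2"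
    "bump M \<B> (1 / pminus - 1 / p1) (1 / p1 - inv_exponent pplus) U D1"
    "bump M \<B> (1 / pminus - 1 / p2) (1 / p2 - inv_exponent pplus) U D2"
    using nearby_exponents[OF basis assms(5) Um U a(1,2,3) assms(20) D E, of p0] by blast
  have p12: "p1 < p2" "0 < p1" using p a by auto
  obtain \<phi> :: "ennreal \<Rightarrow> ennreal \<Rightarrow> ennreal" where \<phi>': "\<forall>a a' b b'. a \<le> a' \<longrightarrow> b \<le> b' \<longrightarrow> \<phi> a b \<le> \<phi> a' b'"
    "\<forall>a b. a < \<infinity> \<longrightarrow> b < \<infinity> \<longrightarrow> \<phi> a b < \<infinity>"
    "\<forall>w\<in>A_class M \<B> (p0 / pminus) \<inter> RH_class M \<B> (holder_conj (pplus / ereal p0)). \<forall>(f, g)\<in>\<F>.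
       Lp_norm (density M w) p0 f \<le> \<phi> (A_const M \<B> (p0 / pminus) w) (RH_const M \<B> (holder_conj (pplus / ereal p0)) w) * Lp_norm (density M w) p0 g"
    using assms(11) by (elim exE conjE) (rule that)
  note \<phi> = \<phi>'(1,2)[rule_format]
  have hyp: "Lp_norm (density M w) p0 f \<le> \<phi> (A_const M \<B> (p0 / pminus) w) (RH_const M \<B> (holder_conj (pplus / ereal p0)) w) * Lp_norm (density M w) p0 g"
    if "w\<in>A_class M \<B> (p0 / pminus) \<inter> RH_class M \<B> (holder_conj (pplus / ereal p0))" "(f, g) \<in> \<F>" for w f g
    using bspec[OF bspec[OF \<phi>'(3) that(1)] that(2)] by simp
  obtain C where C: "1 \<le> C"
    and weak: "\<And>f g. (f, g) \<in> \<F> \<Longrightarrow> modular_dominated M p1 p2 C (\<lambda>x. f x * ennreal (U x)) (\<lambda>x. g x * ennreal (U x))"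
    using weak_modular_estimate[OF assms(1) mb assms(6) Um U p(7,8,9,10) a(1) p(1) p12(1) p(4) assms(9,10) p(5,6) \<phi> hyp] by blast
  obtain K where K: "0 < K" and boyd: "\<And>F G. F \<in> borel_measurable M \<Longrightarrow> G \<in> borel_measurable M \<Longrightarrow>
      modular_dominated M p1 p2 C F G \<Longrightarrow> X F \<le> ennreal K * X G"
    using boyd_interpolation[OF assms(3,15,16,17) p12(2) p(2) a(3) p(3) C] by blast
  show ?thesis
  proof (intro exI[of _ "ennreal K"] conjI ballI)
    fix fg assume "fg \<in> \<F>"
    then obtain f g where fg: "fg = (f, g)" "(f, g) \<in> \<F>" by (cases fg) auto
    have [measurable]: "f \<in> borel_measurable M" "g \<in> borel_measurable M"
      using assms(6) fg by (auto simp: extrapolation_family_def)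
    have cong: "X (\<lambda>x. h x * ennreal (u x)) = X (\<lambda>x. h x * ennreal (U x))"
      if [measurable]: "h \<in> borel_measurable M" for h
      by (intro antisym function_norm_mono[OF assms(12)]) (use uU in auto)
    have "X (\<lambda>x. f x * ennreal (U x)) \<le> ennreal K * X (\<lambda>x. g x * ennreal (U x))"
      by (rule boyd[OF _ _ weak[OF fg(2)]]) measurable
    then show "case fg of (f, g) \<Rightarrow> X (\<lambda>x. f x * ennreal (u x)) \<le> ennreal K * X (\<lambda>x. g x * ennreal (u x))"
      by (simp add: fg(1) cong)
  qed simp
qed

end
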